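(* Let $m,n\in\mathbb{N}$ and let $f\in C^\infty(\mathbb{T}^m\times\mathbb{R}^n)\cap L^1(\mathbb{T}^m\times\mathbb{R}^n)$. Then $f\in\mathcal{S}(\mathbb{T}^m\times\mathbb{R}^n)$ if and only if for each $k\in\mathbb{Z}^m$ the function $\xi\mapsto\widehat{\widehat{f}}(k,\xi)$ is smooth on $\mathbb{R}^n$ and for all $\beta,\gamma\in\mathbb{N}_0^n$ and $N>0$ there exists $C_{N,\beta,\gamma}>0$ such that $$|\xi^\gamma\partial_\xi^\beta\widehat{\widehat{f}}(k,\xi)|\leq C_{N,\beta,\gamma}(1+|k|^2)^{-N/2}(1+|\xi|^2)^{-N/2}$$ for every $k\in\mathbb{Z}^m$ and $\xi\in\mathbb{R}^n$.
   Context: $\mathbb{T}^m=(\mathbb{R}/2\pi\mathbb{Z})^m$; functions on $\mathbb{T}^m\times\mathbb{R}^n$ (variables $(t,x)$) are identified with functions on $\mathbb{R}^{m+n}$ that are $2\pi$-periodic in each of the first $m$ variables. $\mathbb{N}_0$ denotes the nonnegative integers. $\mathcal{S}(\mathbb{T}^m\times\mathbb{R}^n)$ is the set of all $f\in C^\infty(\mathbb{T}^m\times\mathbb{R}^n)$ (complex valued) such that $\sup_{(t,x)\in\mathbb{T}^m\times\mathbb{R}^n}|x^\gamma\partial_t^\alpha\partial_x^\beta f(t,x)|<+\infty$ for all $\alpha\in\mathbb{N}_0^m$, $\beta,\gamma\in\mathbb{N}_0^n$. The mixed partial Fourier transform of $f\in L^1(\mathbb{T}^m\times\mathbb{R}^n)$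 is $\widehat{\widehat{f}}(k,\xi):=\frac{1}{(2\pi)^m}\int_{[0,2\pi]^m}\int_{\mathbb{R}^n}f(t,x)e^{-i(k\cdot t+x\cdot\xi)}\,dx\,dt$ for $k\in\mathbb{Z}^m$, $\xi\in\mathbb{R}^n$. *)

theory Defs
  imports "HOL-Analysis.Analysis"
begin

section \<open>Partial derivatives and smooth functions\<close>

definition partial_deriv ::
    "'a::real_normed_vector \<Rightarrow> ('a \<Rightarrow> 'b::real_normed_vector) \<Rightarrow> 'a \<Rightarrow> 'b" where
  "partial_deriv v f x = vector_derivative (\<lambda>s. f (x + s *\<^sub>R v)) (at 0)"

text \<open>\<open>C_k k f\<close>: all partial derivatives of \<open>f\<close> of order at most \<open>k\<close>, in any order of
  differentiation, exist everywhere and are continuous.\<close>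

primrec C_k :: "nat \<Rightarrow> ('a::euclidean_space \<Rightarrow> 'b::real_normed_vector) \<Rightarrow> bool" where
  "C_k 0 f \<longleftrightarrow> continuous_on UNIV f"
| "C_k (Suc k) f \<longleftrightarrow> continuous_on UNIV f \<and>
     (\<forall>b\<in>Basis. (\<forall>x. (\<lambda>s. f (x + s *\<^sub>R b)) differentiable (at 0)) \<and>
                C_k k (partial_deriv b f))"

definition smooth :: "('a::euclidean_space \<Rightarrow> 'b::real_normed_vector) \<Rightarrow> bool" where
  "smooth f \<longleftrightarrow> (\<forall>k. C_k k f)"

section \<open>Multi-indices\<close>

text \<open>A multi-index in \<open>\<nat>\<^sub>0\<^sup>n\<close> is a function \<open>'n \<Rightarrow> nat\<close>. The index type carries no
  order, so the derivative of a given multi-index is taken along an arbitrary fixed enumeration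
  of the coordinates; for smooth functions the choice is immaterial.\<close>

definition coords :: "'n::finite list" where
  "coords = (SOME is. set is = UNIV \<and> distinct is)"

lemma coords: "set (coords :: 'n::finite list) = UNIV" "distinct (coords :: 'n list)"
proof -
  have "\<exists>is :: 'n list. set is = UNIV \<and> distinct is"
    using finite_distinct_list[of "UNIV :: 'n set"] by auto
  from someI_ex[OF this] show "set (coords :: 'n list) = UNIV" "distinct (coords :: 'n list)"
    by (auto simp: coords_def)
qed

definition multi_deriv ::
    "('n::finite \<Rightarrow> 'a::real_normed_vector) \<Rightarrow> ('n \<Rightarrow> nat) \<Rightarrow>
     ('a \<Rightarrow> 'b::real_normed_vector) \<Rightarrow> 'a \<Rightarrow> 'b" where
  "multi_deriv e \<alpha> f = foldr (\<lambda>i. partial_deriv (e i) ^^ \<alpha> i) coords f"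

abbreviation deriv_t ::
    "('m::finite \<Rightarrow> nat) \<Rightarrow> ((real^'m) \<times> (real^'n::finite) \<Rightarrow> complex) \<Rightarrow> (real^'m) \<times> (real^'n) \<Rightarrow> complex" where
  "deriv_t \<equiv> multi_deriv (\<lambda>i. (axis i 1, 0))"

abbreviation deriv_x ::
    "('n::finite \<Rightarrow> nat) \<Rightarrow> ((real^'m::finite) \<times> (real^'n) \<Rightarrow> complex) \<Rightarrow> (real^'m) \<times> (real^'n) \<Rightarrow> complex" where
  "deriv_x \<equiv> multi_deriv (\<lambda>j. (0, axis j 1))"

abbreviation deriv_xi ::
    "('n::finite \<Rightarrow> nat) \<Rightarrow> (real^'n \<Rightarrow> complex) \<Rightarrow> real^'n \<Rightarrow> complex" where
  "deriv_xi \<equiv> multi_deriv (\<lambda>j. axis j 1)"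

definition monomial :: "real^'n::finite \<Rightarrow> ('n \<Rightarrow> nat) \<Rightarrow> real" where
  "monomial x \<gamma> = (\<Prod>j\<in>UNIV. (x $ j) ^ \<gamma> j)"

section \<open>Function spaces on the product of a torus and a Euclidean space\<close>

definition torus_periodic :: "((real^'m::finite) \<times> (real^'n::finite) \<Rightarrow> complex) \<Rightarrow> bool" where
  "torus_periodic f \<longleftrightarrow> (\<forall>t x i. f (t + (2 * pi) *\<^sub>R axis i 1, x) = f (t, x))"

definition smooth_TR :: "((real^'m::finite) \<times> (real^'n::finite) \<Rightarrow> complex) set" where
  "smooth_TR = {f. torus_periodic f \<and> smooth f}"

definition period_box :: "(real^'m::finite) set" where
  "period_box = cbox 0 (\<chi> i. 2 * pi)"

definition L1_TR :: "((real^'m::finite) \<times> (real^'n::finite) \<Rightarrow> complex) set" where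
  "L1_TR = {f. torus_periodic f \<and> set_integrable lborel (period_box \<times> UNIV) f}"

definition schwartz_TR :: "((real^'m::finite) \<times> (real^'n::finite) \<Rightarrow> complex) set" where
  "schwartz_TR = {f \<in> smooth_TR. \<forall>\<alpha> \<beta> \<gamma>.
     bdd_above (range (\<lambda>(t, x). cmod (of_real (monomial x \<gamma>) * deriv_t \<alpha> (deriv_x \<beta> f) (t, x))))}"

section \<open>The mixed partial Fourier transform\<close>

definition real_vec :: "int^'m::finite \<Rightarrow> real^'m" where
  "real_vec k = (\<chi> i. real_of_int (k $ i))"

definition mixed_fourier ::
    "((real^'m::finite) \<times> (real^'n::finite) \<Rightarrow> complex) \<Rightarrow> int^'m \<Rightarrow> real^'n \<Rightarrow> complex" where
  "mixed_fourier f k \<xi> =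
     1 / (2 * of_real pi) ^ CARD('m) *
     (LINT t:period_box|lborel. (LINT x|lborel.
        f (t, x) * exp (- (\<i> * of_real (real_vec k \<bullet> t + x \<bullet> \<xi>)))))"

end

theory Submission
  imports Defs "HOL-Probability.Probability"
begin

text \<open>
  Write \<open>F = mixed_fourier f\<close>. The proof rests on the symmetry between a function of
  \<open>z = (t, x)\<close> and its transform, a function of \<open>\<kappa> = (k, \<xi>)\<close>. Both conditions of the theorem
  say that something is \<^emph>\<open>rapidly decreasing\<close>: smooth, with every derivative bounded by every
  negative power of a weight. The weight is \<open>1 + \<bar>x\<bar>\<^sup>2\<close> for \<open>f\<close> and
  \<open>(1 + \<bar>k\<bar>\<^sup>2) * (1 + \<bar>\<xi>\<bar>\<^sup>2)\<close>, uniformly in \<open>k\<close>, for \<open>F\<close>. The predicate \<open>rapid\<close> captures both, and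
  \<open>schwartz_TR_iff_rapid_TR\<close> and \<open>rapid_dual_iff\<close> translate the two conditions into it. The
  translation needs that partial derivatives commute, since the given conditions only concern
  derivatives in a fixed order.

  Both the transform and its inverse are integrals of an amplitude against \<open>exp (\<plusminus> \<i> z \<bullet> \<kappa>)\<close>.
  Such an integral is differentiated under the integral sign, which multiplies the amplitude by a
  coordinate, and is multiplied by a coordinate through integration by parts, which
  differentiates the amplitude. So differentiation and multiplication by the weight, as the symbol of
  \<open>1 - \<Delta>\<close>, lead from transforms of rapidly decreasing amplitudes to transforms of rapidly
  decreasing amplitudes, and these transforms are bounded. The locale \<open>transform\<close> contains
  this argument, and it is used twice: \<open>rapid_mixed_fourier\<close> is the forward implication of the
  theorem, and \<open>rapid_inverse_fourier\<close> gives the converse once it is known that \<open>f\<close> is the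
  inverse transform of \<open>F\<close>.

  That last fact, \<open>inverse_fourier_mixed_fourier\<close>, requires that \<open>f\<close> is continuous and
  integrable and that \<open>F\<close> is rapidly decreasing. It combines Fourier inversion on \<open>\<real>\<^sup>n\<close>, proved with
  Gaussian means, for each torus coefficient of \<open>f\<close>, with the uniqueness of Fourier
  coefficients on the torus, proved with the Stone-Weierstrass theorem.
\<close>

section \<open>Directional derivatives of smooth functions\<close>

lemma partial_derivI:
  "((\<lambda>s. f (x + s *\<^sub>R v)) has_vector_derivative D) (at 0) \<Longrightarrow> partial_deriv v f x = D"
  unfolding partial_deriv_def by (rule vector_derivative_at)

lemma has_vector_derivative_along_line:
  fixes f :: "'a::real_normed_vector \<Rightarrow> 'b::real_normed_vector"
  assumes "\<And>x. (\<lambda>s. f (x + s *\<^sub>R v)) differentiable (at 0)"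
  shows "((\<lambda>s. f (x + s *\<^sub>R v)) has_vector_derivative partial_deriv v f (x + r *\<^sub>R v)) (at r within S)"
proof -
  have "((\<lambda>s. f ((x + r *\<^sub>R v) + s *\<^sub>R v)) has_vector_derivative partial_deriv v f (x + r *\<^sub>R v)) (at 0)"
    using assms[of "x + r *\<^sub>R v"] unfolding partial_deriv_def
    by (simp add: vector_derivative_works)
  then have "(((\<lambda>s. f ((x + r *\<^sub>R v) + s *\<^sub>R v)) \<circ> (\<lambda>s. s - r)) has_vector_derivative
      1 *\<^sub>R partial_deriv v f (x + r *\<^sub>R v)) (at r)"
    by (intro vector_diff_chain_at) (auto intro!: derivative_eq_intros)
  then have "((\<lambda>s. f (x + s *\<^sub>R v)) has_vector_derivative partial_deriv v f (x + r *\<^sub>R v)) (at r)"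
    by (simp add: o_def algebra_simps)
  then show ?thesis
    by (rule has_vector_derivative_at_within)
qed

lemma smooth_unfold:
  "smooth f \<longleftrightarrow> continuous_on UNIV f \<and>
     (\<forall>b\<in>Basis. (\<forall>x. (\<lambda>s. f (x + s *\<^sub>R b)) differentiable (at 0)) \<and> smooth (partial_deriv b f))"
proof
  assume f: "smooth f"
  then have "C_k (Suc k) f" for k
    by (simp add: smooth_def del: C_k.simps)
  then show "continuous_on UNIV f \<and>
     (\<forall>b\<in>Basis. (\<forall>x. (\<lambda>s. f (x + s *\<^sub>R b)) differentiable (at 0)) \<and> smooth (partial_deriv b f))"
    unfolding smooth_def C_k.simps by blast
next
  assume f: "continuous_on UNIV f \<and>
     (\<forall>b\<in>Basis. (\<forall>x. (\<lambda>s. f (x + s *\<^sub>R b)) differentiable (at 0)) \<and> smooth (partial_deriv b f))"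
  have "C_k k f" for k
    using f by (cases k) (auto simp: smooth_def)
  then show "smooth f"
    by (simp add: smooth_def)
qed

lemma smooth_imp_continuous: "smooth f \<Longrightarrow> continuous_on UNIV f"
  and smooth_imp_differentiable: "smooth f \<Longrightarrow> b \<in> Basis \<Longrightarrow> (\<lambda>s. f (x + s *\<^sub>R b)) differentiable (at 0)"
  and smooth_partial_deriv: "smooth f \<Longrightarrow> b \<in> Basis \<Longrightarrow> smooth (partial_deriv b f)"
  by (subst (asm) smooth_unfold; simp)+

text \<open>Schwarz's theorem. Differentiating
  \<open>f (x + s a + t b) - f (x + s a) = \<integral>\<^sub>0\<^sup>t \<partial>\<^sub>b f (x + s a + \<tau> b) d\<tau>\<close> in \<open>s\<close> under the integral sign
  gives \<open>\<partial>\<^sub>a f (x + t b) - \<partial>\<^sub>a f x = \<integral>\<^sub>0\<^sup>t \<partial>\<^sub>a \<partial>\<^sub>b f (x + \<tau> b) d\<tau>\<close>; the two mixed derivatives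
  at \<open>x\<close> are the derivatives in \<open>t\<close> of the two sides.\<close>

lemma partial_deriv_commute:
  fixes f :: "'a::euclidean_space \<Rightarrow> complex"
  assumes f: "smooth f" and a: "a \<in> Basis" and b: "b \<in> Basis"
  shows "partial_deriv a (partial_deriv b f) = partial_deriv b (partial_deriv a f)"
proof
  fix x :: 'a
  define fb where "fb = partial_deriv b f"
  define fab where "fab = partial_deriv a fb"
  define fa where "fa = partial_deriv a f"
  note smooth_fb = smooth_partial_deriv[OF f b, folded fb_def]
  have cont_fb: "continuous_on UNIV fb" and cont_fab: "continuous_on UNIV fab"
    using smooth_fb smooth_partial_deriv[OF smooth_fb a] smooth_imp_continuous
    by (auto simp: fab_def)
  note da = has_vector_derivative_along_line[OF smooth_imp_differentiable[OF f a], folded fa_def]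
  note db = has_vector_derivative_along_line[OF smooth_imp_differentiable[OF f b], folded fb_def]
  note dab = has_vector_derivative_along_line[OF smooth_imp_differentiable[OF smooth_fb a], folded fab_def]
  have line: "continuous_on S (\<lambda>\<tau>. g (y + \<tau> *\<^sub>R b))"
    if "continuous_on UNIV g" for g :: "'a \<Rightarrow> complex" and y S
    by (intro continuous_on_compose2[OF that] continuous_intros) auto
  have ftc: "integral {0..t} (\<lambda>\<tau>. fb (y + \<tau> *\<^sub>R b)) = f (y + t *\<^sub>R b) - f y" if "0 \<le> t" for y t
    using fundamental_theorem_of_calculus[OF that, of "\<lambda>\<tau>. f (y + \<tau> *\<^sub>R b)" "\<lambda>\<tau>. fb (y + \<tau> *\<^sub>R b)"]
    by (auto intro!: db)
  have eq: "fa (x + t *\<^sub>R b) - fa x = integral {0..t} (\<lambda>\<tau>. fab (x + \<tau> *\<^sub>R b))" if t: "0 \<le> t" for t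
  proof -
    have "((\<lambda>s. integral (cbox 0 t) (\<lambda>\<tau>. fb (x + \<tau> *\<^sub>R b + s *\<^sub>R a))) has_vector_derivative
        integral (cbox 0 t) (\<lambda>\<tau>. fab (x + \<tau> *\<^sub>R b + 0 *\<^sub>R a))) (at 0 within UNIV)"
    proof (rule leibniz_rule_vector_derivative)
      show "(\<lambda>\<tau>. fb (x + \<tau> *\<^sub>R b + s *\<^sub>R a)) integrable_on cbox 0 t" for s
        by (intro integrable_continuous continuous_on_compose2[OF cont_fb] continuous_intros) auto
      show "continuous_on (UNIV \<times> cbox 0 t) (\<lambda>(s, \<tau>). fab (x + \<tau> *\<^sub>R b + s *\<^sub>R a))"
        unfolding case_prod_beta
        by (intro continuous_on_compose2[OF cont_fab] continuous_intros) auto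
    qed (auto intro!: dab)
    moreover have "integral (cbox 0 t) (\<lambda>\<tau>. fb (x + \<tau> *\<^sub>R b + s *\<^sub>R a))
        = f (x + t *\<^sub>R b + s *\<^sub>R a) - f (x + s *\<^sub>R a)" for s
      using ftc[OF t, of "x + s *\<^sub>R a"] by (simp add: algebra_simps)
    moreover have "((\<lambda>s. f (x + t *\<^sub>R b + s *\<^sub>R a) - f (x + s *\<^sub>R a)) has_vector_derivative
        fa (x + t *\<^sub>R b) - fa x) (at 0)"
      using da[of "x + t *\<^sub>R b" 0 UNIV] da[of x 0 UNIV]
      by (auto intro!: has_vector_derivative_diff)
    ultimately show ?thesis
      using vector_derivative_unique_at by auto
  qed
  have "((\<lambda>t. integral {0..t} (\<lambda>\<tau>. fab (x + \<tau> *\<^sub>R b))) has_vector_derivative fab x) (at 0 within {0..1})"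
    using integral_has_vector_derivative[of 0 1 "\<lambda>\<tau>. fab (x + \<tau> *\<^sub>R b)" 0] line[OF cont_fab] by simp
  then have "((\<lambda>t. fa (x + t *\<^sub>R b) - fa x) has_vector_derivative fab x) (at 0 within {0..1})"
    by (rule has_vector_derivative_transform[rotated 2]) (auto simp: eq)
  moreover have "((\<lambda>t. fa (x + t *\<^sub>R b) - fa x) has_vector_derivative partial_deriv b fa x) (at 0 within {0..1})"
    using has_vector_derivative_along_line
        [OF smooth_imp_differentiable[OF smooth_partial_deriv[OF f a] b, folded fa_def], of x 0]
    by (auto intro!: derivative_eq_intros)
  ultimately have "fab x = partial_deriv b fa x"
    by (rule vector_derivative_unique_within[rotated]) (simp add: trivial_limit_within islimpt_Icc)
  then show "partial_deriv a (partial_deriv b f) x = partial_deriv b (partial_deriv a f) x"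
    by (simp add: fab_def fb_def fa_def)
qed

lemma smooth_funpow_partial_deriv:
  "smooth f \<Longrightarrow> b \<in> Basis \<Longrightarrow> smooth ((partial_deriv b ^^ n) f)"
  by (induction n) (auto intro: smooth_partial_deriv)

lemma smooth_foldr_partial_deriv:
  "smooth f \<Longrightarrow> (\<And>i. e i \<in> Basis) \<Longrightarrow> smooth (foldr (\<lambda>i. partial_deriv (e i) ^^ \<alpha> i) is f)"
  by (induction "is") (auto intro: smooth_funpow_partial_deriv)

lemma smooth_multi_deriv:
  "smooth f \<Longrightarrow> (\<And>i. e i \<in> Basis) \<Longrightarrow> smooth (multi_deriv e \<alpha> f)"
  unfolding multi_deriv_def by (rule smooth_foldr_partial_deriv)

lemma partial_deriv_funpow_commute:
  fixes f :: "'a::euclidean_space \<Rightarrow> complex"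
  assumes "smooth f" "a \<in> Basis" "b \<in> Basis"
  shows "partial_deriv a ((partial_deriv b ^^ n) f) = (partial_deriv b ^^ n) (partial_deriv a f)"
  by (induction n)
    (simp_all add: assms partial_deriv_commute[OF smooth_funpow_partial_deriv, of f b a b])

lemma partial_deriv_foldr_commute:
  fixes f :: "'a::euclidean_space \<Rightarrow> complex"
  assumes f: "smooth f" and e: "\<And>i. e i \<in> Basis" and a: "a \<in> Basis"
  shows "partial_deriv a (foldr (\<lambda>i. partial_deriv (e i) ^^ \<alpha> i) is f)
       = foldr (\<lambda>i. partial_deriv (e i) ^^ \<alpha> i) is (partial_deriv a f)"
  by (induction "is")
    (simp_all add: partial_deriv_funpow_commute[OF smooth_foldr_partial_deriv[OF f e] a e])

lemma partial_deriv_multi_deriv_commute: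
  fixes f :: "'a::euclidean_space \<Rightarrow> complex"
  assumes "smooth f" "\<And>i. e i \<in> Basis" "a \<in> Basis"
  shows "partial_deriv a (multi_deriv e \<alpha> f) = multi_deriv e \<alpha> (partial_deriv a f)"
  unfolding multi_deriv_def by (rule partial_deriv_foldr_commute[OF assms])

text \<open>The new derivative has to travel past all the coordinates that precede \<open>i\<close> in the fixed
  enumeration; this is what makes the family of all \<open>multi_deriv e \<alpha> f\<close> closed under
  differentiation.\<close>

lemma partial_deriv_multi_deriv:
  fixes f :: "'a::euclidean_space \<Rightarrow> complex"
  assumes f: "smooth f" and e: "\<And>i. e i \<in> Basis"
  shows "partial_deriv (e i) (multi_deriv e \<alpha> f) = multi_deriv e (\<alpha>(i := Suc (\<alpha> i))) f"
proof -
  have absent: "foldr (\<lambda>j. partial_deriv (e j) ^^ (\<alpha>(i := Suc (\<alpha> i))) j) is f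
      = foldr (\<lambda>j. partial_deriv (e j) ^^ \<alpha> j) is f" if "i \<notin> set is" for "is"
    using that by (induction "is") auto
  have "partial_deriv (e i) (foldr (\<lambda>j. partial_deriv (e j) ^^ \<alpha> j) is f)
      = foldr (\<lambda>j. partial_deriv (e j) ^^ (\<alpha>(i := Suc (\<alpha> i))) j) is f"
    if "i \<in> set is" "distinct is" for "is"
    using that
  proof (induction "is")
    case (Cons j js)
    show ?case
    proof (cases "i = j")
      case True
      then show ?thesis using Cons.prems absent[of js] by simp
    next
      case False
      have "smooth (foldr (\<lambda>j. partial_deriv (e j) ^^ \<alpha> j) js f)"
        by (rule smooth_foldr_partial_deriv) (auto intro: f e)
      from partial_deriv_funpow_commute[OF this, of "e i" "e j"] show ?thesis
        using Cons False e by simp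
    qed
  qed simp
  then show ?thesis
    unfolding multi_deriv_def using coords[where 'n='b] by blast
qed

section \<open>Rapidly decreasing families\<close>

text \<open>One notion serves both sides of the transform. On the space side the index \<open>k\<close> ranges over
  \<open>unit\<close> and \<open>W\<close> depends on the Euclidean variable only; on the dual side \<open>k\<close> is the lattice
  frequency and the bounds are uniform in it. The definition is coinductive because it then
  suffices, for smoothness and all seminorm bounds at once, to exhibit a class of families that is
  closed under differentiation and whose members themselves satisfy the zeroth order bounds.\<close>

coinductive rapid :: "('k \<Rightarrow> 'a::euclidean_space \<Rightarrow> real) \<Rightarrow> ('k \<Rightarrow> 'a \<Rightarrow> complex) \<Rightarrow> bool"
  for W where
  rapid: "rapid W A"
    if "\<And>k. continuous_on UNIV (A k)"
      and "\<And>k b x. b \<in> Basis \<Longrightarrow> (\<lambda>s. A k (x + s *\<^sub>R b)) differentiable (at 0)"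
      and "\<And>N. \<exists>C. \<forall>k x. W k x ^ N * cmod (A k x) \<le> C"
      and "\<And>b. b \<in> Basis \<Longrightarrow> rapid W (\<lambda>k. partial_deriv b (A k))"

lemma rapid_continuous: "rapid W A \<Longrightarrow> continuous_on UNIV (A k)"
  and rapid_differentiable: "rapid W A \<Longrightarrow> b \<in> Basis \<Longrightarrow> (\<lambda>s. A k (x + s *\<^sub>R b)) differentiable (at 0)"
  and rapid_bound: "rapid W A \<Longrightarrow> \<exists>C. \<forall>k x. W k x ^ N * cmod (A k x) \<le> C"
  and rapid_partial_deriv: "rapid W A \<Longrightarrow> b \<in> Basis \<Longrightarrow> rapid W (\<lambda>k. partial_deriv b (A k))"
  by (auto elim: rapid.cases)

lemma rapid_has_vector_derivative:
  "rapid W A \<Longrightarrow> b \<in> Basis \<Longrightarrow>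
    ((\<lambda>s. A k (x + s *\<^sub>R b)) has_vector_derivative partial_deriv b (A k) (x + r *\<^sub>R b)) (at r within S)"
  by (rule has_vector_derivative_along_line) (rule rapid_differentiable)

lemma rapid_has_vector_derivative_0:
  "rapid W A \<Longrightarrow> b \<in> Basis \<Longrightarrow>
    ((\<lambda>s. A k (x + s *\<^sub>R b)) has_vector_derivative partial_deriv b (A k) x) (at 0)"
  using rapid_has_vector_derivative[of W A b k x 0 UNIV] by simp

lemma rapid_imp_smooth: "rapid W A \<Longrightarrow> smooth (A k)"
proof -
  have "C_k n (A k)" if "rapid W A" for n A
    using that
  proof (induction n arbitrary: A)
    case 0
    then show ?case by (simp add: rapid_continuous)
  next
    case (Suc n)
    then show ?case
      using rapid_continuous rapid_differentiable Suc.IH[OF rapid_partial_deriv] by auto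
  qed
  then show "rapid W A \<Longrightarrow> smooth (A k)"
    by (simp add: smooth_def)
qed

lemma rapid_multi_deriv:
  assumes A: "rapid W A" and e: "\<And>i. e i \<in> Basis"
  shows "rapid W (\<lambda>k. multi_deriv e \<alpha> (A k))"
proof -
  have pow: "rapid W (\<lambda>k. (partial_deriv b ^^ n) (A k))" if "rapid W A" "b \<in> Basis" for A b n
    by (induction n) (auto intro: that rapid_partial_deriv)
  have "rapid W (\<lambda>k. foldr (\<lambda>i. partial_deriv (e i) ^^ \<alpha> i) is (A k))" for "is"
    by (induction "is") (auto intro: A e pow)
  then show ?thesis
    unfolding multi_deriv_def .
qed

lemma rapid_coinduct_derivs:
  assumes "A \<in> X"
    and cont: "\<And>A k. A \<in> X \<Longrightarrow> continuous_on UNIV (A k)"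
    and der: "\<And>A b. A \<in> X \<Longrightarrow> b \<in> Basis \<Longrightarrow>
      \<exists>A'\<in>X. \<forall>k x. ((\<lambda>s. A k (x + s *\<^sub>R b)) has_vector_derivative A' k x) (at 0)"
    and bound: "\<And>A N. A \<in> X \<Longrightarrow> \<exists>C. \<forall>k x. W k x ^ N * cmod (A k x) \<le> C"
  shows "rapid W A"
  using \<open>A \<in> X\<close>
proof (coinduction arbitrary: A)
  case rapid
  have "(\<lambda>k. partial_deriv b (A k)) \<in> X" if b: "b \<in> Basis" for b
  proof -
    from der[OF rapid b] obtain A' where A': "A' \<in> X"
      "\<forall>k x. ((\<lambda>s. A k (x + s *\<^sub>R b)) has_vector_derivative A' k x) (at 0)" by blast
    then have "(\<lambda>k. partial_deriv b (A k)) = A'"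
      by (intro ext partial_derivI) blast
    with A' show ?thesis by simp
  qed
  moreover have "(\<lambda>s. A k (x + s *\<^sub>R b)) differentiable at 0" if b: "b \<in> Basis" for k b x
    using der[OF rapid b] by (auto intro: differentiableI_vector)
  ultimately show ?case
    using cont[OF rapid] bound[OF rapid] by blast
qed

lemma rapid_lincomb:
  assumes "rapid W A" "rapid W B" and W: "\<And>k x. 0 \<le> W k x"
  shows "rapid W (\<lambda>k x. c * A k x + d * B k x)"
proof (rule rapid_coinduct_derivs)
  show "(\<lambda>k x. c * A k x + d * B k x)
      \<in> {\<lambda>k x. c * A k x + d * B k x | A B. rapid W A \<and> rapid W B}"
    using assms by blast
next
  fix F k assume "F \<in> {\<lambda>k x. c * A k x + d * B k x | A B. rapid W A \<and> rapid W B}"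
  then show "continuous_on UNIV (F k)"
    by (auto intro!: continuous_intros dest: rapid_continuous)
next
  fix F N assume "F \<in> {\<lambda>k x. c * A k x + d * B k x | A B. rapid W A \<and> rapid W B}"
  then obtain A B where F: "F = (\<lambda>k x. c * A k x + d * B k x)" and AB: "rapid W A" "rapid W B"
    by blast
  obtain C D where C: "W k x ^ N * cmod (A k x) \<le> C" and D: "W k x ^ N * cmod (B k x) \<le> D" for k x
    using rapid_bound[OF AB(1)] rapid_bound[OF AB(2)] by meson
  have "W k x ^ N * cmod (F k x) \<le> cmod c * C + cmod d * D" for k x
  proof -
    have "W k x ^ N * cmod (F k x) \<le> W k x ^ N * (cmod c * cmod (A k x) + cmod d * cmod (B k x))"
      using norm_triangle_ineq[of "c * A k x" "d * B k x"] W
      by (intro mult_left_mono) (auto simp: F norm_mult)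
    also have "\<dots> = cmod c * (W k x ^ N * cmod (A k x)) + cmod d * (W k x ^ N * cmod (B k x))"
      by (simp add: algebra_simps)
    also have "\<dots> \<le> cmod c * C + cmod d * D"
      by (intro add_mono mult_left_mono C D) auto
    finally show ?thesis .
  qed
  then show "\<exists>C. \<forall>k x. W k x ^ N * cmod (F k x) \<le> C" by blast
next
  fix F b assume "F \<in> {\<lambda>k x. c * A k x + d * B k x | A B. rapid W A \<and> rapid W B}"
    and b: "b \<in> (Basis :: 'b set)"
  then obtain A B where F: "F = (\<lambda>k x. c * A k x + d * B k x)" and AB: "rapid W A" "rapid W B"
    by blast
  have "((\<lambda>s. F k (x + s *\<^sub>R b)) has_vector_derivative
      c * partial_deriv b (A k) x + d * partial_deriv b (B k) x) (at 0)" for k x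
    unfolding F
    by (intro has_vector_derivative_add has_vector_derivative_mult_right
        rapid_has_vector_derivative_0[OF AB(1) b] rapid_has_vector_derivative_0[OF AB(2) b])
  then show "\<exists>F'\<in>{\<lambda>k x. c * A k x + d * B k x | A B. rapid W A \<and> rapid W B}.
      \<forall>k x. ((\<lambda>s. F k (x + s *\<^sub>R b)) has_vector_derivative F' k x) (at 0)"
    using rapid_partial_deriv[OF AB(1) b] rapid_partial_deriv[OF AB(2) b]
    by (intro bexI[of _ "\<lambda>k x. c * partial_deriv b (A k) x + d * partial_deriv b (B k) x"] CollectI
        exI[of _ "\<lambda>k. partial_deriv b (A k)"] exI[of _ "\<lambda>k. partial_deriv b (B k)"] conjI refl) auto
qed

lemma rapid_cmult: "rapid W A \<Longrightarrow> (\<And>k x. 0 \<le> W k x) \<Longrightarrow> rapid W (\<lambda>k x. c * A k x)"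
  using rapid_lincomb[of W A A c 0] by simp

text \<open>The derivative of \<open>q A + B\<close>, for an affine factor \<open>q\<close>, is again of the form \<open>q A' + B'\<close> since
  the derivative of \<open>q\<close> is constant; so these combinations form a class closed under
  differentiation, and one power of \<open>W\<close> absorbs the factor \<open>q\<close>.\<close>

lemma rapid_affine_mult:
  fixes a :: "'k \<Rightarrow> real" and u :: "'a::euclidean_space"
  assumes "rapid W A" and W: "\<And>k x. 0 \<le> W k x" and q: "\<And>k x. \<bar>a k + x \<bullet> u\<bar> \<le> W k x"
  shows "rapid W (\<lambda>k x. of_real (a k + x \<bullet> u) * A k x)"
proof -
  define X where "X = {\<lambda>k x. of_real (a k + x \<bullet> u) * A k x + B k x | A B. rapid W A \<and> rapid W B}"
  show ?thesis
  proof (rule rapid_coinduct_derivs)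
    have "rapid W (\<lambda>k x. 0 * A k x)" by (intro rapid_cmult assms)
    then show "(\<lambda>k x. of_real (a k + x \<bullet> u) * A k x) \<in> X"
      using assms(1) unfolding X_def by (intro CollectI exI[of _ A] exI[of _ "\<lambda>k x. 0 * A k x"]) auto
  next
    fix F k assume "F \<in> X"
    then show "continuous_on UNIV (F k)"
      by (auto simp: X_def intro!: continuous_intros dest: rapid_continuous)
  next
    fix F N assume "F \<in> X"
    then obtain A B where F: "F = (\<lambda>k x. of_real (a k + x \<bullet> u) * A k x + B k x)"
      and AB: "rapid W A" "rapid W B"
      unfolding X_def by blast
    obtain C D where C: "W k x ^ Suc N * cmod (A k x) \<le> C" and D: "W k x ^ N * cmod (B k x) \<le> D" for k x
      using rapid_bound[OF AB(1)] rapid_bound[OF AB(2)] by meson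
    have "W k x ^ N * cmod (F k x) \<le> C + D" for k x
    proof -
      have "cmod (F k x) \<le> cmod (of_real (a k + x \<bullet> u) * A k x) + cmod (B k x)"
        unfolding F by (rule norm_triangle_ineq)
      also have "\<dots> = \<bar>a k + x \<bullet> u\<bar> * cmod (A k x) + cmod (B k x)"
        unfolding norm_mult norm_of_real ..
      also have "\<dots> \<le> W k x * cmod (A k x) + cmod (B k x)"
        by (intro add_mono mult_right_mono q) auto
      finally have "W k x ^ N * cmod (F k x) \<le> W k x ^ N * (W k x * cmod (A k x) + cmod (B k x))"
        using W by (intro mult_left_mono) auto
      also have "\<dots> = W k x ^ Suc N * cmod (A k x) + W k x ^ N * cmod (B k x)"
        by (simp add: algebra_simps)
      also have "\<dots> \<le> C + D"
        by (intro add_mono C D)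
      finally show ?thesis .
    qed
    then show "\<exists>C. \<forall>k x. W k x ^ N * cmod (F k x) \<le> C" by blast
  next
    fix F and b :: 'a assume "F \<in> X" and b: "b \<in> Basis"
    then obtain A B where F: "F = (\<lambda>k x. of_real (a k + x \<bullet> u) * A k x + B k x)"
      and AB: "rapid W A" "rapid W B"
      unfolding X_def by blast
    let ?B' = "\<lambda>k x. of_real (b \<bullet> u) * A k x + 1 * partial_deriv b (B k) x"
    let ?F' = "\<lambda>k x. of_real (a k + x \<bullet> u) * partial_deriv b (A k) x + ?B' k x"
    have "((\<lambda>s. F k (x + s *\<^sub>R b)) has_vector_derivative ?F' k x) (at 0)" for k x
    proof -
      have "((\<lambda>s. of_real (a k + (x + s *\<^sub>R b) \<bullet> u) :: complex) has_vector_derivative of_real (b \<bullet> u)) (at 0)"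
        by (rule has_vector_derivative_of_real)
          (auto simp: inner_add_left has_real_derivative_iff_has_vector_derivative[symmetric]
            intro!: derivative_eq_intros)
      then show ?thesis
        unfolding F
        using has_vector_derivative_add[OF has_vector_derivative_mult[OF _
              rapid_has_vector_derivative_0[OF AB(1) b, of k x]]
              rapid_has_vector_derivative_0[OF AB(2) b, of k x]]
        by (fastforce simp: add.assoc)
    qed
    moreover have "rapid W ?B'"
      by (intro rapid_lincomb rapid_partial_deriv AB b W)
    then have "?F' \<in> X"
      unfolding X_def using rapid_partial_deriv[OF AB(1) b]
      by (intro CollectI exI[of _ "\<lambda>k. partial_deriv b (A k)"] exI[of _ ?B'] conjI refl)
    ultimately show "\<exists>F'\<in>X. \<forall>k x. ((\<lambda>s. F k (x + s *\<^sub>R b)) has_vector_derivative F' k x) (at 0)"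
      by (intro bexI[of _ ?F']) auto
  qed
qed

section \<open>Monomials and weights\<close>

lemma abs_nth_le_weight: "\<bar>x $ j\<bar> \<le> 1 + (norm x)\<^sup>2" for x :: "real^'n::finite"
proof -
  have "\<bar>x $ j\<bar> \<le> norm x" by (rule component_le_norm_cart)
  also have "\<dots> \<le> 1 + (norm x)\<^sup>2"
    using sum_squares_ge_zero[of "norm x - 1/2" 0] by (auto simp: power2_eq_square algebra_simps)
  finally show ?thesis .
qed

lemma abs_monomial_le: "\<bar>monomial x \<gamma>\<bar> \<le> (1 + (norm x)\<^sup>2) ^ (\<Sum>j\<in>UNIV. \<gamma> j)"
  unfolding monomial_def abs_prod power_sum power_abs
  by (intro prod_mono conjI power_mono abs_nth_le_weight) auto

lemma monomial_0: "monomial x (\<lambda>_. 0) = 1"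
  by (simp add: monomial_def)

lemma monomial_single: "monomial x (\<lambda>i. if i = j then p else 0) = (x $ j) ^ p"
proof -
  have "monomial x (\<lambda>i. if i = j then p else 0) = (\<Prod>i\<in>UNIV. if i = j then (x $ i) ^ p else 1)"
    unfolding monomial_def by (intro prod.cong) auto
  then show ?thesis by simp
qed

text \<open>Conversely the finitely many monomials \<open>1\<close> and \<open>x\<^sub>j\<^sup>2\<^sup>N\<close> dominate a power of the weight:
  the norm is controlled by the coordinate of largest modulus.\<close>

lemma weight_power_le:
  fixes x :: "real^'n::finite"
  shows "(1 + (norm x)\<^sup>2) ^ N \<le> (1 + real CARD('n)) ^ N * (1 + (\<Sum>j\<in>UNIV. \<bar>x $ j\<bar> ^ (2 * N)))"
proof -
  define M where "M = Max (range (\<lambda>j. \<bar>x $ j\<bar>))"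
  have M: "\<bar>x $ j\<bar> \<le> M" for j
    unfolding M_def by (intro Max_ge) auto
  obtain j where j: "M = \<bar>x $ j\<bar>"
    using Max_in[of "range (\<lambda>j. \<bar>x $ j\<bar>)"] unfolding M_def by (force simp del: Max_in)
  have "(norm x)\<^sup>2 = (\<Sum>i\<in>UNIV. (x $ i)\<^sup>2)"
    by (simp add: norm_vec_def L2_set_def sum_nonneg)
  also have "\<dots> \<le> (\<Sum>i\<in>(UNIV::'n set). M\<^sup>2)"
    by (intro sum_mono) (metis M abs_ge_zero power2_abs power_mono)
  finally have norm: "(norm x)\<^sup>2 \<le> CARD('n) * M\<^sup>2" by simp
  have "1 + (norm x)\<^sup>2 \<le> (1 + real CARD('n)) * max 1 (M\<^sup>2)"
  proof -
    have "1 + (norm x)\<^sup>2 \<le> max 1 (M\<^sup>2) + CARD('n) * max 1 (M\<^sup>2)"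
      using norm by (intro add_mono order_trans[OF norm] mult_left_mono) auto
    then show ?thesis by (simp add: algebra_simps)
  qed
  then have "(1 + (norm x)\<^sup>2) ^ N \<le> ((1 + real CARD('n)) * max 1 (M\<^sup>2)) ^ N"
    by (intro power_mono) auto
  also have "\<dots> = (1 + real CARD('n)) ^ N * max 1 (M\<^sup>2) ^ N"
    by (simp add: power_mult_distrib)
  also have "max 1 (M\<^sup>2) ^ N \<le> 1 + \<bar>x $ j\<bar> ^ (2 * N)"
    by (auto simp: max_def j power_mult)
  also have "\<dots> \<le> 1 + (\<Sum>j\<in>UNIV. \<bar>x $ j\<bar> ^ (2 * N))"
    by (intro add_left_mono member_le_sum) auto
  finally show ?thesis by (simp add: mult_left_mono)
qed

section \<open>Oscillatory integrals\<close>

lemma norm_cis_diff_le: "cmod (cis a - cis b) \<le> \<bar>a - b\<bar>"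
proof -
  have "cmod (exp (\<i> * complex_of_real (a - b)) - 1) \<le> \<bar>a - b\<bar>"
    by (rule order_trans[OF _ iexp_approx1[of "a - b" 0, simplified]]) simp
  moreover have "cis a - cis b = cis b * (exp (\<i> * complex_of_real (a - b)) - 1)"
    by (simp only: cis_conv_exp[symmetric] right_diff_distrib cis_mult) simp
  ultimately show ?thesis
    by (simp add: norm_mult)
qed

definition osc :: "'w measure \<Rightarrow> ('w \<Rightarrow> 'a::euclidean_space) \<Rightarrow> ('w \<Rightarrow> complex) \<Rightarrow> 'a \<Rightarrow> complex" where
  "osc M Y a \<eta> = (\<integral>w. a w * cis (Y w \<bullet> \<eta>) \<partial>M)"

lemma measurable_cis [measurable]: "f \<in> borel_measurable M \<Longrightarrow> (\<lambda>w. cis (f w)) \<in> borel_measurable M"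
  unfolding cis_conv_exp by measurable

lemma integrable_mult_cis:
  assumes "integrable M a" "f \<in> borel_measurable M"
  shows "integrable M (\<lambda>w. a w * cis (f w))"
  by (rule Bochner_Integration.integrable_bound[OF assms(1)]) (use assms in \<open>auto simp: norm_mult\<close>)

lemma norm_osc_le: "cmod (osc M Y a \<eta>) \<le> (\<integral>w. cmod (a w) \<partial>M)"
  unfolding osc_def by (rule order_trans[OF integral_norm_bound]) (simp add: norm_mult)

lemma continuous_on_osc:
  assumes a: "integrable M a" and Y: "Y \<in> borel_measurable M"
  shows "continuous_on UNIV (osc M Y a)"
proof (rule continuous_at_imp_continuous_on, intro ballI)
  fix \<eta> :: 'b
  note [measurable] = borel_measurable_integrable[OF a] Y
  show "isCont (osc M Y a) \<eta>"
    unfolding continuous_at_sequentially o_def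
  proof (intro allI impI)
    fix X assume X: "X \<longlonglongrightarrow> \<eta>"
    show "(\<lambda>n. osc M Y a (X n)) \<longlonglongrightarrow> osc M Y a \<eta>"
      unfolding osc_def
    proof (rule integral_dominated_convergence[where w = "\<lambda>w. cmod (a w)"])
      show "AE w in M. (\<lambda>n. a w * cis (Y w \<bullet> X n)) \<longlonglongrightarrow> a w * cis (Y w \<bullet> \<eta>)"
      proof (rule AE_I2)
        fix w
        have "isCont cis z" for z
          unfolding cis_conv_exp by (intro continuous_intros)
        then show "(\<lambda>n. a w * cis (Y w \<bullet> X n)) \<longlonglongrightarrow> a w * cis (Y w \<bullet> \<eta>)"
          by (intro tendsto_intros isCont_tendsto_compose[of _ cis] X)
      qed
    qed (use a in \<open>auto simp: norm_mult\<close>)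
  qed
qed

lemma cis_linear_derivative:
  "((\<lambda>s. cis (a + s * b)) has_vector_derivative \<i> * of_real b * cis (a + r * b)) (at r within S)"
proof -
  have "((\<lambda>z. exp (\<i> * (of_real a + z * of_real b))) has_field_derivative
      \<i> * of_real b * exp (\<i> * (of_real a + of_real r * of_real b))) (at (of_real r))"
    by (auto intro!: derivative_eq_intros)
  from has_vector_derivative_real_field[OF this]
  show ?thesis
    by (simp add: cis_conv_exp)
qed

lemma has_vector_derivative_0_iff_quotient:
  fixes f :: "real \<Rightarrow> complex"
  shows "(f has_vector_derivative D) (at 0) \<longleftrightarrow> ((\<lambda>s. (f s - f 0) /\<^sub>R s) \<longlongrightarrow> D) (at 0)"
proof -
  have "((\<lambda>s. norm (f s - f 0 - s *\<^sub>R D) / norm s) \<longlongrightarrow> 0) (at 0) \<longleftrightarrow>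
      ((\<lambda>s. norm ((f s - f 0) /\<^sub>R s - D)) \<longlongrightarrow> 0) (at 0)"
  proof (rule tendsto_cong, rule eventually_at_filter[THEN iffD2], rule always_eventually, intro allI impI)
    fix s :: real assume "s \<noteq> 0"
    then have "(f s - f 0) /\<^sub>R s - D = (f s - f 0 - s *\<^sub>R D) /\<^sub>R s"
      by (simp add: scaleR_diff_right)
    then show "norm (f s - f 0 - s *\<^sub>R D) / norm s = norm ((f s - f 0) /\<^sub>R s - D)"
      by (simp add: divide_inverse mult.commute)
  qed
  then show ?thesis
    unfolding has_vector_derivative_def has_derivative_at
    by (simp add: bounded_linear_scaleR_left tendsto_norm_zero_iff Lim_null[symmetric])
qed

text \<open>Dominated convergence for the difference quotients: \<open>cis\<close> is 1-Lipschitz, so they are bounded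
  by \<open>\<bar>Y w \<bullet> v\<bar> * cmod (a w)\<close>.\<close>

lemma has_vector_derivative_osc:
  assumes a: "integrable M a" and Y: "Y \<in> borel_measurable M"
    and b: "integrable M (\<lambda>w. \<i> * of_real (Y w \<bullet> v) * a w)"
  shows "((\<lambda>s. osc M Y a (\<eta> + s *\<^sub>R v)) has_vector_derivative
      osc M Y (\<lambda>w. \<i> * of_real (Y w \<bullet> v) * a w) \<eta>) (at 0)"
proof -
  note [measurable] = borel_measurable_integrable[OF a] borel_measurable_integrable[OF b] Y
  let ?q = "\<lambda>s w. (a w * cis (Y w \<bullet> (\<eta> + s *\<^sub>R v)) - a w * cis (Y w \<bullet> \<eta>)) /\<^sub>R s"
  have "((\<lambda>s. (osc M Y a (\<eta> + s *\<^sub>R v) - osc M Y a \<eta>) /\<^sub>R s) \<longlongrightarrow>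
      osc M Y (\<lambda>w. \<i> * of_real (Y w \<bullet> v) * a w) \<eta>) (at 0)"
    unfolding tendsto_at_iff_sequentially o_def
  proof (intro allI impI)
    fix X :: "nat \<Rightarrow> real"
    assume "\<forall>i. X i \<in> UNIV - {0}" and lim: "X \<longlonglongrightarrow> 0"
    then have X: "X i \<noteq> 0" for i by auto
    have "(\<lambda>n. \<integral>w. ?q (X n) w \<partial>M) \<longlonglongrightarrow> osc M Y (\<lambda>w. \<i> * of_real (Y w \<bullet> v) * a w) \<eta>"
      unfolding osc_def
    proof (rule integral_dominated_convergence[where w = "\<lambda>w. cmod (\<i> * of_real (Y w \<bullet> v) * a w)"])
      show "AE w in M. (\<lambda>n. ?q (X n) w) \<longlonglongrightarrow> \<i> * of_real (Y w \<bullet> v) * a w * cis (Y w \<bullet> \<eta>)"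
      proof (rule AE_I2)
        fix w
        have "((\<lambda>s. a w * cis (Y w \<bullet> \<eta> + s * (Y w \<bullet> v))) has_vector_derivative
            a w * (\<i> * of_real (Y w \<bullet> v) * cis (Y w \<bullet> \<eta> + 0 * (Y w \<bullet> v)))) (at 0)"
          by (intro has_vector_derivative_mult_right cis_linear_derivative)
        then have "((\<lambda>s. ?q s w) \<longlongrightarrow> \<i> * of_real (Y w \<bullet> v) * a w * cis (Y w \<bullet> \<eta>)) (at 0)"
          by (simp add: has_vector_derivative_0_iff_quotient inner_add_right mult_ac)
        then show "(\<lambda>n. ?q (X n) w) \<longlonglongrightarrow> \<i> * of_real (Y w \<bullet> v) * a w * cis (Y w \<bullet> \<eta>)"
          using X lim unfolding tendsto_at_iff_sequentially o_def by blast
      qed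
      show "AE w in M. norm (?q (X n) w) \<le> cmod (\<i> * of_real (Y w \<bullet> v) * a w)" for n
      proof (rule AE_I2)
        fix w
        have "norm (?q (X n) w) = cmod (a w) * cmod (cis (Y w \<bullet> (\<eta> + X n *\<^sub>R v)) - cis (Y w \<bullet> \<eta>)) / \<bar>X n\<bar>"
          unfolding right_diff_distrib[symmetric] by (simp add: norm_mult divide_inverse mult_ac)
        also have "\<dots> \<le> cmod (a w) * \<bar>X n * (Y w \<bullet> v)\<bar> / \<bar>X n\<bar>"
          using norm_cis_diff_le[of "Y w \<bullet> (\<eta> + X n *\<^sub>R v)" "Y w \<bullet> \<eta>"]
          by (intro divide_right_mono mult_left_mono) (auto simp: inner_add_right)
        also have "\<dots> = cmod (\<i> * of_real (Y w \<bullet> v) * a w)"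
          using X[of n] by (simp add: norm_mult abs_mult)
        finally show "norm (?q (X n) w) \<le> cmod (\<i> * of_real (Y w \<bullet> v) * a w)" .
      qed
    qed (use integrable_norm[OF b] in auto)
    moreover have "(\<integral>w. ?q s w \<partial>M) = (osc M Y a (\<eta> + s *\<^sub>R v) - osc M Y a \<eta>) /\<^sub>R s" for s
      unfolding osc_def by (simp add: Bochner_Integration.integral_diff integrable_mult_cis a)
    ultimately show "(\<lambda>n. (osc M Y a (\<eta> + X n *\<^sub>R v) - osc M Y a \<eta>) /\<^sub>R X n)
        \<longlonglongrightarrow> osc M Y (\<lambda>w. \<i> * of_real (Y w \<bullet> v) * a w) \<eta>"
      by (simp only:)
  qed
  then show ?thesis
    by (simp add: has_vector_derivative_0_iff_quotient)
qed

section \<open>Integration by parts\<close>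

lemma has_bochner_integral_translate:
  fixes f :: "'a::euclidean_space \<Rightarrow> complex"
  assumes "has_bochner_integral lborel f I"
  shows "has_bochner_integral lborel (\<lambda>x. f (x + c)) I"
proof -
  have f: "integrable lborel f" "integral\<^sup>L lborel f = I"
    using assms by (auto simp: has_bochner_integral_iff)
  then have "integrable (distr lborel borel ((+) c)) f" "integral\<^sup>L (distr lborel borel ((+) c)) f = I"
    by (simp_all add: lborel_distr_plus)
  then show ?thesis
    using f by (simp add: integrable_distr_eq integral_distr has_bochner_integral_iff add.commute)
qed

text \<open>Integration by parts in the form that a directional derivative has vanishing integral.
  Integrating \<open>h' (x + s v)\<close> over \<open>0 \<le> s \<le> p\<close> gives \<open>h (x + p v) - h x\<close>, whose integral over
  \<open>B\<close> is 0 by invariance; by Fubini and invariance again the same double integral is \<open>p\<close> times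
  the integral of \<open>h'\<close>. Working with integrals of translates avoids boundary terms and limits at
  infinity. The predicate \<open>P\<close> singles out the functions whose integral over \<open>B\<close> is invariant
  under the translations: all functions if \<open>B\<close> is invariant along \<open>v\<close>, and the periodic ones if
  \<open>B\<close> is a period cell.\<close>

lemma integral_derivative_eq_0:
  fixes h h' :: "'a::euclidean_space \<Rightarrow> complex" and v :: 'a
  assumes p: "0 < p"
    and B[measurable]: "B \<in> sets borel"
    and h: "integrable lborel (\<lambda>x. indicator B x *\<^sub>R h x)"
    and h': "integrable lborel (\<lambda>x. indicator B x *\<^sub>R h' x)" and [measurable]: "h' \<in> borel_measurable borel"
    and der: "\<And>x s. ((\<lambda>s. h (x + s *\<^sub>R v)) has_vector_derivative h' (x + s *\<^sub>R v)) (at s)"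
    and cont: "\<And>x. continuous_on UNIV (\<lambda>s. h' (x + s *\<^sub>R v))"
    and shift: "\<And>\<phi> s. P \<phi> \<Longrightarrow> 0 \<le> s \<Longrightarrow> s \<le> p \<Longrightarrow> integrable lborel (\<lambda>x. indicator B x *\<^sub>R \<phi> x) \<Longrightarrow>
      has_bochner_integral lborel (\<lambda>x. indicator B x *\<^sub>R \<phi> (x + s *\<^sub>R v)) (\<integral>x. indicator B x *\<^sub>R \<phi> x \<partial>lborel)"
    and P: "P h" "P h'" "P (\<lambda>x. complex_of_real (cmod (h' x)))"
  shows "(\<integral>x. indicator B x *\<^sub>R h' x \<partial>lborel) = 0"
proof -
  let ?I = "\<integral>x. indicator B x *\<^sub>R h' x \<partial>lborel"
  let ?g = "\<lambda>s x. indicator {0..p} s *\<^sub>R (indicator B x *\<^sub>R h' (x + s *\<^sub>R v))"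
  note shift_h' = shift[OF P(2) _ _ h']
  have "integrable lborel (\<lambda>x. complex_of_real (cmod (indicator B x *\<^sub>R h' x)))"
    using integrable_norm[OF h'] by (rule integrable_of_real)
  then have abs: "integrable lborel (\<lambda>x. indicator B x *\<^sub>R complex_of_real (cmod (h' x)))"
    by (rule back_subst[of "integrable lborel"]) (auto simp: indicator_def)
  define J where "J = (\<integral>x. indicator B x *\<^sub>R cmod (h' x) \<partial>lborel)"
  have J: "(\<integral>x. indicator B x *\<^sub>R cmod (h' (x + s *\<^sub>R v)) \<partial>lborel) = J" if "0 \<le> s" "s \<le> p" for s
  proof -
    have "(\<integral>x. complex_of_real (indicator B x *\<^sub>R cmod (h' (x + s *\<^sub>R v))) \<partial>lborel)
        = (\<integral>x. complex_of_real (indicator B x *\<^sub>R cmod (h' x)) \<partial>lborel)"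
      using has_bochner_integral_integral_eq[OF shift[OF P(3) that abs]]
      by (simp add: scaleR_conv_of_real)
    then show ?thesis
      unfolding integral_complex_of_real J_def of_real_eq_iff .
  qed
  have int: "integrable (lborel \<Otimes>\<^sub>M lborel) (\<lambda>(s, x). ?g s x)"
  proof (rule lborel_pair.Fubini_integrable)
    show "integrable lborel (\<lambda>s. \<integral>x. norm (case (s, x) of (s, x) \<Rightarrow> ?g s x) \<partial>lborel)"
    proof -
      have "(\<lambda>s. \<integral>x. norm (case (s, x) of (s, x) \<Rightarrow> ?g s x) \<partial>lborel) = (\<lambda>s. indicator {0..p} s *\<^sub>R J)"
        using J by (auto simp: indicator_def fun_eq_iff cong: if_cong)
      moreover have "integrable lborel (indicator {0..p} :: real \<Rightarrow> real)"
        by (intro integrable_real_indicator) (auto simp: emeasure_lborel_Icc_eq)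
      ultimately show ?thesis by simp
    qed
    show "AE s in lborel. integrable lborel (\<lambda>x. case (s, x) of (s, x) \<Rightarrow> ?g s x)"
    proof (rule AE_I2)
      fix s
      show "integrable lborel (\<lambda>x. case (s, x) of (s, x) \<Rightarrow> ?g s x)"
        using has_bochner_integral_iff[THEN iffD1, OF shift_h'[of s]] by (cases "s \<in> {0..p}") auto
    qed
  qed measurable
  have "(\<integral>s. (\<integral>x. ?g s x \<partial>lborel) \<partial>lborel) = (\<integral>s. indicator {0..p} s *\<^sub>R ?I \<partial>lborel)"
  proof (rule Bochner_Integration.integral_cong[OF refl])
    fix s
    show "(\<integral>x. ?g s x \<partial>lborel) = indicator {0..p} s *\<^sub>R ?I"
      using has_bochner_integral_integral_eq[OF shift_h'[of s]] by (cases "s \<in> {0..p}") auto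
  qed
  also have "\<dots> = p *\<^sub>R ?I"
    using p by simp
  finally have 1: "(\<integral>s. (\<integral>x. ?g s x \<partial>lborel) \<partial>lborel) = p *\<^sub>R ?I" .
  have "(\<integral>x. (\<integral>s. ?g s x \<partial>lborel) \<partial>lborel)
      = (\<integral>x. indicator B x *\<^sub>R h (x + p *\<^sub>R v) - indicator B x *\<^sub>R h x \<partial>lborel)"
  proof (rule Bochner_Integration.integral_cong[OF refl])
    fix x
    have "(\<integral>s. indicator {0..p} s *\<^sub>R h' (x + s *\<^sub>R v) \<partial>lborel) = h (x + p *\<^sub>R v) - h (x + 0 *\<^sub>R v)"
      using p by (intro integral_FTC_atLeastAtMost has_vector_derivative_at_within[OF der]
          continuous_on_subset[OF cont]) auto
    then show "(\<integral>s. ?g s x \<partial>lborel) = indicator B x *\<^sub>R h (x + p *\<^sub>R v) - indicator B x *\<^sub>R h x"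
      by (cases "x \<in> B") auto
  qed
  also have "\<dots> = 0"
  proof -
    have "has_bochner_integral lborel (\<lambda>x. indicator B x *\<^sub>R h (x + p *\<^sub>R v)) (\<integral>x. indicator B x *\<^sub>R h x \<partial>lborel)"
      using p by (intro shift P h) auto
    then show ?thesis
      using h by (subst Bochner_Integration.integral_diff) (auto simp: has_bochner_integral_iff)
  qed
  finally have "p *\<^sub>R ?I = 0"
    using lborel_pair.Fubini_integral[OF int] 1 by simp
  then show ?thesis
    using p by simp
qed

lemma integral_derivative_eq_0_line:
  fixes h h' :: "'a::euclidean_space \<Rightarrow> complex" and v :: 'a
  assumes B: "B \<in> sets borel" and inv: "\<And>x s. x + s *\<^sub>R v \<in> B \<longleftrightarrow> x \<in> B"
    and h: "integrable lborel (\<lambda>x. indicator B x *\<^sub>R h x)"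
    and h': "integrable lborel (\<lambda>x. indicator B x *\<^sub>R h' x)" "h' \<in> borel_measurable borel"
    and der: "\<And>x s. ((\<lambda>s. h (x + s *\<^sub>R v)) has_vector_derivative h' (x + s *\<^sub>R v)) (at s)"
    and cont: "\<And>x. continuous_on UNIV (\<lambda>s. h' (x + s *\<^sub>R v))"
  shows "(\<integral>x. indicator B x *\<^sub>R h' x \<partial>lborel) = 0"
proof (rule integral_derivative_eq_0[where P = "\<lambda>_. True" and p = 1, OF _ B h h' der cont])
  fix \<phi> :: "'a \<Rightarrow> complex" and s :: real
  assume "integrable lborel (\<lambda>x. indicator B x *\<^sub>R \<phi> x)"
  then have "has_bochner_integral lborel (\<lambda>x. indicator B x *\<^sub>R \<phi> x) (\<integral>x. indicator B x *\<^sub>R \<phi> x \<partial>lborel)"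
    by (simp add: has_bochner_integral_iff)
  from has_bochner_integral_translate[OF this, of "s *\<^sub>R v"]
  show "has_bochner_integral lborel (\<lambda>x. indicator B x *\<^sub>R \<phi> (x + s *\<^sub>R v)) (\<integral>x. indicator B x *\<^sub>R \<phi> x \<partial>lborel)"
    by (simp add: indicator_def inv)
qed auto

lemma AE_lborel_inner_neq:
  assumes "b \<in> Basis"
  shows "AE x in lborel. x \<bullet> b \<noteq> c"
proof -
  have "{x. x \<bullet> b = c} \<in> null_sets (completion lborel)"
    using negligible_standard_hyperplane[OF assms, of c] by (simp add: negligible_iff_null_sets)
  then have "{x. x \<bullet> b = c} \<in> null_sets lborel"
    by (subst (asm) null_sets_completion_iff) (auto intro!: closed_Collect_eq continuous_intros borel_closed)
  then show ?thesis
    by (rule AE_I') auto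
qed

text \<open>Shifting a period cell by \<open>s v\<close> pushes a slab of thickness \<open>s\<close> out of it, and this slab
  re-enters on the opposite side after a shift by the period. The two pieces \<open>L\<close> and \<open>R\<close> of the
  cell are therefore translated separately; they fit together again up to two hyperplanes.\<close>

lemma has_bochner_integral_periodic_shift:
  fixes \<phi> :: "'a::euclidean_space \<Rightarrow> complex"
  assumes v: "v \<in> Basis" and B[measurable]: "B \<in> sets borel"
    and strip: "\<And>x. x \<in> B \<Longrightarrow> 0 \<le> x \<bullet> v \<and> x \<bullet> v \<le> p"
    and fill: "\<And>x r. x + r *\<^sub>R v \<in> B \<Longrightarrow> 0 \<le> x \<bullet> v \<Longrightarrow> x \<bullet> v \<le> p \<Longrightarrow> x \<in> B"
    and per: "\<And>x. \<phi> (x + p *\<^sub>R v) = \<phi> x"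
    and s: "0 \<le> s" "s \<le> p" and int: "integrable lborel (\<lambda>x. indicator B x *\<^sub>R \<phi> x)"
    and [measurable]: "\<phi> \<in> borel_measurable borel"
  shows "has_bochner_integral lborel (\<lambda>x. indicator B x *\<^sub>R \<phi> (x + s *\<^sub>R v)) (\<integral>x. indicator B x *\<^sub>R \<phi> x \<partial>lborel)"
proof -
  define L where "L = {x \<in> B. x \<bullet> v < s}"
  define R where "R = {x \<in> B. s \<le> x \<bullet> v}"
  have [measurable]: "L \<in> sets borel" "R \<in> sets borel"
    unfolding L_def R_def by measurable
  have part: "integrable lborel (\<lambda>x. indicator S x *\<^sub>R \<phi> x)" if "S \<subseteq> B" "S \<in> sets borel" for S
  proof -
    have "integrable lborel (\<lambda>x. indicator S x *\<^sub>R (indicator B x *\<^sub>R \<phi> x))"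
      using that by (intro integrable_mult_indicator[OF _ int]) auto
    moreover have "(\<lambda>x. indicator S x *\<^sub>R (indicator B x *\<^sub>R \<phi> x)) = (\<lambda>x. indicator S x *\<^sub>R \<phi> x)"
      using that by (auto simp: indicator_def fun_eq_iff)
    ultimately show ?thesis by simp
  qed
  let ?int = "\<lambda>S. \<integral>x. indicator S x *\<^sub>R \<phi> x \<partial>lborel"
  have "has_bochner_integral lborel (\<lambda>x. indicator R x *\<^sub>R \<phi> x) (?int R)"
    "has_bochner_integral lborel (\<lambda>x. indicator L x *\<^sub>R \<phi> x) (?int L)"
    using part[of R] part[of L] by (auto simp: has_bochner_integral_iff L_def R_def)
  from has_bochner_integral_add[OF has_bochner_integral_translate[OF this(1), of "s *\<^sub>R v"]
      has_bochner_integral_translate[OF this(2), of "(s - p) *\<^sub>R v"]]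
  have "has_bochner_integral lborel (\<lambda>x. indicator R (x + s *\<^sub>R v) *\<^sub>R \<phi> (x + s *\<^sub>R v)
      + indicator L (x + (s - p) *\<^sub>R v) *\<^sub>R \<phi> (x + (s - p) *\<^sub>R v)) (?int R + ?int L)" .
  moreover have "?int R + ?int L = ?int B"
  proof -
    have "?int R + ?int L = (\<integral>x. indicator R x *\<^sub>R \<phi> x + indicator L x *\<^sub>R \<phi> x \<partial>lborel)"
      by (rule Bochner_Integration.integral_add[symmetric]; rule part) (auto simp: L_def R_def)
    also have "\<dots> = ?int B"
      by (rule Bochner_Integration.integral_cong) (auto simp: L_def R_def indicator_def)
    finally show ?thesis .
  qed
  moreover have "AE x in lborel. indicator R (x + s *\<^sub>R v) *\<^sub>R \<phi> (x + s *\<^sub>R v)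
      + indicator L (x + (s - p) *\<^sub>R v) *\<^sub>R \<phi> (x + (s - p) *\<^sub>R v) = indicator B x *\<^sub>R \<phi> (x + s *\<^sub>R v)"
    using AE_lborel_inner_neq[OF v, of p] AE_lborel_inner_neq[OF v, of "p - s"]
  proof eventually_elim
    case (elim x)
    have per': "\<phi> (x + (s - p) *\<^sub>R v) = \<phi> (x + s *\<^sub>R v)"
      using per[of "x + (s - p) *\<^sub>R v"] by (simp add: algebra_simps)
    have vv: "v \<bullet> v = 1" using v by simp
    have R: "x + s *\<^sub>R v \<in> R \<longleftrightarrow> x \<in> B \<and> x \<bullet> v < p - s"
    proof
      assume R: "x + s *\<^sub>R v \<in> R"
      then have "x + s *\<^sub>R v \<in> B" "0 \<le> x \<bullet> v" "x \<bullet> v + s \<le> p"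
        using strip[of "x + s *\<^sub>R v"] by (auto simp: R_def inner_add_left vv)
      then show "x \<in> B \<and> x \<bullet> v < p - s"
        using fill[of x s] s elim by auto
    next
      assume x: "x \<in> B \<and> x \<bullet> v < p - s"
      then have "x + s *\<^sub>R v \<in> B"
        using strip[of x] s fill[of "x + s *\<^sub>R v" "- s"] by (auto simp: inner_add_left vv)
      then show "x + s *\<^sub>R v \<in> R"
        using x strip[of x] by (auto simp: R_def inner_add_left vv)
    qed
    have L: "x + (s - p) *\<^sub>R v \<in> L \<longleftrightarrow> x \<in> B \<and> p - s < x \<bullet> v"
    proof
      assume L: "x + (s - p) *\<^sub>R v \<in> L"
      then have "x + (s - p) *\<^sub>R v \<in> B" "x \<bullet> v < p" "0 \<le> x \<bullet> v + (s - p)"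
        using strip[of "x + (s - p) *\<^sub>R v"] by (auto simp: L_def inner_add_left vv)
      then show "x \<in> B \<and> p - s < x \<bullet> v"
        using fill[of x "s - p"] s elim by auto
    next
      assume x: "x \<in> B \<and> p - s < x \<bullet> v"
      then have "x + (s - p) *\<^sub>R v \<in> B"
        using strip[of x] s fill[of "x + (s - p) *\<^sub>R v" "p - s"]
        by (auto simp: inner_add_left vv algebra_simps)
      then show "x + (s - p) *\<^sub>R v \<in> L"
        using x strip[of x] elim by (auto simp: L_def inner_add_left vv)
    qed
    show ?case
      using elim by (auto simp: indicator_def R L per')
  qed
  ultimately show ?thesis
    by (subst (asm) has_bochner_integral_cong_AE) (auto simp: has_bochner_integral_iff)
qed

section \<open>Products of one-dimensional integrals\<close>

lemma
  fixes f :: "'a::euclidean_space \<Rightarrow> real \<Rightarrow> complex"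
  assumes "\<And>b. b \<in> Basis \<Longrightarrow> integrable lborel (f b)"
  shows integrable_lborel_prod: "integrable lborel (\<lambda>x. \<Prod>b\<in>Basis. f b (x \<bullet> b))"
    and integral_lborel_prod: "(\<integral>x. (\<Prod>b\<in>Basis. f b (x \<bullet> b)) \<partial>lborel) = (\<Prod>b\<in>Basis. \<integral>s. f b s \<partial>lborel)"
proof -
  interpret product_sigma_finite "\<lambda>_::'a. lborel :: real measure" ..
  have [measurable]: "b \<in> Basis \<Longrightarrow> f b \<in> borel_measurable borel" for b
    using borel_measurable_integrable[OF assms[of b]] by simp
  have meas: "(\<lambda>x::'a. \<Prod>b\<in>Basis. f b (x \<bullet> b)) \<in> borel_measurable borel"
    by (intro borel_measurable_prod measurable_compose[OF _ \<open>\<And>b. b \<in> Basis \<Longrightarrow> f b \<in> borel_measurable borel\<close>]) auto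
  have coord: "(\<Prod>b\<in>Basis. f b ((\<Sum>b'\<in>Basis. y b' *\<^sub>R b') \<bullet> b)) = (\<Prod>b\<in>Basis. f b (y b))" for y :: "'a \<Rightarrow> real"
    by (intro prod.cong) (auto simp: inner_sum_left_Basis)
  have "integrable (\<Pi>\<^sub>M b\<in>Basis. lborel) (\<lambda>y. \<Prod>b\<in>(Basis :: 'a set). f b (y b))"
    by (intro product_integrable_prod assms) auto
  then show "integrable lborel (\<lambda>x. \<Prod>b\<in>Basis. f b (x \<bullet> b))"
    by (subst lborel_eq, subst integrable_distr_eq) (auto simp: coord meas)
  have "(\<integral>y. (\<Prod>b\<in>(Basis :: 'a set). f b (y b)) \<partial>(\<Pi>\<^sub>M b\<in>Basis. lborel)) = (\<Prod>b\<in>Basis. \<integral>s. f b s \<partial>lborel)"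
    by (intro product_integral_prod assms) auto
  then show "(\<integral>x. (\<Prod>b\<in>Basis. f b (x \<bullet> b)) \<partial>lborel) = (\<Prod>b\<in>Basis. \<integral>s. f b s \<partial>lborel)"
    by (subst lborel_eq, subst integral_distr) (auto simp: coord meas)
qed

lemma integrable_inverse_one_plus_square: "integrable lborel (\<lambda>s::real. inverse (1 + s\<^sup>2))"
  using integrable_inverse_1_plus_square by (simp add: set_integrable_def)

text \<open>Each factor \<open>1 + x\<^sub>b\<^sup>2\<close> is at most \<open>1 + \<bar>x\<bar>\<^sup>2\<close>, so the weight is dominated by a product of
  integrable functions of one variable.\<close>

lemma integrable_weight: "integrable lborel (\<lambda>x::'a::euclidean_space. 1 / (1 + (norm x)\<^sup>2) ^ DIM('a))"
proof (rule Bochner_Integration.integrable_bound)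
  show "integrable lborel (\<lambda>x::'a. \<Prod>b\<in>Basis. complex_of_real (inverse (1 + (x \<bullet> b)\<^sup>2)))"
    by (intro integrable_lborel_prod integrable_of_real integrable_inverse_one_plus_square)
  show "AE x::'a in lborel. norm (1 / (1 + (norm x)\<^sup>2) ^ DIM('a))
      \<le> norm (\<Prod>b\<in>(Basis :: 'a set). complex_of_real (inverse (1 + (x \<bullet> b)\<^sup>2)))"
  proof (rule AE_I2)
    fix x :: 'a
    have pos: "0 < 1 + (x \<bullet> b)\<^sup>2" for b
      by (simp add: add_pos_nonneg)
    have "(\<Prod>b\<in>(Basis :: 'a set). 1 + (x \<bullet> b)\<^sup>2) \<le> (\<Prod>b\<in>(Basis :: 'a set). 1 + (norm x)\<^sup>2)"
      using pos by (intro prod_mono conjI add_left_mono) (auto intro: less_imp_le simp: abs_le_square_iff[symmetric] Basis_le_norm)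
    then have "1 / (1 + (norm x)\<^sup>2) ^ DIM('a) \<le> 1 / (\<Prod>b\<in>(Basis :: 'a set). 1 + (x \<bullet> b)\<^sup>2)"
      using pos by (intro divide_left_mono) (auto intro!: mult_pos_pos prod_pos simp: add_pos_nonneg)
    also have "\<dots> = norm (\<Prod>b\<in>(Basis :: 'a set). complex_of_real (inverse (1 + (x \<bullet> b)\<^sup>2)))"
    proof -
      have "(\<Prod>b\<in>(Basis :: 'a set). complex_of_real (inverse (1 + (x \<bullet> b)\<^sup>2)))
          = of_real (1 / (\<Prod>b\<in>(Basis :: 'a set). 1 + (x \<bullet> b)\<^sup>2))"
        unfolding of_real_prod[symmetric] prod_dividef[symmetric] by (simp add: inverse_eq_divide prod_dividef)
      moreover have "0 \<le> (\<Prod>b\<in>(Basis :: 'a set). 1 + (x \<bullet> b)\<^sup>2)"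
        using pos by (intro prod_nonneg) (auto intro: less_imp_le)
      ultimately show ?thesis by (simp only: norm_of_real) simp
    qed
    finally show "norm (1 / (1 + (norm x)\<^sup>2) ^ DIM('a))
      \<le> norm (\<Prod>b\<in>(Basis :: 'a set). complex_of_real (inverse (1 + (x \<bullet> b)\<^sup>2)))"
      by (simp add: add_nonneg_nonneg)
  qed
qed simp

lemma (in pair_sigma_finite) integrable_pair_mult:
  fixes f :: "'a \<Rightarrow> real" and g :: "'b \<Rightarrow> real"
  assumes f: "integrable M1 f" and g: "integrable M2 g"
  shows "integrable (M1 \<Otimes>\<^sub>M M2) (\<lambda>(x, y). f x * g y)"
proof (rule Fubini_integrable)
  note [measurable] = borel_measurable_integrable[OF f] borel_measurable_integrable[OF g]
  show "(\<lambda>(x, y). f x * g y) \<in> borel_measurable (M1 \<Otimes>\<^sub>M M2)"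
    by measurable
qed (use f g in \<open>auto simp: abs_mult\<close>)

section \<open>Transforms of rapidly decreasing amplitudes\<close>

text \<open>The argument by which an integral transform preserves rapid decrease, separated from the
  particular transform: the functions \<open>T A\<close>, for amplitudes \<open>A \<in> \<A>\<close>, are continuous, bounded and
  closed under linear combinations, and differentiating \<open>T A\<close> amounts to changing the amplitude
  within \<open>\<A>\<close>. If
  multiplication by the weight is also a change of amplitude, then every \<open>T A\<close> is rapidly
  decreasing.\<close>

locale transform =
  fixes \<A> :: "'amp set" and T :: "'amp \<Rightarrow> 'k \<Rightarrow> 'a::euclidean_space \<Rightarrow> complex"
  assumes transform_add: "A \<in> \<A> \<Longrightarrow> B \<in> \<A> \<Longrightarrow> \<exists>C\<in>\<A>. \<forall>k x. T A k x + T B k x = T C k x"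
    and transform_scale: "A \<in> \<A> \<Longrightarrow> \<exists>C\<in>\<A>. \<forall>k x. c * T A k x = T C k x"
    and transform_continuous: "A \<in> \<A> \<Longrightarrow> continuous_on UNIV (T A k)"
    and transform_bounded: "A \<in> \<A> \<Longrightarrow> \<exists>C. \<forall>k x. cmod (T A k x) \<le> C"
    and transform_derivative: "A \<in> \<A> \<Longrightarrow> b \<in> Basis \<Longrightarrow>
      \<exists>C\<in>\<A>. \<forall>k x. ((\<lambda>s. T A k (x + s *\<^sub>R b)) has_vector_derivative T C k x) (at 0)"
begin

definition multiplier :: "('k \<Rightarrow> 'a \<Rightarrow> complex) \<Rightarrow> bool" where
  "multiplier q \<longleftrightarrow> (\<forall>A\<in>\<A>. \<exists>C\<in>\<A>. \<forall>k x. q k x * T A k x = T C k x)"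

lemma multiplier_const: "multiplier (\<lambda>_ _. c)"
  unfolding multiplier_def using transform_scale by blast

lemma multiplier_mult: "multiplier p \<Longrightarrow> multiplier q \<Longrightarrow> multiplier (\<lambda>k x. p k x * q k x)"
  unfolding multiplier_def mult.assoc by metis

lemma multiplier_add:
  assumes p: "multiplier p" and q: "multiplier q"
  shows "multiplier (\<lambda>k x. p k x + q k x)"
  unfolding multiplier_def
proof
  fix A assume A: "A \<in> \<A>"
  obtain B C where "B \<in> \<A>" "C \<in> \<A>" and BC: "\<And>k x. p k x * T A k x = T B k x" "\<And>k x. q k x * T A k x = T C k x"
    using p q A unfolding multiplier_def by meson
  then obtain D where "D \<in> \<A>" "\<And>k x. T B k x + T C k x = T D k x"
    using transform_add by meson
  then show "\<exists>D\<in>\<A>. \<forall>k x. (p k x + q k x) * T A k x = T D k x"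
    by (auto simp: distrib_right BC)
qed

lemma multiplier_sum: "(\<And>i. i \<in> I \<Longrightarrow> multiplier (q i)) \<Longrightarrow> multiplier (\<lambda>k x. \<Sum>i\<in>I. q i k x)"
  by (induction I rule: infinite_finite_induct) (auto intro: multiplier_add multiplier_const)

text \<open>This is \<open>1 + \<bar>y\<bar>\<^sup>2 = 1 - \<Sum>\<^sub>i (\<i> y\<^sub>i)\<^sup>2\<close>, the symbol of \<open>1 - \<Delta>\<close>: integration by parts turns the
  single factors \<open>\<i> y\<^sub>i\<close> into derivatives of the amplitude.\<close>

lemma multiplier_one_plus_norm_square:
  fixes y :: "'k \<Rightarrow> 'a \<Rightarrow> real^'d::finite"
  assumes "\<And>i. multiplier (\<lambda>k x. \<i> * of_real (y k x $ i))"
  shows "multiplier (\<lambda>k x. of_real (1 + (norm (y k x))\<^sup>2))"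
proof -
  have "complex_of_real (1 + (norm z)\<^sup>2) = 1 + (\<Sum>i\<in>UNIV. (-1) * ((\<i> * of_real (z $ i)) * (\<i> * of_real (z $ i))))"
    for z :: "real^'d"
    by (simp add: norm_vec_def L2_set_def sum_nonneg power2_eq_square mult.assoc[symmetric])
      (simp add: algebra_simps)
  then show ?thesis
    by (simp only:) (intro multiplier_add multiplier_sum multiplier_mult multiplier_const assms)
qed

lemma rapid_transform:
  assumes W: "multiplier (\<lambda>k x. of_real (W k x))" "\<And>k x. 0 \<le> W k x" and A: "A \<in> \<A>"
  shows "rapid W (T A)"
proof (rule rapid_coinduct_derivs)
  show "T A \<in> T ` \<A>" using A by blast
  fix F assume F: "F \<in> T ` \<A>"
  then show "continuous_on UNIV (F k)" for k
    using transform_continuous by blast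
  show "\<exists>F'\<in>T ` \<A>. \<forall>k x. ((\<lambda>s. F k (x + s *\<^sub>R b)) has_vector_derivative F' k x) (at 0)"
    if "b \<in> Basis" for b
    using F transform_derivative[OF _ that] by blast
  have "\<exists>C. \<forall>k x. W k x ^ N * cmod (T B k x) \<le> C" if "B \<in> \<A>" for B N
    using that
  proof (induction N arbitrary: B)
    case 0
    then show ?case using transform_bounded by simp
  next
    case (Suc N)
    then obtain B' where B': "B' \<in> \<A>" "\<And>k x. of_real (W k x) * T B k x = T B' k x"
      using W(1) unfolding multiplier_def by meson
    have "W k x ^ Suc N * cmod (T B k x) = W k x ^ N * cmod (T B' k x)" for k x
      using W(2)[of k x] by (simp add: norm_mult flip: B'(2))
    then show ?case
      using Suc.IH[OF B'(1)] by (simp only:)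
  qed
  then show "\<exists>C. \<forall>k x. W k x ^ N * cmod (F k x) \<le> C" for N
    using F by blast
qed

end

section \<open>The Fourier transform of a rapidly decreasing function\<close>

definition space_weight :: "unit \<Rightarrow> (real^'m::finite) \<times> (real^'n::finite) \<Rightarrow> real" where
  "space_weight _ z = 1 + (norm (snd z))\<^sup>2"

definition dual_weight :: "int^'m::finite \<Rightarrow> real^'n::finite \<Rightarrow> real" where
  "dual_weight k \<xi> = (1 + (norm (real_vec k))\<^sup>2) * (1 + (norm \<xi>)\<^sup>2)"

definition rapid_TR :: "((real^'m::finite) \<times> (real^'n::finite) \<Rightarrow> complex) set" where
  "rapid_TR = {g. torus_periodic g \<and> rapid space_weight (\<lambda>_. g)}"

abbreviation period_cell :: "((real^'m::finite) \<times> (real^'n::finite)) set" where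
  "period_cell \<equiv> period_box \<times> UNIV"

lemma space_weight_nonneg: "0 \<le> space_weight u z"
  by (simp add: space_weight_def)

lemma dual_weight_nonneg: "0 \<le> dual_weight k \<xi>"
  by (simp add: dual_weight_def)

lemma period_box_iff: "t \<in> period_box \<longleftrightarrow> (\<forall>i. 0 \<le> t $ i \<and> t $ i \<le> 2 * pi)"
  by (auto simp: period_box_def mem_box_cart)

lemma period_box_borel [measurable]: "period_box \<in> sets borel"
  by (simp add: period_box_def)

lemma period_cell_borel [measurable]: "period_cell \<in> sets borel"
  unfolding borel_prod[symmetric] by (intro pair_measureI) auto

lemma torus_periodic_add: "torus_periodic g \<Longrightarrow> g (z + (2 * pi) *\<^sub>R (axis i 1, 0)) = g z"
  by (cases z) (simp add: torus_periodic_def)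

lemma rapid_TR_lincomb:
  "g \<in> rapid_TR \<Longrightarrow> h \<in> rapid_TR \<Longrightarrow> (\<lambda>z. c * g z + d * h z) \<in> rapid_TR"
  unfolding rapid_TR_def
  using rapid_lincomb[of space_weight "\<lambda>_. g" "\<lambda>_. h" c d] by (auto simp: torus_periodic_def space_weight_nonneg)

lemma rapid_TR_partial_deriv: "g \<in> rapid_TR \<Longrightarrow> b \<in> Basis \<Longrightarrow> partial_deriv b g \<in> rapid_TR"
proof -
  assume g: "g \<in> rapid_TR" and b: "b \<in> Basis"
  have "partial_deriv b g (t + (2 * pi) *\<^sub>R axis i 1, x) = partial_deriv b g (t, x)" for t x i
  proof -
    have "g ((t + (2 * pi) *\<^sub>R axis i 1, x) + s *\<^sub>R b) = g ((t, x) + s *\<^sub>R b)" for s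
    proof -
      have "(t + (2 * pi) *\<^sub>R axis i 1, x) + s *\<^sub>R b = ((t, x) + s *\<^sub>R b) + (2 * pi) *\<^sub>R (axis i 1, 0)"
        by (simp add: prod_eq_iff)
      with g show ?thesis
        by (simp only: rapid_TR_def mem_Collect_eq torus_periodic_add)
    qed
    then show ?thesis
      by (simp add: partial_deriv_def)
  qed
  then show ?thesis
    using g rapid_partial_deriv[of space_weight "\<lambda>_. g" b] b by (simp add: rapid_TR_def torus_periodic_def)
qed

lemma rapid_TR_mult_snd:
  assumes g: "g \<in> rapid_TR" and b: "b \<in> Basis"
  shows "(\<lambda>z. of_real (snd z \<bullet> b) * g z) \<in> rapid_TR"
proof -
  have "\<bar>0 + z \<bullet> (0, b)\<bar> \<le> space_weight u z" for u and z :: "(real^'a) \<times> (real^'b)"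
    using abs_nth_le_weight[of "snd z"] b by (auto simp: inner_prod_def space_weight_def Basis_vec_def inner_axis)
  from rapid_affine_mult[where W = space_weight and a = "\<lambda>_. 0", OF _ space_weight_nonneg this, of "\<lambda>_. g"]
  show ?thesis
    using g by (auto simp: rapid_TR_def torus_periodic_def inner_prod_def)
qed

text \<open>The torus variable stays in a compact set, and the power \<open>(1 + \<bar>x\<bar>\<^sup>2)\<^sup>-\<^sup>n\<close> of the weight is integrable
  in the Euclidean variable.\<close>

lemma rapid_TR_integrable:
  assumes g: "g \<in> rapid_TR"
  shows "set_integrable lborel period_cell g"
proof -
  obtain C where C: "(1 + (norm (snd z))\<^sup>2) ^ CARD('b) * cmod (g z) \<le> C" for z
    using rapid_bound[of space_weight "\<lambda>_. g" "CARD('b)"] g unfolding rapid_TR_def space_weight_def by blast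
  have cont: "continuous_on UNIV g"
    using rapid_continuous[of space_weight "\<lambda>_. g"] g by (auto simp: rapid_TR_def)
  then have [measurable]: "g \<in> borel_measurable borel"
    by (rule borel_measurable_continuous_onI)
  have "integrable (lborel \<Otimes>\<^sub>M lborel) (\<lambda>(t, x). indicator (period_box :: (real^'a) set) t
      * (C * (1 / (1 + (norm (x :: real^'b))\<^sup>2) ^ CARD('b))))"
    using integrable_weight[where 'a = "real^'b"]
    by (intro lborel_pair.integrable_pair_mult integrable_mult_right)
      (auto simp: period_box_def intro!: integrable_real_indicator emeasure_lborel_cbox_finite)
  then have dom: "integrable lborel (\<lambda>(t, x). indicator (period_box :: (real^'a) set) t
      * (C * (1 / (1 + (norm (x :: real^'b))\<^sup>2) ^ CARD('b))))"
    by (simp add: lborel_prod)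
  show ?thesis
    unfolding set_integrable_def
  proof (rule Bochner_Integration.integrable_bound[OF dom])
    show "AE z in lborel. norm (indicator period_cell z *\<^sub>R g z) \<le> norm (case z of (t, x) \<Rightarrow>
        indicator (period_box :: (real^'a) set) t * (C * (1 / (1 + (norm (x :: real^'b))\<^sup>2) ^ CARD('b))))"
    proof (rule AE_I2, clarify)
      fix t :: "real^'a" and x :: "real^'b"
      have "0 < (1 + (norm x)\<^sup>2) ^ CARD('b)"
        by (simp add: add_pos_nonneg)
      then have "cmod (g (t, x)) \<le> \<bar>C * (1 / (1 + (norm x)\<^sup>2) ^ CARD('b))\<bar>"
        using C[of "(t, x)"] by (auto simp: field_simps)
      then show "norm (indicator period_cell (t, x) *\<^sub>R g (t, x)) \<le>
          norm (indicator (period_box :: (real^'a) set) t * (C * (1 / (1 + (norm x)\<^sup>2) ^ CARD('b))))"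
        by (auto simp: indicator_def)
    qed
  qed simp
qed

lemma mixed_fourier_eq:
  fixes g :: "(real^'m::finite) \<times> (real^'n::finite) \<Rightarrow> complex"
  assumes g: "set_integrable lborel period_cell g"
  shows "mixed_fourier g k \<xi> = 1 / (2 * of_real pi) ^ CARD('m) *
    (\<integral>z. (indicator period_cell z *\<^sub>R g z) * cis (- (z \<bullet> (real_vec k, \<xi>))) \<partial>lborel)"
proof -
  let ?h = "\<lambda>z. (indicator period_cell z *\<^sub>R g z) * cis (- (z \<bullet> (real_vec k, \<xi>)))"
  have "integrable lborel ?h"
    using g unfolding set_integrable_def by (rule integrable_mult_cis) simp
  then have "integrable (lborel \<Otimes>\<^sub>M lborel) ?h"
    by (simp add: lborel_prod)
  from lborel_pair.integral_fst'[OF this]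
  have "(\<integral>z. ?h z \<partial>lborel) = (\<integral>t. \<integral>x. ?h (t, x) \<partial>lborel \<partial>lborel)"
    by (simp add: lborel_prod)
  also have "\<dots> = (LINT t:period_box|lborel. (LINT x|lborel.
        g (t, x) * exp (- (\<i> * of_real (real_vec k \<bullet> t + x \<bullet> \<xi>)))))"
    unfolding set_lebesgue_integral_def
  proof (rule Bochner_Integration.integral_cong[OF refl])
    fix t :: "real^'m"
    have "cis (- ((t, x) \<bullet> (real_vec k, \<xi>))) = exp (- (\<i> * of_real (real_vec k \<bullet> t + x \<bullet> \<xi>)))" for x
      unfolding cis_conv_exp by (rule arg_cong[where f = exp]) (simp add: inner_commute algebra_simps)
    then show "(\<integral>x. ?h (t, x) \<partial>lborel) = indicator period_box t *\<^sub>R (LINT x|lborel.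
        g (t, x) * exp (- (\<i> * of_real (real_vec k \<bullet> t + x \<bullet> \<xi>))))"
      by (cases "t \<in> period_box") auto
  qed
  finally show ?thesis
    by (simp add: mixed_fourier_def)
qed


lemma borel_measurable_uminus_snd:
  "(\<lambda>z :: 'a::euclidean_space \<times> 'b::euclidean_space. - snd z) \<in> borel_measurable lborel"
  by (simp add: borel_measurable_continuous_onI continuous_on_minus continuous_on_snd continuous_on_id)

text \<open>For fixed \<open>k\<close> the torus variable belongs to the amplitude, and only \<open>-x\<close> acts as a phase
  against \<open>\<xi>\<close>.\<close>

lemma mixed_fourier_osc:
  fixes g :: "(real^'m::finite) \<times> (real^'n::finite) \<Rightarrow> complex"
  assumes g: "set_integrable lborel period_cell g"
  shows "mixed_fourier g k = osc lborel (\<lambda>z. - snd z)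
    (\<lambda>z. 1 / (2 * of_real pi) ^ CARD('m) * ((indicator period_cell z *\<^sub>R g z) * cis (- (fst z \<bullet> real_vec k))))"
proof
  fix \<xi> :: "real^'n"
  have "cis (- (z \<bullet> (real_vec k, \<xi>))) = cis (- (fst z \<bullet> real_vec k)) * cis (- snd z \<bullet> \<xi>)"
    for z :: "(real^'m) \<times> (real^'n)"
    by (simp add: cis_mult inner_prod_def)
  then show "mixed_fourier g k \<xi> = osc lborel (\<lambda>z. - snd z)
    (\<lambda>z. 1 / (2 * of_real pi) ^ CARD('m) * ((indicator period_cell z *\<^sub>R g z) * cis (- (fst z \<bullet> real_vec k)))) \<xi>"
    unfolding mixed_fourier_eq[OF g] osc_def integral_mult_right_zero[symmetric] by (simp only: mult.assoc)
qed

lemma integrable_fourier_amplitude: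
  fixes g :: "(real^'m::finite) \<times> (real^'n::finite) \<Rightarrow> complex"
  assumes g: "set_integrable lborel period_cell g"
  shows "integrable lborel (\<lambda>z. c * ((indicator period_cell z *\<^sub>R g z) * cis (- (fst z \<bullet> real_vec k))))"
  using g unfolding set_integrable_def
  by (intro integrable_mult_right integrable_mult_cis) (auto simp flip: borel_prod)

lemma mixed_fourier_lincomb:
  assumes g: "set_integrable lborel period_cell g" and h: "set_integrable lborel period_cell h"
  shows "mixed_fourier (\<lambda>z. c * g z + d * h z) k \<xi> = c * mixed_fourier g k \<xi> + d * mixed_fourier h k \<xi>"
proof -
  have gh: "set_integrable lborel period_cell (\<lambda>z. c * g z + d * h z)"
    by (intro set_integral_add set_integrable_mult_right g h)
  define E where "E = (\<lambda>u z. (indicator period_cell z *\<^sub>R u z) * cis (- (z \<bullet> (real_vec k, \<xi>))))"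
  have "integrable lborel (E g)" "integrable lborel (E h)"
    unfolding E_def using g h unfolding set_integrable_def by (rule_tac [!] integrable_mult_cis) simp_all
  moreover have "E (\<lambda>z. c * g z + d * h z) = (\<lambda>z. c * E g z + d * E h z)"
    by (auto simp: E_def fun_eq_iff scaleR_conv_of_real algebra_simps)
  ultimately have "(\<integral>z. E (\<lambda>z. c * g z + d * h z) z \<partial>lborel) = c * (\<integral>z. E g z \<partial>lborel) + d * (\<integral>z. E h z \<partial>lborel)"
    by simp
  then show ?thesis
    unfolding mixed_fourier_eq[OF gh] mixed_fourier_eq[OF g] mixed_fourier_eq[OF h] E_def
    by (simp only: distrib_left mult.left_commute)
qed

text \<open>Torus and Euclidean directions are treated alike: the phase is the inner product of
  \<open>z = (t, x)\<close> with \<open>\<kappa> = (k, \<xi>)\<close>, and \<open>h'\<close> is the derivative of \<open>h = g * cis (- (z \<bullet> \<kappa>))\<close> along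
  \<open>b\<close>. Only the reason why \<open>h'\<close> integrates to 0 differs: periodicity of \<open>h\<close> in the torus
  directions, where \<open>k\<close> being integral is used, and translation invariance in the others.\<close>

lemma mixed_fourier_partial_deriv:
  fixes g :: "(real^'m::finite) \<times> (real^'n::finite) \<Rightarrow> complex"
  assumes g: "g \<in> rapid_TR" and b: "b \<in> Basis"
  shows "mixed_fourier (partial_deriv b g) k \<xi> = \<i> * of_real (b \<bullet> (real_vec k, \<xi>)) * mixed_fourier g k \<xi>"
proof -
  let ?\<kappa> = "(real_vec k, \<xi>) :: (real^'m) \<times> (real^'n)"
  let ?e = "\<lambda>z. cis (- (z \<bullet> ?\<kappa>))"
  define h where "h = (\<lambda>z. g z * ?e z)"
  define h' where "h' = (\<lambda>z. (partial_deriv b g z - \<i> * of_real (b \<bullet> ?\<kappa>) * g z) * ?e z)"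
  note g' = rapid_TR_partial_deriv[OF g b]
  have rapid: "rapid space_weight (\<lambda>_. g)"
    using g by (simp add: rapid_TR_def)
  have cont_g: "continuous_on UNIV g" and cont_g': "continuous_on UNIV (partial_deriv b g)"
    using g g' rapid_continuous[of space_weight "\<lambda>_. g"] rapid_continuous[of space_weight "\<lambda>_. partial_deriv b g"]
    by (auto simp: rapid_TR_def)
  have cont_e: "continuous_on UNIV ?e"
    unfolding cis_conv_exp by (intro continuous_intros)
  have cont_h: "continuous_on UNIV h" and cont_h': "continuous_on UNIV h'"
    unfolding h_def h'_def by (intro continuous_intros cont_g cont_g' cont_e)+
  have [measurable]: "h \<in> borel_measurable borel" "h' \<in> borel_measurable borel"
    using cont_h cont_h' by (auto intro: borel_measurable_continuous_onI)
  have int_e: "integrable lborel (\<lambda>z. indicator period_cell z *\<^sub>R (a z * ?e z))"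
    if "set_integrable lborel period_cell a" for a
    using integrable_mult_cis[OF that[unfolded set_integrable_def], of "\<lambda>z. - (z \<bullet> ?\<kappa>)"] by simp
  have int_h: "integrable lborel (\<lambda>z. indicator period_cell z *\<^sub>R h z)"
    unfolding h_def by (rule int_e[OF rapid_TR_integrable[OF g]])
  have int_h': "integrable lborel (\<lambda>z. indicator period_cell z *\<^sub>R h' z)"
    unfolding h'_def
    by (intro int_e set_integral_diff set_integrable_mult_right rapid_TR_integrable g g')
  have der: "((\<lambda>s. h (z + s *\<^sub>R b)) has_vector_derivative h' (z + s *\<^sub>R b)) (at s)" for z s
  proof -
    have "((\<lambda>s. ?e (z + s *\<^sub>R b)) has_vector_derivative
        \<i> * of_real (- (b \<bullet> ?\<kappa>)) * ?e (z + s *\<^sub>R b)) (at s)"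
      using cis_linear_derivative[of "- (z \<bullet> ?\<kappa>)" "- (b \<bullet> ?\<kappa>)" s UNIV]
      by (simp only: inner_add_left inner_scaleR_left minus_add_distrib mult_minus_right)
    from has_vector_derivative_mult[OF rapid_has_vector_derivative[OF rapid b, of z s UNIV] this]
    show ?thesis
      by (simp add: h_def h'_def algebra_simps)
  qed
  have cont_line: "continuous_on UNIV (\<lambda>s. h' (z + s *\<^sub>R b))" for z
    by (intro continuous_on_compose2[OF cont_h'] continuous_intros) auto
  have "(\<integral>z. indicator period_cell z *\<^sub>R h' z \<partial>lborel) = 0"
  proof -
    from b consider i where "b = (axis i 1, 0)" | j where "b = (0, axis j 1)"
      by (auto simp: Basis_prod_def Basis_vec_def)
    then show ?thesis
    proof cases
      case 1
      have periodic: "a (z + (2 * pi) *\<^sub>R b) * ?e (z + (2 * pi) *\<^sub>R b) = a z * ?e z" if "torus_periodic a" for a z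
      proof -
        have "?e (z + (2 * pi) *\<^sub>R b) = ?e z * cis (- (2 * pi * of_int (k $ i)))"
          by (simp add: cis_mult inner_add_left 1 real_vec_def inner_axis' algebra_simps)
        also have "cis (- (2 * pi * of_int (k $ i))) = cis (2 * pi * of_int (- (k $ i)))"
          by simp
        also have "\<dots> = 1"
          by (rule cis_multiple_2pi) simp
        finally show ?thesis
          using torus_periodic_add[OF that] by (simp add: 1)
      qed
      have per_h: "h (z + (2 * pi) *\<^sub>R b) = h z" for z
        using periodic[of g z] g by (simp add: h_def rapid_TR_def)
      have per_h': "h' (z + (2 * pi) *\<^sub>R b) = h' z" for z
      proof -
        have "torus_periodic (\<lambda>z. partial_deriv b g z - \<i> * of_real (b \<bullet> ?\<kappa>) * g z)"
          using g g' by (auto simp: rapid_TR_def torus_periodic_def)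
        from periodic[OF this, of z] show ?thesis by (simp only: h'_def)
      qed
      show ?thesis
      proof (rule integral_derivative_eq_0[where p = "2 * pi" and
            P = "\<lambda>\<phi>. \<phi> \<in> borel_measurable borel \<and> (\<forall>z. \<phi> (z + (2 * pi) *\<^sub>R b) = \<phi> z)",
            OF _ _ int_h int_h' _ der cont_line])
        fix \<phi> :: "_ \<Rightarrow> complex" and s :: real
        assume \<phi>: "\<phi> \<in> borel_measurable borel \<and> (\<forall>z. \<phi> (z + (2 * pi) *\<^sub>R b) = \<phi> z)"
          and s: "0 \<le> s" "s \<le> 2 * pi"
          and int: "integrable lborel (\<lambda>z. indicator period_cell z *\<^sub>R \<phi> z)"
        show "has_bochner_integral lborel (\<lambda>z. indicator period_cell z *\<^sub>R \<phi> (z + s *\<^sub>R b))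
            (\<integral>z. indicator period_cell z *\<^sub>R \<phi> z \<partial>lborel)"
        proof (rule has_bochner_integral_periodic_shift[OF b _ _ _ _ s int])
          fix z :: "(real^'m) \<times> (real^'n)" and r :: real
          show "0 \<le> z \<bullet> b \<and> z \<bullet> b \<le> 2 * pi" if "z \<in> period_cell"
            using that by (auto simp: 1 period_box_iff inner_prod_def inner_axis)
          show "z \<in> period_cell"
            if *: "z + r *\<^sub>R b \<in> period_cell" "0 \<le> z \<bullet> b" "z \<bullet> b \<le> 2 * pi"
          proof -
            have "0 \<le> fst z $ i' \<and> fst z $ i' \<le> 2 * pi" for i'
            proof (cases "i' = i")
              case True
              then show ?thesis using *(2,3) by (simp add: 1 inner_prod_def inner_axis)
            next
              case False
              have "0 \<le> fst (z + r *\<^sub>R b) $ i' \<and> fst (z + r *\<^sub>R b) $ i' \<le> 2 * pi"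
                using *(1) by (simp add: mem_Times_iff period_box_iff)
              then show ?thesis using False by (simp add: 1 axis_def)
            qed
            then show ?thesis
              by (simp add: mem_Times_iff period_box_iff)
          qed
        qed (use \<phi> in auto)
      qed (auto simp: per_h per_h')
    next
      case 2
      show ?thesis
        by (rule integral_derivative_eq_0_line[OF _ _ int_h int_h' _ der cont_line])
          (auto simp: 2 mem_Times_iff)
    qed
  qed
  moreover define E where "E = (\<lambda>u z. indicator period_cell z *\<^sub>R (u z * ?e z))"
  have "(\<lambda>z. indicator period_cell z *\<^sub>R h' z) = (\<lambda>z. E (partial_deriv b g) z - \<i> * of_real (b \<bullet> ?\<kappa>) * E g z)"
    by (auto simp: E_def h'_def fun_eq_iff scaleR_conv_of_real algebra_simps)
  moreover have "integrable lborel (E g)" "integrable lborel (E (partial_deriv b g))"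
    unfolding E_def by (intro int_e rapid_TR_integrable g g')+
  ultimately have "(\<integral>z. E (partial_deriv b g) z \<partial>lborel) = \<i> * of_real (b \<bullet> ?\<kappa>) * (\<integral>z. E g z \<partial>lborel)"
    by simp
  then show ?thesis
    unfolding mixed_fourier_eq[OF rapid_TR_integrable[OF g]] mixed_fourier_eq[OF rapid_TR_integrable[OF g']]
    by (simp only: E_def mult_scaleR_left mult.left_commute)
qed

interpretation fourier: transform "rapid_TR :: ((real^'m::finite) \<times> (real^'n::finite) \<Rightarrow> complex) set" mixed_fourier
proof
  fix g h :: "(real^'m) \<times> (real^'n) \<Rightarrow> complex" and b :: "real^'n" and c k
  assume g: "g \<in> rapid_TR"
  note int = rapid_TR_integrable[OF g]
  show "\<exists>C\<in>rapid_TR. \<forall>k \<xi>. mixed_fourier g k \<xi> + mixed_fourier h k \<xi> = mixed_fourier C k \<xi>" if "h \<in> rapid_TR"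
    using mixed_fourier_lincomb[OF int rapid_TR_integrable[OF that], of 1 1]
    by (intro bexI[OF _ rapid_TR_lincomb[OF g that, of 1 1]]) simp
  show "\<exists>C\<in>rapid_TR. \<forall>k \<xi>. c * mixed_fourier g k \<xi> = mixed_fourier C k \<xi>"
    using mixed_fourier_lincomb[OF int int, of c 0]
    by (intro bexI[OF _ rapid_TR_lincomb[OF g g, of c 0]]) simp
  show "continuous_on UNIV (mixed_fourier g k)"
    unfolding mixed_fourier_osc[OF int]
    by (rule continuous_on_osc[OF integrable_fourier_amplitude[OF int] borel_measurable_uminus_snd])
  show "\<exists>C. \<forall>k \<xi>. cmod (mixed_fourier g k \<xi>) \<le> C"
  proof (intro exI allI)
    fix k \<xi>
    have "cmod (mixed_fourier g k \<xi>) \<le> (\<integral>z. cmod (1 / (2 * of_real pi) ^ CARD('m)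
        * ((indicator period_cell z *\<^sub>R g z) * cis (- (fst z \<bullet> real_vec k)))) \<partial>lborel)"
      unfolding mixed_fourier_osc[OF int] by (rule norm_osc_le)
    also have "\<dots> = (\<integral>z. cmod (1 / (2 * of_real pi) ^ CARD('m) * (indicator period_cell z *\<^sub>R g z)) \<partial>lborel)"
      by (simp only: norm_mult norm_cis mult_1_right)
    finally show "cmod (mixed_fourier g k \<xi>) \<le> \<dots>" .
  qed
  show "\<exists>C\<in>rapid_TR. \<forall>k \<xi>. ((\<lambda>s. mixed_fourier g k (\<xi> + s *\<^sub>R b)) has_vector_derivative mixed_fourier C k \<xi>) (at 0)"
    if b: "b \<in> Basis"
  proof -
    \<comment> \<open>The second summand is zero; it gives \<open>C\<close> the shape of a linear combination.\<close>
    define C where "C = (\<lambda>z. - \<i> * (of_real (snd z \<bullet> b) * g z) + 0 * (of_real (snd z \<bullet> b) * g z))"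
    have C: "C \<in> rapid_TR"
      unfolding C_def by (intro rapid_TR_lincomb rapid_TR_mult_snd g b)
    have "((\<lambda>s. mixed_fourier g k (\<xi> + s *\<^sub>R b)) has_vector_derivative mixed_fourier C k \<xi>) (at 0)" for k \<xi>
    proof -
      let ?a = "\<lambda>g z. 1 / (2 * of_real pi) ^ CARD('m) * ((indicator period_cell z *\<^sub>R g z) * cis (- (fst z \<bullet> real_vec k)))"
      have eq: "(\<lambda>z. \<i> * of_real (- snd z \<bullet> b) * ?a g z) = ?a C"
        by (auto simp: C_def fun_eq_iff scaleR_conv_of_real)
      have "integrable lborel (\<lambda>z. \<i> * of_real (- snd z \<bullet> b) * ?a g z)"
        unfolding eq by (rule integrable_fourier_amplitude[OF rapid_TR_integrable[OF C]])
      from has_vector_derivative_osc[OF integrable_fourier_amplitude[OF int] borel_measurable_uminus_snd this,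
          unfolded eq]
      show ?thesis
        unfolding mixed_fourier_osc[OF int] mixed_fourier_osc[OF rapid_TR_integrable[OF C]] .
    qed
    with C show ?thesis by blast
  qed
qed

lemma rapid_mixed_fourier:
  fixes g :: "(real^'m::finite) \<times> (real^'n::finite) \<Rightarrow> complex"
  assumes "g \<in> rapid_TR"
  shows "rapid dual_weight (mixed_fourier g)"
proof (rule fourier.rapid_transform[OF _ dual_weight_nonneg assms])
  have mult: "fourier.multiplier (\<lambda>k \<xi>. \<i> * of_real (b \<bullet> (real_vec k, \<xi>)) :: complex)" if "b \<in> Basis"
    for b :: "(real^'m) \<times> (real^'n)"
    unfolding fourier.multiplier_def
    by (intro ballI bexI[OF _ rapid_TR_partial_deriv[OF _ that]] allI) (simp_all add: mixed_fourier_partial_deriv that)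
  have "fourier.multiplier (\<lambda>(k :: int^'m) (\<xi> :: real^'n). of_real (1 + (norm (real_vec k))\<^sup>2))"
  proof (rule fourier.multiplier_one_plus_norm_square)
    fix i show "fourier.multiplier (\<lambda>(k :: int^'m) (\<xi> :: real^'n). \<i> * of_real (real_vec k $ i))"
      using mult[of "(axis i 1, 0)"] by (simp add: inner_axis' Basis_prod_def)
  qed
  moreover have "fourier.multiplier (\<lambda>(k :: int^'m) (\<xi> :: real^'n). of_real (1 + (norm \<xi>)\<^sup>2))"
  proof (rule fourier.multiplier_one_plus_norm_square)
    fix j show "fourier.multiplier (\<lambda>(k :: int^'m) (\<xi> :: real^'n). \<i> * of_real (\<xi> $ j))"
      using mult[of "(0, axis j 1)"] by (simp add: inner_axis' Basis_prod_def)
  qed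
  ultimately show "fourier.multiplier (\<lambda>(k :: int^'m) (\<xi> :: real^'n). of_real (dual_weight k \<xi>))"
    unfolding dual_weight_def of_real_mult by (rule fourier.multiplier_mult)
qed

section \<open>The inverse transform\<close>

text \<open>The sum over \<open>\<int>\<close> is split into its two halves, each compared with \<open>\<Sum>n\<^sup>-\<^sup>2\<close>.\<close>

lemma abs_summable_inverse_one_plus_square: "Infinite_Set_Sum.abs_summable_on (\<lambda>j::int. inverse (1 + (real_of_int j)\<^sup>2)) (UNIV)"
proof -
  have nat: "Infinite_Set_Sum.abs_summable_on (\<lambda>n::nat. inverse (1 + (real n)\<^sup>2)) (UNIV)"
    unfolding abs_summable_on_nat_iff'
  proof (rule summable_comparison_test'[where N = 1])
    show "summable (\<lambda>n. inverse (real n ^ 2))"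
      by (rule inverse_power_summable) simp
    show "norm (norm (inverse (1 + (real n)\<^sup>2))) \<le> inverse (real n ^ 2)" if "1 \<le> n" for n
    proof -
      have "inverse (1 + (real n)\<^sup>2) \<le> inverse (real n ^ 2)"
        using that by (intro le_imp_inverse_le) simp_all
      moreover have "0 \<le> inverse (1 + (real n)\<^sup>2)"
        by simp
      ultimately show ?thesis by (simp only: real_norm_def abs_of_nonneg)
    qed
  qed
  have "Infinite_Set_Sum.abs_summable_on (\<lambda>j::int. inverse (1 + (real_of_int j)\<^sup>2)) (range int)"
    "Infinite_Set_Sum.abs_summable_on (\<lambda>j::int. inverse (1 + (real_of_int j)\<^sup>2)) (range (\<lambda>n. - int n))"
    by (rule_tac [!] abs_summable_on_reindex) (use nat in simp_all)
  then have "Infinite_Set_Sum.abs_summable_on (\<lambda>j::int. inverse (1 + (real_of_int j)\<^sup>2)) ((range int \<union> range (\<lambda>n. - int n)))"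
    by (rule abs_summable_on_union)
  moreover have "range int \<union> range (\<lambda>n. - int n) = UNIV"
  proof -
    have "j \<in> range int \<union> range (\<lambda>n. - int n)" for j
      by (cases j rule: int_cases2) simp_all
    then show ?thesis by (intro UNIV_eq_I[symmetric])
  qed
  ultimately show ?thesis by simp
qed

lemma one_plus_norm_real_vec: "1 + (norm (real_vec k :: real^'m::finite))\<^sup>2 = 1 + (\<Sum>i\<in>UNIV. (real_of_int (k $ i))\<^sup>2)"
  by (simp add: norm_vec_def L2_set_def sum_nonneg real_vec_def)

lemma integrable_lattice_weight:
  "integrable (count_space UNIV) (\<lambda>k::int^'m::finite. 1 / (1 + (norm (real_vec k))\<^sup>2) ^ CARD('m))"
proof (rule Bochner_Integration.integrable_bound)
  have "Infinite_Set_Sum.abs_summable_on (\<lambda>k::'m \<Rightarrow> int. \<Prod>i\<in>UNIV. inverse (1 + (real_of_int (k i))\<^sup>2)) (PiE UNIV (\<lambda>_. UNIV))"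
    by (intro Infinite_Set_Sum.abs_summable_on_prod_PiE abs_summable_inverse_one_plus_square) auto
  then have "Infinite_Set_Sum.abs_summable_on (\<lambda>k::'m \<Rightarrow> int. \<Prod>i\<in>UNIV. inverse (1 + (real_of_int (k i))\<^sup>2)) (UNIV)"
    by simp
  moreover have "bij_betw vec_nth (UNIV :: (int^'m) set) UNIV"
    by (rule bij_betw_byWitness[where f' = vec_lambda]) (auto simp: vec_eq_iff)
  ultimately have "Infinite_Set_Sum.abs_summable_on (\<lambda>k::int^'m. \<Prod>i\<in>UNIV. inverse (1 + (real_of_int (k $ i))\<^sup>2)) (UNIV)"
    by (rule abs_summable_on_reindex_bij_betw[THEN iffD2, rotated])
  then show "integrable (count_space UNIV) (\<lambda>k::int^'m. \<Prod>i\<in>UNIV. inverse (1 + (real_of_int (k $ i))\<^sup>2))"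
    by (simp add: abs_summable_on_def)
  show "AE k in count_space UNIV. norm (1 / (1 + (norm (real_vec k :: real^'m))\<^sup>2) ^ CARD('m))
      \<le> norm (\<Prod>i\<in>UNIV. inverse (1 + (real_of_int (k $ i))\<^sup>2))"
  proof (rule AE_I2)
    fix k :: "int^'m"
    have pos: "0 < 1 + (real_of_int (k $ i))\<^sup>2" for i
      by (simp add: add_pos_nonneg)
    have "(\<Prod>i\<in>UNIV. 1 + (real_of_int (k $ i))\<^sup>2) \<le> (\<Prod>i\<in>(UNIV :: 'm set). 1 + (norm (real_vec k))\<^sup>2)"
      unfolding one_plus_norm_real_vec
      using pos by (intro prod_mono conjI add_left_mono member_le_sum) (auto intro: less_imp_le)
    then have "1 / (1 + (norm (real_vec k))\<^sup>2) ^ CARD('m) \<le> 1 / (\<Prod>i\<in>UNIV. 1 + (real_of_int (k $ i))\<^sup>2)"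
      using pos by (intro divide_left_mono) (auto intro!: mult_pos_pos prod_pos simp: add_pos_nonneg)
    also have "\<dots> = (\<Prod>i\<in>UNIV. inverse (1 + (real_of_int (k $ i))\<^sup>2))"
      by (simp add: inverse_eq_divide prod_dividef)
    finally show "norm (1 / (1 + (norm (real_vec k :: real^'m))\<^sup>2) ^ CARD('m))
      \<le> norm (\<Prod>i\<in>UNIV. inverse (1 + (real_of_int (k $ i))\<^sup>2))"
      by (simp add: add_nonneg_nonneg)
  qed
qed simp

definition dual_measure :: "((int^'m::finite) \<times> (real^'n::finite)) measure" where
  "dual_measure = count_space UNIV \<Otimes>\<^sub>M lborel"

interpretation dual: pair_sigma_finite "count_space (UNIV :: (int^'m::finite) set)" "lborel :: (real^'n::finite) measure"
  by (intro pair_sigma_finite.intro sigma_finite_measure_count_space sigma_finite_lborel)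

definition frequency :: "(int^'m::finite) \<times> (real^'n::finite) \<Rightarrow> (real^'m) \<times> (real^'n)" where
  "frequency = (\<lambda>(k, \<xi>). (real_vec k, \<xi>))"

text \<open>The sum over the lattice and the integral over \<open>\<xi>\<close> are one integral over a product measure, so
  that the results on oscillatory integrals apply. The \<open>unit\<close> argument makes the result a family
  in the sense of \<^const>\<open>rapid\<close>.\<close>

definition inverse_fourier ::
    "(int^'m::finite \<Rightarrow> real^'n::finite \<Rightarrow> complex) \<Rightarrow> unit \<Rightarrow> (real^'m) \<times> (real^'n) \<Rightarrow> complex" where
  "inverse_fourier A _ = osc dual_measure frequency (\<lambda>(k, \<xi>). 1 / (2 * of_real pi) ^ CARD('n) * A k \<xi>)"

lemma measurable_dual:
  fixes A :: "int^'m::finite \<Rightarrow> real^'n::finite \<Rightarrow> 'b::topological_space"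
  assumes "\<And>k. A k \<in> borel_measurable borel"
  shows "(\<lambda>(k, \<xi>). A k \<xi>) \<in> borel_measurable dual_measure"
  unfolding dual_measure_def case_prod_beta
  by (rule measurable_pair_measure_countable1) (auto simp: assms)

lemma measurable_frequency: "frequency \<in> borel_measurable dual_measure"
  unfolding frequency_def
  by (rule measurable_dual) (intro borel_measurable_continuous_onI continuous_intros)

lemma rapid_integrable:
  fixes A :: "int^'m::finite \<Rightarrow> real^'b::finite \<Rightarrow> complex"
  assumes A: "rapid dual_weight A"
  shows "integrable lborel (A k)"
proof -
  obtain C where C: "dual_weight k \<xi> ^ CARD('b) * cmod (A k \<xi>) \<le> C" for k \<xi>
    using rapid_bound[OF A] by blast
  show ?thesis
  proof (rule Bochner_Integration.integrable_bound)
    show "integrable lborel (\<lambda>\<xi>::real^'b. C * (1 / (1 + (norm \<xi>)\<^sup>2) ^ CARD('b)))"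
      using integrable_weight[where 'a = "real^'b"] by (intro integrable_mult_right) simp
    show "A k \<in> borel_measurable lborel"
      using rapid_continuous[OF A] by (simp add: borel_measurable_continuous_onI)
    show "AE \<xi> in lborel. norm (A k \<xi>) \<le> norm (C * (1 / (1 + (norm \<xi>)\<^sup>2) ^ CARD('b)))"
    proof (rule AE_I2)
      fix \<xi> :: "real^'b"
      have pos: "0 < (1 + (norm \<xi>)\<^sup>2) ^ CARD('b)"
        by (simp add: add_pos_nonneg)
      have "(1 + (norm \<xi>)\<^sup>2) ^ CARD('b) * cmod (A k \<xi>) \<le> dual_weight k \<xi> ^ CARD('b) * cmod (A k \<xi>)"
        unfolding dual_weight_def by (intro mult_right_mono power_mono) (auto simp: algebra_simps)
      with C[of k \<xi>] have "(1 + (norm \<xi>)\<^sup>2) ^ CARD('b) * cmod (A k \<xi>) \<le> C" by simp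
      then show "norm (A k \<xi>) \<le> norm (C * (1 / (1 + (norm \<xi>)\<^sup>2) ^ CARD('b)))"
        using pos by (auto simp: field_simps)
    qed
  qed
qed

lemma rapid_integrable_dual:
  fixes A :: "int^'m::finite \<Rightarrow> real^'n::finite \<Rightarrow> complex"
  assumes A: "rapid dual_weight A"
  shows "integrable dual_measure (\<lambda>(k, \<xi>). c * A k \<xi>)"
proof -
  \<comment> \<open>Enough powers of the weight to be summable in \<open>k\<close> and integrable in \<open>\<xi>\<close>.\<close>
  define N where "N = CARD('m) + CARD('n)"
  obtain C where C: "dual_weight k \<xi> ^ N * cmod (A k \<xi>) \<le> C" for k \<xi>
    using rapid_bound[OF A] by blast
  let ?p = "\<lambda>k :: int^'m. (1 + (norm (real_vec k))\<^sup>2) ^ CARD('m)" and ?q = "\<lambda>\<xi> :: real^'n. (1 + (norm \<xi>)\<^sup>2) ^ CARD('n)"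
  have "integrable dual_measure (\<lambda>(k, \<xi>). A k \<xi>)"
  proof (rule Bochner_Integration.integrable_bound)
    show "integrable dual_measure (\<lambda>(k, \<xi>). 1 / ?p k * (C * (1 / ?q \<xi>)))"
      unfolding dual_measure_def
      using integrable_weight[where 'a = "real^'n"] integrable_lattice_weight[where 'm = 'm]
      by (intro dual.integrable_pair_mult integrable_mult_right) simp_all
    show "(\<lambda>(k, \<xi>). A k \<xi>) \<in> borel_measurable dual_measure"
      by (intro measurable_dual borel_measurable_continuous_onI rapid_continuous[OF A])
    show "AE w in dual_measure. norm (case w of (k, \<xi>) \<Rightarrow> A k \<xi>)
        \<le> norm (case w of (k, \<xi>) \<Rightarrow> 1 / ?p k * (C * (1 / ?q \<xi>)))"
    proof (rule AE_I2, clarify)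
      fix k :: "int^'m" and \<xi> :: "real^'n"
      have pos: "0 < ?p k" "0 < ?q \<xi>"
        by (simp_all add: add_pos_nonneg)
      have "?p k * ?q \<xi> \<le> dual_weight k \<xi> ^ N"
        unfolding dual_weight_def power_mult_distrib N_def
        by (intro mult_mono power_increasing) (auto intro: mult_nonneg_nonneg)
      then have "(?p k * ?q \<xi>) * cmod (A k \<xi>) \<le> dual_weight k \<xi> ^ N * cmod (A k \<xi>)"
        by (intro mult_right_mono) auto
      with C[of k \<xi>] have le: "(?p k * ?q \<xi>) * cmod (A k \<xi>) \<le> C" by simp
      have "cmod (A k \<xi>) = (?p k * ?q \<xi>) * cmod (A k \<xi>) / (?p k * ?q \<xi>)"
        using mult_pos_pos[OF pos] by (intro nonzero_mult_div_cancel_left[symmetric]) (rule less_imp_neq[symmetric])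
      also have "\<dots> \<le> C / (?p k * ?q \<xi>)"
        using pos le by (intro divide_right_mono) auto
      also have "\<dots> = 1 / ?p k * (C * (1 / ?q \<xi>))" by simp
      finally show "norm (A k \<xi>) \<le> norm (1 / ?p k * (C * (1 / ?q \<xi>)))"
        by (simp only: real_norm_def)
    qed
  qed
  from integrable_mult_right[OF this, of c] show ?thesis
    by (simp add: case_prod_unfold)
qed

text \<open>Integration by parts in \<open>\<xi>\<close>, separately for each lattice frequency.\<close>

lemma inverse_fourier_partial_deriv:
  fixes A :: "int^'m::finite \<Rightarrow> real^'n::finite \<Rightarrow> complex"
  assumes A: "rapid dual_weight A" and b: "b \<in> Basis"
  shows "inverse_fourier (\<lambda>k. partial_deriv b (A k)) u z = - \<i> * of_real (snd z \<bullet> b) * inverse_fourier A u z"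
proof -
  let ?c = "1 / (2 * of_real pi) ^ CARD('n) :: complex"
  let ?e = "\<lambda>k \<xi>. cis (frequency (k, \<xi>) \<bullet> z)"
  let ?E = "\<lambda>A w. (case w of (k, \<xi>) \<Rightarrow> ?c * A k \<xi>) * cis (frequency w \<bullet> z)"
  note A' = rapid_partial_deriv[OF A b]
  have meas[measurable]: "(\<lambda>w. frequency w \<bullet> z) \<in> borel_measurable dual_measure"
    using measurable_frequency by measurable
  have int: "integrable dual_measure (?E B)" if "rapid dual_weight B" for B
    by (intro integrable_mult_cis rapid_integrable_dual that meas)
  have slice: "(\<integral>\<xi>. (partial_deriv b (A k) \<xi> + \<i> * of_real (snd z \<bullet> b) * A k \<xi>) * ?e k \<xi> \<partial>lborel) = 0" for k
  proof -
    let ?h = "\<lambda>\<xi>. A k \<xi> * ?e k \<xi>"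
    let ?h' = "\<lambda>\<xi>. (partial_deriv b (A k) \<xi> + \<i> * of_real (snd z \<bullet> b) * A k \<xi>) * ?e k \<xi>"
    have cont_e: "continuous_on UNIV (?e k)"
      unfolding cis_conv_exp frequency_def prod.case inner_Pair inner_prod_def by (intro continuous_intros)
    have cont: "continuous_on UNIV ?h'"
      by (intro continuous_intros rapid_continuous[OF A] rapid_continuous[OF A'] cont_e)
    have int_e: "integrable lborel (\<lambda>\<xi>. B \<xi> * ?e k \<xi>)" if "integrable lborel B" for B
      using that by (rule integrable_mult_cis)
        (simp add: frequency_def inner_prod_def borel_measurable_continuous_onI continuous_intros)
    have "(\<integral>\<xi>. indicator UNIV \<xi> *\<^sub>R ?h' \<xi> \<partial>lborel) = 0"
    proof (rule integral_derivative_eq_0_line[where v = b and h = ?h])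
      show "integrable lborel (\<lambda>\<xi>. indicator UNIV \<xi> *\<^sub>R ?h \<xi>)"
        using int_e[OF rapid_integrable[OF A]] by simp
      have "integrable lborel ?h'"
        by (intro int_e Bochner_Integration.integrable_add integrable_mult_right rapid_integrable A A')
      then show "integrable lborel (\<lambda>\<xi>. indicator UNIV \<xi> *\<^sub>R ?h' \<xi>)" by simp
      show "?h' \<in> borel_measurable borel"
        by (rule borel_measurable_continuous_onI[OF cont])
      show "continuous_on UNIV (\<lambda>s. ?h' (\<xi> + s *\<^sub>R b))" for \<xi>
        by (rule continuous_on_compose2[OF cont]) (auto intro!: continuous_intros)
      show "((\<lambda>s. ?h (\<xi> + s *\<^sub>R b)) has_vector_derivative ?h' (\<xi> + s *\<^sub>R b)) (at s)" for \<xi> s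
      proof -
        have "((\<lambda>s. ?e k (\<xi> + s *\<^sub>R b)) has_vector_derivative
            \<i> * of_real (snd z \<bullet> b) * ?e k (\<xi> + s *\<^sub>R b)) (at s)"
          using cis_linear_derivative[of "frequency (k, \<xi>) \<bullet> z" "b \<bullet> snd z" s UNIV]
          by (simp add: frequency_def inner_prod_def inner_add_left inner_commute[of "snd z" b] add.assoc)
        from has_vector_derivative_mult[OF rapid_has_vector_derivative[OF A b, of k \<xi> s UNIV] this]
        show ?thesis
          by (simp add: algebra_simps)
      qed
    qed auto
    then show ?thesis by simp
  qed
  let ?F = "\<lambda>w. ?E (\<lambda>k. partial_deriv b (A k)) w + \<i> * of_real (snd z \<bullet> b) * ?E A w"
  have "integrable dual_measure ?F"
    by (intro Bochner_Integration.integrable_add integrable_mult_right int A A')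
  from dual.integral_fst'[OF this[unfolded dual_measure_def]]
  have "(\<integral>w. ?F w \<partial>dual_measure) = (\<integral>k. (\<integral>\<xi>. ?F (k, \<xi>) \<partial>lborel) \<partial>count_space UNIV)"
    by (simp only: dual_measure_def)
  also have "\<dots> = 0"
  proof -
    have "?F (k, \<xi>) = ?c * ((partial_deriv b (A k) \<xi> + \<i> * of_real (snd z \<bullet> b) * A k \<xi>) * ?e k \<xi>)" for k \<xi>
      by (simp add: algebra_simps add_divide_distrib)
    then have "(\<integral>\<xi>. ?F (k, \<xi>) \<partial>lborel) = 0" for k
      by (simp only: integral_mult_right_zero slice) simp
    then show ?thesis by simp
  qed
  finally have "(\<integral>w. ?E (\<lambda>k. partial_deriv b (A k)) w \<partial>dual_measure) + \<i> * of_real (snd z \<bullet> b) * (\<integral>w. ?E A w \<partial>dual_measure) = 0"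
    using Bochner_Integration.integral_add[OF int[OF A'] integrable_mult_right[OF int[OF A]],
        of "\<i> * of_real (snd z \<bullet> b)"]
    by (simp only: integral_mult_right_zero)
  then show ?thesis
    unfolding inverse_fourier_def osc_def by (simp add: add_eq_0_iff)
qed

interpretation inverse: transform "{A :: int^'m::finite \<Rightarrow> real^'n::finite \<Rightarrow> complex. rapid dual_weight A}" inverse_fourier
proof (standard; (elim CollectE)?)
  fix A B :: "int^'m \<Rightarrow> real^'n \<Rightarrow> complex" and b :: "(real^'m) \<times> (real^'n)" and c :: complex and u :: unit
  assume A: "rapid dual_weight A"
  let ?c = "1 / (2 * of_real pi) ^ CARD('n) :: complex"
  have lincomb: "c * inverse_fourier A u z + d * inverse_fourier B u z = inverse_fourier (\<lambda>k \<xi>. c * A k \<xi> + d * B k \<xi>) u z"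
    if B: "rapid dual_weight B" for c d B u z
  proof -
    define E where "E = (\<lambda>A w. (case w of (k, \<xi>) \<Rightarrow> ?c * A k \<xi>) * cis (frequency w \<bullet> z))"
    have int: "integrable dual_measure (E B)" if "rapid dual_weight B" for B
    proof -
      have "(\<lambda>w. frequency w \<bullet> z) \<in> borel_measurable dual_measure"
        using measurable_frequency by measurable
      then show ?thesis
        unfolding E_def by (intro integrable_mult_cis rapid_integrable_dual that)
    qed
    have "E (\<lambda>k \<xi>. c * A k \<xi> + d * B k \<xi>) = (\<lambda>w. c * E A w + d * E B w)"
      by (auto simp: E_def fun_eq_iff algebra_simps add_divide_distrib)
    then have "(\<integral>w. E (\<lambda>k \<xi>. c * A k \<xi> + d * B k \<xi>) w \<partial>dual_measure)
        = c * (\<integral>w. E A w \<partial>dual_measure) + d * (\<integral>w. E B w \<partial>dual_measure)"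
      using int[OF A] int[OF B] by simp
    then show ?thesis
      unfolding inverse_fourier_def osc_def by (simp only: E_def)
  qed
  show "\<exists>C\<in>{A. rapid dual_weight A}. \<forall>u z. inverse_fourier A u z + inverse_fourier B u z = inverse_fourier C u z"
    if B: "rapid dual_weight B"
    using rapid_lincomb[OF A B dual_weight_nonneg, of 1 1] lincomb[OF B, where c = 1 and d = 1]
    by (intro bexI[of _ "\<lambda>k \<xi>. 1 * A k \<xi> + 1 * B k \<xi>"]) auto
  show "\<exists>C\<in>{A. rapid dual_weight A}. \<forall>u z. c * inverse_fourier A u z = inverse_fourier C u z"
    using rapid_lincomb[OF A A dual_weight_nonneg, of c 0] lincomb[OF A, where c = c and d = 0]
    by (intro bexI[of _ "\<lambda>k \<xi>. c * A k \<xi> + 0 * A k \<xi>"]) auto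
  show "continuous_on UNIV (inverse_fourier A u)"
    unfolding inverse_fourier_def by (intro continuous_on_osc rapid_integrable_dual A measurable_frequency)
  show "\<exists>C. \<forall>u z. cmod (inverse_fourier A u z) \<le> C"
    unfolding inverse_fourier_def using norm_osc_le by blast
  show "\<exists>C\<in>{A. rapid dual_weight A}. \<forall>u z.
      ((\<lambda>s. inverse_fourier A u (z + s *\<^sub>R b)) has_vector_derivative inverse_fourier C u z) (at 0)"
    if b: "b \<in> Basis"
  proof -
    define q where "q = (\<lambda>k \<xi>. real_vec k \<bullet> fst b + \<xi> \<bullet> snd b)"
    have "\<bar>q k \<xi>\<bar> \<le> dual_weight k \<xi>" for k \<xi>
    proof -
      from b consider i where "b = (axis i 1, 0)" | j where "b = (0, axis j 1)"
        by (auto simp: Basis_prod_def Basis_vec_def)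
      then have "\<bar>q k \<xi>\<bar> \<le> 1 + (norm (real_vec k))\<^sup>2 \<or> \<bar>q k \<xi>\<bar> \<le> 1 + (norm \<xi>)\<^sup>2"
        using abs_nth_le_weight[of "real_vec k"] abs_nth_le_weight[of \<xi>]
        by cases (auto simp: q_def inner_axis)
      moreover have "1 + (norm (real_vec k))\<^sup>2 \<le> dual_weight k \<xi>" "1 + (norm \<xi>)\<^sup>2 \<le> dual_weight k \<xi>"
        by (auto simp: dual_weight_def algebra_simps)
      ultimately show ?thesis by linarith
    qed
    then have "rapid dual_weight (\<lambda>k \<xi>. of_real (q k \<xi>) * A k \<xi>)"
      unfolding q_def by (intro rapid_affine_mult A dual_weight_nonneg)
    from rapid_cmult[OF this dual_weight_nonneg, of \<i>]
    have C: "rapid dual_weight (\<lambda>k \<xi>. \<i> * (of_real (q k \<xi>) * A k \<xi>))" .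
    have eq: "(\<lambda>w. \<i> * of_real (frequency w \<bullet> b) * (case w of (k, \<xi>) \<Rightarrow> ?c * A k \<xi>))
        = (\<lambda>(k, \<xi>). ?c * (\<i> * (of_real (q k \<xi>) * A k \<xi>)))"
      by (auto simp: q_def frequency_def inner_prod_def)
    have "integrable dual_measure (\<lambda>w. \<i> * of_real (frequency w \<bullet> b) * (case w of (k, \<xi>) \<Rightarrow> ?c * A k \<xi>))"
      unfolding eq by (rule rapid_integrable_dual[OF C])
    from has_vector_derivative_osc[OF rapid_integrable_dual[OF A] measurable_frequency this]
    show ?thesis
      unfolding eq inverse_fourier_def
      by (intro bexI[of _ "\<lambda>k \<xi>. \<i> * (of_real (q k \<xi>) * A k \<xi>)"] allI CollectI C)
  qed
qed

lemma rapid_inverse_fourier: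
  fixes A :: "int^'m::finite \<Rightarrow> real^'n::finite \<Rightarrow> complex"
  assumes A: "rapid dual_weight A"
  shows "rapid space_weight (inverse_fourier A)"
proof (rule inverse.rapid_transform[OF _ space_weight_nonneg])
  have "inverse.multiplier (\<lambda>u (z :: (real^'m) \<times> (real^'n)). of_real (1 + (norm (snd z))\<^sup>2))"
  proof (rule inverse.multiplier_one_plus_norm_square)
    fix j
    show "inverse.multiplier (\<lambda>u (z :: (real^'m) \<times> (real^'n)). \<i> * of_real (snd z $ j))"
      unfolding inverse.multiplier_def
    proof
      fix A :: "int^'m \<Rightarrow> real^'n \<Rightarrow> complex"
      assume "A \<in> {A. rapid dual_weight A}"
      then have A: "rapid dual_weight A" by simp
      have b: "(axis j 1 :: real^'n) \<in> Basis" by simp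
      note A' = rapid_partial_deriv[OF A b]
      obtain C where C: "C \<in> {A. rapid dual_weight A}"
        "\<And>u z. (-1) * inverse_fourier (\<lambda>k. partial_deriv (axis j 1) (A k)) u z = inverse_fourier C u z"
        using inverse.transform_scale[of _ "-1"] A' by blast
      then have "\<i> * of_real (snd z $ j) * inverse_fourier A u z = inverse_fourier C u z" for u z
        using inverse_fourier_partial_deriv[OF A b, of u z] by (simp add: inner_axis flip: C(2))
      with C(1) show "\<exists>C\<in>{A. rapid dual_weight A}. \<forall>u z. \<i> * of_real (snd z $ j) * inverse_fourier A u z = inverse_fourier C u z"
        by blast
    qed
  qed
  then show "inverse.multiplier (\<lambda>u (z :: (real^'m) \<times> (real^'n)). of_real (space_weight u z))"
    by (simp add: space_weight_def)
qed (use A in simp)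

section \<open>Fourier inversion on a Euclidean space\<close>

lemma lborel_integral_affine:
  fixes h :: "'a::euclidean_space \<Rightarrow> complex"
  assumes [measurable]: "h \<in> borel_measurable borel" and c: "c \<noteq> 0"
  shows "(\<integral>y. h y \<partial>lborel) = \<bar>c\<bar> ^ DIM('a) *\<^sub>R (\<integral>u. h (t + c *\<^sub>R u) \<partial>lborel)"
  by (subst lborel_affine[OF c, of t]) (simp add: integral_density integral_distr)

lemma
  fixes u :: real
  shows integrable_gaussian_cis: "integrable lborel (\<lambda>s. of_real (exp (- s\<^sup>2 / 2)) * cis (s * u))"
    and integral_gaussian_cis: "(\<integral>s. of_real (exp (- s\<^sup>2 / 2)) * cis (s * u) \<partial>lborel)
      = of_real (sqrt (2 * pi) * exp (- u\<^sup>2 / 2))"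
proof -
  have eq: "complex_of_real (exp (- s\<^sup>2 / 2)) * cis (s * u)
      = of_real (sqrt (2 * pi)) * (std_normal_density s *\<^sub>R iexp (u * s))" for s
    by (simp add: std_normal_density_def scaleR_conv_of_real cis_conv_exp mult.commute)
  have "integrable lborel (\<lambda>s. complex_of_real (std_normal_density s))"
    by (intro integrable_of_real integrable_normal_density) simp
  from integrable_mult_cis[OF this, of "\<lambda>s. u * s"]
  have "integrable lborel (\<lambda>s. std_normal_density s *\<^sub>R iexp (u * s))"
    by (simp add: scaleR_conv_of_real cis_conv_exp)
  then show "integrable lborel (\<lambda>s. of_real (exp (- s\<^sup>2 / 2)) * cis (s * u))"
    unfolding eq by (intro integrable_mult_right)
  have "(\<integral>s. std_normal_density s *\<^sub>R iexp (u * s) \<partial>lborel) = char std_normal_distribution u"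
    unfolding char_def by (subst integral_density) auto
  then show "(\<integral>s. of_real (exp (- s\<^sup>2 / 2)) * cis (s * u) \<partial>lborel) = of_real (sqrt (2 * pi) * exp (- u\<^sup>2 / 2))"
    unfolding eq integral_mult_right_zero by (simp add: char_std_normal_distribution)
qed

definition gaussian :: "'a::euclidean_space \<Rightarrow> real" where
  "gaussian x = exp (- (norm x)\<^sup>2 / 2)"

lemma continuous_gaussian: "continuous_on S gaussian"
  unfolding gaussian_def by (intro continuous_intros) auto

lemma borel_measurable_gaussian [measurable]: "gaussian \<in> borel_measurable borel"
  by (rule borel_measurable_continuous_onI[OF continuous_gaussian])

lemma
  fixes u :: "'a::euclidean_space"
  shows integrable_gaussian_cis_inner: "integrable lborel (\<lambda>\<xi>. of_real (gaussian \<xi>) * cis (\<xi> \<bullet> u))"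
    and integral_gaussian_cis_inner: "(\<integral>\<xi>. of_real (gaussian \<xi>) * cis (\<xi> \<bullet> u) \<partial>lborel)
      = of_real (sqrt (2 * pi) ^ DIM('a) * gaussian u)"
proof -
  have norm: "(norm x)\<^sup>2 = (\<Sum>b\<in>Basis. (x \<bullet> b)\<^sup>2)" for x :: 'a
    unfolding power2_norm_eq_inner unfolding euclidean_inner[of x x] power2_eq_square ..
  have gaussian: "gaussian x = (\<Prod>b\<in>Basis. exp (- (x \<bullet> b)\<^sup>2 / 2))" for x :: 'a
    by (simp add: gaussian_def norm sum_divide_distrib sum_negf[symmetric] flip: exp_sum)
  have eq: "of_real (gaussian \<xi>) * cis (\<xi> \<bullet> u)
      = (\<Prod>b\<in>Basis. of_real (exp (- (\<xi> \<bullet> b)\<^sup>2 / 2)) * cis ((\<xi> \<bullet> b) * (u \<bullet> b)))" for \<xi> :: 'a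
  proof -
    have "cis (\<xi> \<bullet> u) = (\<Prod>b\<in>Basis. cis ((\<xi> \<bullet> b) * (u \<bullet> b)))"
      unfolding cis_conv_exp euclidean_inner[of \<xi> u] by (simp add: sum_distrib_left exp_sum)
    then show ?thesis
      by (simp add: gaussian prod.distrib)
  qed
  show "integrable lborel (\<lambda>\<xi>. of_real (gaussian \<xi>) * cis (\<xi> \<bullet> u))"
    unfolding eq by (intro integrable_lborel_prod integrable_gaussian_cis)
  show "(\<integral>\<xi>. of_real (gaussian \<xi>) * cis (\<xi> \<bullet> u) \<partial>lborel) = of_real (sqrt (2 * pi) ^ DIM('a) * gaussian u)"
    unfolding eq integral_lborel_prod[OF integrable_gaussian_cis] integral_gaussian_cis
    by (simp add: gaussian prod.distrib)
qed

lemma integrable_gaussian: "integrable lborel (\<lambda>\<xi>::'a::euclidean_space. complex_of_real (gaussian \<xi>))"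
  using integrable_gaussian_cis_inner[of "0::'a"] by simp

lemma integral_gaussian:
  "(\<integral>\<xi>. complex_of_real (gaussian (\<xi> :: 'a::euclidean_space)) \<partial>lborel) = of_real (sqrt (2 * pi) ^ DIM('a))"
  using integral_gaussian_cis_inner[of "0::'a"] by (simp add: gaussian_def)

text \<open>The function \<open>f\<close> is integrable but possibly unbounded, so it is cut at the unit sphere about
  \<open>x\<close>. On the ball, where \<open>f\<close> is bounded, rescaling the integration variable makes the Gaussian
  fixed and dominated convergence applies. Off the ball the kernel is at most
  \<open>c\<^sup>n exp (- c\<^sup>2 / 2)\<close>, which tends to 0 and is integrated against \<open>\<bar>f\<bar>\<close>.\<close>

lemma gaussian_mean_tendsto:
  fixes f :: "'a::euclidean_space \<Rightarrow> complex"
  assumes f: "integrable lborel f" and cont: "continuous_on UNIV f"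
  shows "(\<lambda>n. \<integral>y. f y * of_real (real (Suc n) ^ DIM('a) * gaussian (real (Suc n) *\<^sub>R (x - y))) \<partial>lborel)
    \<longlonglongrightarrow> of_real (sqrt (2 * pi) ^ DIM('a)) * f x"
proof -
  define near where "near = (\<lambda>y. indicator (cball x 1) y *\<^sub>R f y)"
  define far where "far = (\<lambda>y. indicator (- cball x 1) y *\<^sub>R f y)"
  define K where "K = (\<lambda>n y. complex_of_real (real (Suc n) ^ DIM('a) * gaussian (real (Suc n) *\<^sub>R (x - y))))"
  have f_meas[measurable]: "f \<in> borel_measurable borel"
    by (rule borel_measurable_continuous_onI[OF cont])
  have [measurable]: "near \<in> borel_measurable borel" "far \<in> borel_measurable borel"
    unfolding near_def far_def
    by (intro borel_measurable_scaleR borel_measurable_indicator f_meas borel_comp borel_closed closed_cball)+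
  have [measurable]: "K n \<in> borel_measurable borel" for n
    unfolding K_def
    by (intro borel_measurable_continuous_onI continuous_intros
        continuous_on_compose2[OF continuous_gaussian[of UNIV]]) auto
  have int_near: "integrable lborel near" and int_far: "integrable lborel far"
    unfolding near_def far_def by (intro integrable_mult_indicator f; simp)+
  have gaussian_le: "gaussian z \<le> 1" "0 \<le> gaussian z" for z :: 'a
    by (simp_all add: gaussian_def)
  have int_K: "integrable lborel (\<lambda>y. g y * K n y)" if "integrable lborel g" for g n
  proof (rule Bochner_Integration.integrable_bound)
    show "integrable lborel (\<lambda>y. real (Suc n) ^ DIM('a) * cmod (g y))"
      by (intro integrable_mult_right integrable_norm that)
    show "(\<lambda>y. g y * K n y) \<in> borel_measurable lborel"
      using borel_measurable_integrable[OF that] by measurable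
    show "AE y in lborel. norm (g y * K n y) \<le> norm (real (Suc n) ^ DIM('a) * cmod (g y))"
    proof (rule AE_I2)
      fix y
      have "norm (g y * K n y) = cmod (g y) * (real (Suc n) ^ DIM('a) * gaussian (real (Suc n) *\<^sub>R (x - y)))"
        unfolding K_def norm_mult norm_of_real using gaussian_le by (simp add: abs_mult)
      also have "\<dots> \<le> cmod (g y) * (real (Suc n) ^ DIM('a) * 1)"
        by (intro mult_left_mono gaussian_le) auto
      finally show "norm (g y * K n y) \<le> norm (real (Suc n) ^ DIM('a) * cmod (g y))"
        by (simp add: mult.commute abs_mult)
    qed
  qed
  obtain B where B: "cmod (near y) \<le> B" for y
  proof -
    have "bounded (f ` cball x 1)"
      by (intro compact_imp_bounded compact_continuous_image continuous_on_subset[OF cont]) auto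
    then obtain B where "\<forall>y\<in>cball x 1. cmod (f y) \<le> B" "0 < B"
      unfolding bounded_pos by auto
    then show thesis
      by (intro that[of B]) (auto simp: near_def indicator_def)
  qed
  have near_lim: "(\<lambda>n. \<integral>y. near y * K n y \<partial>lborel) \<longlonglongrightarrow> of_real (sqrt (2 * pi) ^ DIM('a)) * f x"
  proof -
    have subst: "(\<integral>y. near y * K n y \<partial>lborel) = (\<integral>u. near (x + (1 / real (Suc n)) *\<^sub>R u) * of_real (gaussian u) \<partial>lborel)" for n
    proof -
      have "(\<integral>y. near y * K n y \<partial>lborel) = \<bar>1 / real (Suc n)\<bar> ^ DIM('a) *\<^sub>R
          (\<integral>u. near (x + (1 / real (Suc n)) *\<^sub>R u) * K n (x + (1 / real (Suc n)) *\<^sub>R u) \<partial>lborel)"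
        by (rule lborel_integral_affine) auto
      also have "\<dots> = (\<integral>u. \<bar>1 / real (Suc n)\<bar> ^ DIM('a) *\<^sub>R
          (near (x + (1 / real (Suc n)) *\<^sub>R u) * K n (x + (1 / real (Suc n)) *\<^sub>R u)) \<partial>lborel)"
        by (simp only: integral_scaleR_right)
      also have "\<dots> = (\<integral>u. near (x + (1 / real (Suc n)) *\<^sub>R u) * of_real (gaussian u) \<partial>lborel)"
        by (intro Bochner_Integration.integral_cong refl)
          (simp add: K_def gaussian_def scaleR_conv_of_real power_divide del: of_nat_Suc)
      finally show ?thesis .
    qed
    have "(\<lambda>n. \<integral>u. near (x + (1 / real (Suc n)) *\<^sub>R u) * of_real (gaussian u) \<partial>lborel)
        \<longlonglongrightarrow> (\<integral>u. f x * of_real (gaussian (u::'a)) \<partial>lborel)"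
    proof (rule integral_dominated_convergence[where w = "\<lambda>u. B * gaussian u"])
      show "integrable lborel (\<lambda>u::'a. B * gaussian u)"
        using integrable_norm[OF integrable_gaussian[where 'a = 'a]] gaussian_le
        by (intro integrable_mult_right) simp
      show "AE u in lborel. norm (near (x + (1 / real (Suc n)) *\<^sub>R u) * of_real (gaussian u)) \<le> B * gaussian u" for n
        using B gaussian_le by (intro AE_I2) (simp add: norm_mult mult_right_mono)
      show "AE u in lborel. (\<lambda>n. near (x + (1 / real (Suc n)) *\<^sub>R u) * of_real (gaussian u)) \<longlonglongrightarrow> f x * of_real (gaussian u)"
      proof (rule AE_I2)
        fix u :: 'a
        have lim: "(\<lambda>n. x + (1 / real (Suc n)) *\<^sub>R u) \<longlonglongrightarrow> x + 0 *\<^sub>R u"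
          using LIMSEQ_inverse_real_of_nat by (intro tendsto_intros) (simp add: inverse_eq_divide)
        have "eventually (\<lambda>n. x + (1 / real (Suc n)) *\<^sub>R u \<in> ball x 1) sequentially"
          using lim by (intro topological_tendstoD) auto
        then have "eventually (\<lambda>n. f (x + (1 / real (Suc n)) *\<^sub>R u) = near (x + (1 / real (Suc n)) *\<^sub>R u)) sequentially"
          by eventually_elim (auto simp: near_def indicator_def mem_ball)
        moreover have "(\<lambda>n. f (x + (1 / real (Suc n)) *\<^sub>R u)) \<longlonglongrightarrow> f x"
          using continuous_on_tendsto_compose[OF cont lim] by simp
        ultimately have "(\<lambda>n. near (x + (1 / real (Suc n)) *\<^sub>R u)) \<longlonglongrightarrow> f x"
          by (rule Lim_transform_eventually[rotated])
        then show "(\<lambda>n. near (x + (1 / real (Suc n)) *\<^sub>R u) * of_real (gaussian u)) \<longlonglongrightarrow> f x * of_real (gaussian u)"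
          by (intro tendsto_intros)
      qed
    qed auto
    moreover have "(\<integral>u. f x * of_real (gaussian (u::'a)) \<partial>lborel) = of_real (sqrt (2 * pi) ^ DIM('a)) * f x"
      unfolding integral_mult_right_zero integral_gaussian by (rule mult.commute)
    ultimately show ?thesis
      by (simp only: subst)
  qed
  have far_lim: "(\<lambda>n. \<integral>y. far y * K n y \<partial>lborel) \<longlonglongrightarrow> 0"
  proof (rule Lim_null_comparison)
    show "eventually (\<lambda>n. norm (\<integral>y. far y * K n y \<partial>lborel)
        \<le> real (Suc n) ^ DIM('a) / exp (real (Suc n)) * (\<integral>y. cmod (far y) \<partial>lborel)) sequentially"
      using eventually_ge_at_top[of 1]
    proof eventually_elim
      case (elim n)
      have "norm (far y * K n y) \<le> cmod (far y) * (real (Suc n) ^ DIM('a) / exp (real (Suc n)))" for y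
      proof (cases "y \<in> cball x 1")
        case False
        then have y: "1 \<le> norm (x - y)" by (simp add: dist_norm)
        have "real (Suc n) * 2 \<le> real (Suc n) * real (Suc n)"
          using elim by (intro mult_left_mono) auto
        then have "real (Suc n) \<le> (real (Suc n))\<^sup>2 / 2"
          by (simp add: power2_eq_square del: of_nat_Suc)
        also have "\<dots> \<le> (norm (real (Suc n) *\<^sub>R (x - y)))\<^sup>2 / 2"
          using y by (simp add: power_mult_distrib del: of_nat_Suc)
        finally have "gaussian (real (Suc n) *\<^sub>R (x - y)) \<le> exp (- real (Suc n))"
          unfolding gaussian_def by simp
        then have "real (Suc n) ^ DIM('a) * gaussian (real (Suc n) *\<^sub>R (x - y)) \<le> real (Suc n) ^ DIM('a) / exp (real (Suc n))"
          by (simp add: exp_minus divide_inverse del: of_nat_Suc)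
        then show ?thesis
          unfolding norm_mult K_def norm_of_real using gaussian_le
          by (intro mult_left_mono) (simp_all add: abs_mult del: of_nat_Suc)
      qed (simp add: far_def)
      then have "(\<integral>y. norm (far y * K n y) \<partial>lborel) \<le> (\<integral>y. cmod (far y) * (real (Suc n) ^ DIM('a) / exp (real (Suc n))) \<partial>lborel)"
        by (intro integral_mono integrable_norm int_K int_far integrable_mult_left)
      then show ?case
        by (intro order_trans[OF integral_norm_bound]) (simp add: mult.commute del: of_nat_Suc)
    qed
    have "(\<lambda>n. real (Suc n) ^ DIM('a) / exp (real (Suc n))) \<longlonglongrightarrow> 0"
      by (rule filterlim_compose[OF tendsto_power_div_exp_0 filterlim_compose[OF filterlim_real_sequentially filterlim_Suc]])
    then show "(\<lambda>n. real (Suc n) ^ DIM('a) / exp (real (Suc n)) * (\<integral>y. cmod (far y) \<partial>lborel)) \<longlonglongrightarrow> 0"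
      by (rule tendsto_mult_left_zero)
  qed
  have "(\<integral>y. f y * K n y \<partial>lborel) = (\<integral>y. near y * K n y \<partial>lborel) + (\<integral>y. far y * K n y \<partial>lborel)" for n
  proof -
    have "(\<lambda>y. f y * K n y) = (\<lambda>y. near y * K n y + far y * K n y)"
      by (auto simp: near_def far_def indicator_def fun_eq_iff)
    then show ?thesis
      by (simp only: Bochner_Integration.integral_add[OF int_K[OF int_near] int_K[OF int_far]])
  qed
  then show ?thesis
    using tendsto_add[OF near_lim far_lim] by (simp add: K_def)
qed

text \<open>Inserting the factor \<open>gaussian (\<xi> / c)\<close> in the inversion integral makes Fubini applicable and
  turns it into a Gaussian mean of \<open>f\<close> about \<open>x\<close>. As \<open>c\<close> tends to infinity the means tend to
  \<open>f x\<close>, and the regularised integrals tend to the inversion integral because \<open>F\<close> is integrable.\<close>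

lemma fourier_inversion:
  fixes f :: "'a::euclidean_space \<Rightarrow> complex"
  assumes f: "integrable lborel f" and cont: "continuous_on UNIV f"
    and F_def: "\<And>\<xi>. F \<xi> = (\<integral>y. f y * cis (- (y \<bullet> \<xi>)) \<partial>lborel)" and F: "integrable lborel F"
  shows "f x = 1 / (2 * of_real pi) ^ DIM('a) * (\<integral>\<xi>. F \<xi> * cis (\<xi> \<bullet> x) \<partial>lborel)"
proof -
  let ?G = "\<lambda>n (\<xi> :: 'a). complex_of_real (gaussian ((1 / real (Suc n)) *\<^sub>R \<xi>))"
  note [measurable] = borel_measurable_continuous_onI[OF cont] borel_measurable_integrable[OF F, simplified]
  have smoothed: "(\<integral>\<xi>. F \<xi> * cis (\<xi> \<bullet> x) * ?G n \<xi> \<partial>lborel) = of_real (sqrt (2 * pi) ^ DIM('a)) *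
      (\<integral>y. f y * of_real (real (Suc n) ^ DIM('a) * gaussian (real (Suc n) *\<^sub>R (x - y))) \<partial>lborel)" for n
  proof -
    let ?H = "\<lambda>y \<xi>. f y * (?G n \<xi> * cis (\<xi> \<bullet> (x - y)))"
    have scaled: "(\<integral>\<xi>. ?G n \<xi> * cis (\<xi> \<bullet> v) \<partial>lborel)
        = of_real (sqrt (2 * pi) ^ DIM('a) * (real (Suc n) ^ DIM('a) * gaussian (real (Suc n) *\<^sub>R v)))" for v :: 'a
    proof -
      have "(\<integral>\<xi>. ?G n \<xi> * cis (\<xi> \<bullet> v) \<partial>lborel) = \<bar>real (Suc n)\<bar> ^ DIM('a) *\<^sub>R
          (\<integral>\<eta>. ?G n (0 + real (Suc n) *\<^sub>R \<eta>) * cis ((0 + real (Suc n) *\<^sub>R \<eta>) \<bullet> v) \<partial>lborel)"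
        by (rule lborel_integral_affine) auto
      also have "(\<lambda>\<eta>. ?G n (0 + real (Suc n) *\<^sub>R \<eta>) * cis ((0 + real (Suc n) *\<^sub>R \<eta>) \<bullet> v))
          = (\<lambda>\<eta>. of_real (gaussian \<eta>) * cis (\<eta> \<bullet> (real (Suc n) *\<^sub>R v)))"
        by (auto simp: fun_eq_iff simp del: of_nat_Suc)
      finally show ?thesis
        by (simp only: integral_gaussian_cis_inner) (simp add: scaleR_conv_of_real mult_ac del: of_nat_Suc)
    qed
    \<comment> \<open>The integral of a non-integrable function is 0 by convention, but this one is positive.\<close>
    have int_G: "integrable lborel (?G n)"
    proof (rule ccontr)
      assume "\<not> integrable lborel (?G n)"
      then have "(\<integral>\<xi>. ?G n \<xi> \<partial>lborel) = 0"
        by (rule not_integrable_integral_eq)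
      then show False
        using scaled[of 0] by (simp add: gaussian_def del: of_nat_Suc)
    qed
    have "integrable (lborel \<Otimes>\<^sub>M lborel) (\<lambda>(y, \<xi>). cmod (f y) * cmod (?G n \<xi>))"
      by (intro lborel_pair.integrable_pair_mult integrable_norm f int_G)
    then have int: "integrable (lborel \<Otimes>\<^sub>M lborel) (\<lambda>(y, \<xi>). ?H y \<xi>)"
      by (rule Bochner_Integration.integrable_bound) (auto simp: norm_mult)
    have "(\<integral>\<xi>. F \<xi> * cis (\<xi> \<bullet> x) * ?G n \<xi> \<partial>lborel) = (\<integral>\<xi>. (\<integral>y. ?H y \<xi> \<partial>lborel) \<partial>lborel)"
    proof (rule Bochner_Integration.integral_cong[OF refl])
      fix \<xi>
      have "cis (\<xi> \<bullet> (x - y)) = cis (\<xi> \<bullet> x) * cis (- (y \<bullet> \<xi>))" for y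
        by (simp add: cis_mult inner_diff_right inner_commute)
      then have "(\<lambda>y. ?H y \<xi>) = (\<lambda>y. (cis (\<xi> \<bullet> x) * ?G n \<xi>) * (f y * cis (- (y \<bullet> \<xi>))))"
        by (auto simp: fun_eq_iff)
      then show "F \<xi> * cis (\<xi> \<bullet> x) * ?G n \<xi> = (\<integral>y. ?H y \<xi> \<partial>lborel)"
        unfolding F_def by (simp only: integral_mult_right_zero) (simp add: mult_ac)
    qed
    also have "\<dots> = (\<integral>y. (\<integral>\<xi>. ?H y \<xi> \<partial>lborel) \<partial>lborel)"
      by (rule lborel_pair.Fubini_integral[OF int])
    also have "\<dots> = (\<integral>y. of_real (sqrt (2 * pi) ^ DIM('a)) *
        (f y * of_real (real (Suc n) ^ DIM('a) * gaussian (real (Suc n) *\<^sub>R (x - y)))) \<partial>lborel)"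
    proof (rule Bochner_Integration.integral_cong[OF refl])
      fix y
      have "(\<integral>\<xi>. ?H y \<xi> \<partial>lborel) = f y * of_real (sqrt (2 * pi) ^ DIM('a)
          * (real (Suc n) ^ DIM('a) * gaussian (real (Suc n) *\<^sub>R (x - y))))"
        by (simp only: integral_mult_right_zero scaled)
      then show "(\<integral>\<xi>. ?H y \<xi> \<partial>lborel) = of_real (sqrt (2 * pi) ^ DIM('a)) *
          (f y * of_real (real (Suc n) ^ DIM('a) * gaussian (real (Suc n) *\<^sub>R (x - y))))"
        by (simp only: of_real_mult mult_ac)
    qed
    finally show ?thesis
      by (simp only: integral_mult_right_zero)
  qed
  have "(\<lambda>n. \<integral>\<xi>. F \<xi> * cis (\<xi> \<bullet> x) * ?G n \<xi> \<partial>lborel) \<longlonglongrightarrow> (\<integral>\<xi>. F \<xi> * cis (\<xi> \<bullet> x) \<partial>lborel)"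
  proof (rule integral_dominated_convergence[where w = "\<lambda>\<xi>. cmod (F \<xi>)"])
    show "AE \<xi> in lborel. norm (F \<xi> * cis (\<xi> \<bullet> x) * ?G n \<xi>) \<le> cmod (F \<xi>)" for n
      by (intro AE_I2) (simp add: norm_mult gaussian_def mult_left_le)
    show "AE \<xi> in lborel. (\<lambda>n. F \<xi> * cis (\<xi> \<bullet> x) * ?G n \<xi>) \<longlonglongrightarrow> F \<xi> * cis (\<xi> \<bullet> x)"
    proof (rule AE_I2)
      fix \<xi> :: 'a
      have "(\<lambda>n. (1 / real (Suc n)) *\<^sub>R \<xi>) \<longlonglongrightarrow> 0 *\<^sub>R \<xi>"
        using LIMSEQ_inverse_real_of_nat by (intro tendsto_intros) (simp add: inverse_eq_divide)
      from continuous_on_tendsto_compose[OF continuous_gaussian[of UNIV] this]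
      have "(\<lambda>n. gaussian ((1 / real (Suc n)) *\<^sub>R \<xi>)) \<longlonglongrightarrow> 1"
        by (simp add: gaussian_def)
      then have "(\<lambda>n. F \<xi> * cis (\<xi> \<bullet> x) * ?G n \<xi>) \<longlonglongrightarrow> F \<xi> * cis (\<xi> \<bullet> x) * of_real 1"
        by (intro tendsto_intros)
      then show "(\<lambda>n. F \<xi> * cis (\<xi> \<bullet> x) * ?G n \<xi>) \<longlonglongrightarrow> F \<xi> * cis (\<xi> \<bullet> x)" by simp
    qed
  qed (use F in auto)
  moreover have "(\<lambda>n. \<integral>\<xi>. F \<xi> * cis (\<xi> \<bullet> x) * ?G n \<xi> \<partial>lborel)
      \<longlonglongrightarrow> of_real (sqrt (2 * pi) ^ DIM('a)) * (of_real (sqrt (2 * pi) ^ DIM('a)) * f x)"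
    unfolding smoothed by (intro tendsto_intros gaussian_mean_tendsto f cont)
  ultimately have "(\<integral>\<xi>. F \<xi> * cis (\<xi> \<bullet> x) \<partial>lborel) = of_real (sqrt (2 * pi) ^ DIM('a)) * (of_real (sqrt (2 * pi) ^ DIM('a)) * f x)"
    by (rule LIMSEQ_unique)
  also have "\<dots> = of_real ((sqrt (2 * pi) * sqrt (2 * pi)) ^ DIM('a)) * f x"
    by (simp only: power_mult_distrib of_real_mult mult.assoc)
  also have "\<dots> = (2 * of_real pi) ^ DIM('a) * f x"
    by simp
  finally show ?thesis by simp
qed

section \<open>Uniqueness of Fourier coefficients on the torus\<close>

lemma inner_real_vec_add: "t \<bullet> real_vec (k + l) = t \<bullet> real_vec k + t \<bullet> real_vec l"
  by (simp add: real_vec_def inner_vec_def sum.distrib algebra_simps)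

lemma real_vec_minus: "real_vec (k - l) = real_vec k - real_vec l"
  by (simp add: real_vec_def vec_eq_iff)

lemma integral_torus_character:
  fixes k :: "int^'m::finite"
  shows "(\<integral>t. indicator period_box t *\<^sub>R cis (t \<bullet> real_vec k) \<partial>lborel) = (if k = 0 then (2 * of_real pi) ^ CARD('m) else 0)"
proof -
  let ?f = "\<lambda>(b :: real^'m) s. indicator {0..2 * pi} s *\<^sub>R cis (0 + s * (real_vec k \<bullet> b))"
  have int: "integrable lborel (?f b)" for b
  proof -
    have "set_integrable lborel {0..2 * pi} (\<lambda>s. cis (0 + s * (real_vec k \<bullet> b)))"
      unfolding cis_conv_exp by (intro borel_integrable_atLeastAtMost' continuous_intros)
    then show ?thesis by (simp add: set_integrable_def)
  qed
  have "indicator period_box t *\<^sub>R cis (t \<bullet> real_vec k) = (\<Prod>b\<in>Basis. ?f b (t \<bullet> b))" for t :: "real^'m"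
  proof -
    have "cis (t \<bullet> real_vec k) = (\<Prod>b\<in>Basis. cis (0 + (t \<bullet> b) * (real_vec k \<bullet> b)))"
      unfolding cis_conv_exp euclidean_inner[of t "real_vec k"] by (simp add: sum_distrib_left exp_sum)
    moreover have "indicator period_box t = (\<Prod>b\<in>Basis. indicator {0..2 * pi} (t \<bullet> b) :: real)"
    proof (cases "t \<in> period_box")
      case True
      have "indicator {0..2 * pi} (t \<bullet> b) = (1 :: real)" if b: "b \<in> Basis" for b :: "real^'m"
      proof -
        obtain i where "b = axis i 1"
          using b by (auto simp: Basis_vec_def)
        then show ?thesis
          using True by (simp add: period_box_iff inner_axis)
      qed
      then show ?thesis
        using True by (simp cong: prod.cong)
    next
      case False
      then obtain i where "\<not> (0 \<le> t $ i \<and> t $ i \<le> 2 * pi)"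
        by (auto simp: period_box_iff)
      then have "\<exists>b\<in>Basis. indicator {0..2 * pi} (t \<bullet> b) = (0::real)"
        by (intro bexI[of _ "axis i 1"]) (auto simp: inner_axis)
      then show ?thesis
        using False by (simp add: prod_zero_iff)
    qed
    ultimately show ?thesis
      by (simp add: scaleR_conv_of_real prod.distrib)
  qed
  then have eq: "(\<integral>t. indicator period_box t *\<^sub>R cis (t \<bullet> real_vec k) \<partial>lborel) = (\<Prod>b\<in>Basis. \<integral>s. ?f b s \<partial>lborel)"
    by (simp only: integral_lborel_prod[OF int])
  show ?thesis
  proof (cases "k = 0")
    case True
    have "(\<integral>s. ?f b s \<partial>lborel) = 2 * of_real pi" for b
      using True by (simp add: real_vec_def scaleR_conv_of_real flip: zero_vec_def)
    then have "(\<integral>t. indicator period_box t *\<^sub>R cis (t \<bullet> real_vec k) \<partial>lborel) = (\<Prod>b\<in>(Basis :: (real^'m) set). 2 * of_real pi)"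
      by (simp only: eq)
    then show ?thesis
      using True by simp
  next
    case False
    then obtain i where i: "k $ i \<noteq> 0"
      by (auto simp: vec_eq_iff)
    have "(\<integral>s. ?f (axis i 1) s \<partial>lborel)
        = cis (0 + 2 * pi * (real_vec k \<bullet> axis i 1)) / (\<i> * of_int (k $ i)) - cis (0 + 0 * (real_vec k \<bullet> axis i 1)) / (\<i> * of_int (k $ i))"
    proof (rule integral_FTC_atLeastAtMost)
      show "((\<lambda>s. cis (0 + s * (real_vec k \<bullet> axis i 1)) / (\<i> * of_int (k $ i))) has_vector_derivative
          cis (0 + s * (real_vec k \<bullet> axis i 1))) (at s within {0..2 * pi})" for s
        using has_vector_derivative_divide[OF cis_linear_derivative[of 0 "real_vec k \<bullet> axis i 1" s "{0..2 * pi}"], of "\<i> * of_int (k $ i)"] i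
        by (simp add: real_vec_def inner_axis)
      show "continuous_on {0..2 * pi} (\<lambda>s. cis (0 + s * (real_vec k \<bullet> axis i 1)))"
        unfolding cis_conv_exp by (intro continuous_intros)
    qed simp
    also have "cis (0 + 2 * pi * (real_vec k \<bullet> axis i 1)) = 1"
      using cis_multiple_2pi[of "of_int (k $ i)"] by (simp add: real_vec_def inner_axis)
    finally have "(\<integral>s. ?f (axis i 1) s \<partial>lborel) = 0" by simp
    then have "\<exists>b\<in>Basis. (\<integral>s. ?f b s \<partial>lborel) = 0"
      by (intro bexI[of _ "axis i 1"]) auto
    then show ?thesis
      using False by (simp only: eq prod_zero_iff finite_Basis if_False)
  qed
qed

inductive trig_poly :: "(real^'m::finite \<Rightarrow> complex) \<Rightarrow> bool" where
  character: "trig_poly (\<lambda>t. c * cis (t \<bullet> real_vec k))"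
| add: "trig_poly p \<Longrightarrow> trig_poly q \<Longrightarrow> trig_poly (\<lambda>t. p t + q t)"

lemma trig_poly_const: "trig_poly (\<lambda>_. c)"
  using trig_poly.character[of c 0] by (simp add: real_vec_def flip: zero_vec_def)

lemma trig_poly_sum: "(\<And>i. i \<in> I \<Longrightarrow> trig_poly (p i)) \<Longrightarrow> trig_poly (\<lambda>t. \<Sum>i\<in>I. p i t)"
  by (induction I rule: infinite_finite_induct) (auto intro: trig_poly_const trig_poly.add)

lemma trig_poly_mult:
  assumes "trig_poly p" "trig_poly q"
  shows "trig_poly (\<lambda>t. p t * q t)"
  using assms(1)
proof induction
  case (character c k)
  show ?case
    using assms(2)
  proof induction
    case (character d l)
    have "(\<lambda>t. c * cis (t \<bullet> real_vec k) * (d * cis (t \<bullet> real_vec l))) = (\<lambda>t. c * d * cis (t \<bullet> real_vec (k + l)))"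
      by (simp add: inner_real_vec_add fun_eq_iff cis_mult[symmetric])
    then show ?case by (simp only: trig_poly.character)
  next
    case (add p q)
    then show ?case by (simp add: distrib_left trig_poly.add)
  qed
next
  case (add p q)
  then show ?case by (simp add: distrib_right trig_poly.add)
qed

lemma trig_poly_cmult: "trig_poly p \<Longrightarrow> trig_poly (\<lambda>t. c * p t)"
  by (rule trig_poly_mult[OF trig_poly_const])

definition torus_point :: "real^'m::finite \<Rightarrow> complex^'m" where
  "torus_point t = (\<chi> i. cis (t $ i))"

lemma continuous_torus_point: "continuous_on S torus_point"
  unfolding torus_point_def cis_conv_exp by (intro continuous_intros)

lemma trig_poly_cos_sin:
  fixes i :: "'a::finite"
  shows "trig_poly (\<lambda>t. of_real (cos (t $ i)))" "trig_poly (\<lambda>t. of_real (sin (t $ i)))"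
proof -
  have "t \<bullet> real_vec (axis i n) = real_of_int n * t $ i" for t :: "real^'a" and n
  proof -
    have "real_vec (axis i n) = real_of_int n *\<^sub>R axis i 1"
      by (auto simp: real_vec_def vec_eq_iff axis_def)
    then show ?thesis by (simp add: inner_axis)
  qed
  then have exp: "trig_poly (\<lambda>t :: real^'a. cis (t $ i))" "trig_poly (\<lambda>t :: real^'a. cis (- t $ i))"
    using trig_poly.character[of 1 "axis i 1"] trig_poly.character[of 1 "axis i (- 1)"] by simp_all
  have "trig_poly (\<lambda>t. 1 / 2 * cis (t $ i) + 1 / 2 * cis (- t $ i))"
    "trig_poly (\<lambda>t. 1 / (2 * \<i>) * cis (t $ i) + (- 1 / (2 * \<i>)) * cis (- t $ i))"
    by (intro trig_poly.add trig_poly_cmult exp)+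
  moreover have "1 / 2 * cis s + 1 / 2 * cis (- s) = of_real (cos s)"
    "1 / (2 * \<i>) * cis s + (- 1 / (2 * \<i>)) * cis (- s) = of_real (sin s)" for s
    by (auto simp: complex_eq_iff)
  ultimately show "trig_poly (\<lambda>t. of_real (cos (t $ i)))" "trig_poly (\<lambda>t. of_real (sin (t $ i)))"
    by (simp_all only:)
qed

text \<open>The coordinates of \<^const>\<open>torus_point\<close> are cosines and sines, hence trigonometric polynomials,
  and these form an algebra.\<close>

lemma trig_poly_real_polynomial:
  assumes "real_polynomial_function p"
  shows "trig_poly (\<lambda>t. complex_of_real (p (torus_point t)))"
  using assms
proof induction
  case (linear p)
  interpret bounded_linear p by fact
  have expand: "p w = (\<Sum>b\<in>Basis. p b * (w \<bullet> b))" for w :: "complex^'a"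
    using arg_cong[OF euclidean_representation[of w], of p] by (simp add: sum scaleR mult.commute)
  have eq: "(\<lambda>t. complex_of_real (p (torus_point t))) = (\<lambda>t. \<Sum>b\<in>Basis. of_real (p b) * of_real (torus_point t \<bullet> b))"
    by (rule ext, subst expand) (simp only: of_real_sum of_real_mult)
  show ?case
    unfolding eq
  proof (intro trig_poly_sum trig_poly_cmult)
    fix b :: "complex^'a" assume "b \<in> Basis"
    then consider i where "b = axis i 1" | i where "b = axis i \<i>"
      by (auto simp: Basis_vec_def Basis_complex_def)
    then show "trig_poly (\<lambda>t. complex_of_real (torus_point t \<bullet> b))"
      by cases (simp_all add: torus_point_def inner_axis trig_poly_cos_sin)
  qed
qed (auto intro: trig_poly_const trig_poly.add trig_poly_mult)

lemma trig_poly_polynomial_function: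
  fixes p :: "complex^'m::finite \<Rightarrow> complex"
  assumes "polynomial_function p"
  shows "trig_poly (\<lambda>t. p (torus_point t))"
proof -
  have "real_polynomial_function (Re \<circ> p)" "real_polynomial_function (Im \<circ> p)"
    using assms bounded_linear_Re bounded_linear_Im unfolding polynomial_function_def by blast+
  from this[THEN trig_poly_real_polynomial]
  have "trig_poly (\<lambda>t. of_real (Re (p (torus_point t))) + \<i> * of_real (Im (p (torus_point t))))"
    by (intro trig_poly.add trig_poly_cmult) (simp_all add: o_def)
  then show ?thesis
    by (simp only: complex_eq[symmetric])
qed

lemma periodic_lattice:
  fixes h :: "real^'m::finite \<Rightarrow> complex"
  assumes per: "\<And>t i. h (t + (2 * pi) *\<^sub>R axis i 1) = h t"
  shows "h (t + (2 * pi) *\<^sub>R real_vec k) = h t"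
proof -
  have nat: "h (t + (real n * (2 * pi)) *\<^sub>R axis i 1) = h t" for t i n
  proof (induction n arbitrary: t)
    case (Suc n)
    have "t + (real (Suc n) * (2 * pi)) *\<^sub>R axis i 1 = (t + (real n * (2 * pi)) *\<^sub>R axis i 1) + (2 * pi) *\<^sub>R axis i 1"
      by (simp add: algebra_simps scaleR_add_left)
    then show ?case by (simp only: per Suc.IH)
  qed simp
  have int: "h (t + (of_int j * (2 * pi)) *\<^sub>R axis i 1) = h t" for t i j
  proof (cases j rule: int_cases2)
    case (nonneg n)
    then show ?thesis using nat[of t n i] by simp
  next
    case (nonpos n)
    then show ?thesis
      using nat[of "t + (of_int j * (2 * pi)) *\<^sub>R axis i 1" n i] by (simp flip: scaleR_add_left)
  qed
  have "h (t + (\<Sum>i\<in>I. (of_int (k $ i) * (2 * pi)) *\<^sub>R axis i 1)) = h t" for I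
  proof (induction I rule: infinite_finite_induct)
    case (insert i I)
    then show ?case
      using int[of "t + (\<Sum>i\<in>I. (of_int (k $ i) * (2 * pi)) *\<^sub>R axis i 1)" "k $ i" i] by (simp add: add_ac)
  qed auto
  moreover have "(\<Sum>i\<in>UNIV. (of_int (k $ i) * (2 * pi)) *\<^sub>R axis i 1) = (2 * pi) *\<^sub>R real_vec k"
    by (simp add: vec_eq_iff real_vec_def axis_def if_distrib cong: if_cong)
  ultimately show ?thesis by metis
qed

text \<open>A function whose Fourier coefficients vanish is orthogonal to all trigonometric polynomials.
  By Stone-Weierstrass these approximate its own conjugate uniformly, so the integral of
  \<open>\<bar>h\<bar>\<^sup>2\<close> vanishes.\<close>

lemma torus_uniqueness:
  fixes h :: "real^'m::finite \<Rightarrow> complex"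
  assumes cont: "continuous_on UNIV h"
    and per: "\<And>t i. h (t + (2 * pi) *\<^sub>R axis i 1) = h t"
    and coeff: "\<And>k. (\<integral>t. indicator period_box t *\<^sub>R (h t * cis (t \<bullet> real_vec k)) \<partial>lborel) = 0"
  shows "h t = 0"
proof -
  let ?B = "period_box :: (real^'m) set"
  have compact: "compact ?B"
    by (simp add: period_box_def)
  have int: "integrable lborel (\<lambda>t. indicator ?B t *\<^sub>R g t)" if "continuous_on UNIV g" for g :: "real^'m \<Rightarrow> complex"
    using borel_integrable_compact[OF compact continuous_on_subset[OF that]]
    by (simp add: indicator_scaleR_eq_if)
  have same_point: "h s = h t" if "torus_point s = torus_point t" for s t
  proof -
    have "\<exists>n::int. s $ i = t $ i + 2 * pi * n" for i
      using that by (intro sin_cos_eq_iff[THEN iffD1]) (simp add: torus_point_def vec_eq_iff complex_eq_iff)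
    then obtain k where "\<And>i. s $ i = t $ i + 2 * pi * of_int (k i)"
      by metis
    then have "s = t + (2 * pi) *\<^sub>R real_vec (\<chi> i. k i)"
      by (simp add: vec_eq_iff real_vec_def)
    then show ?thesis
      using periodic_lattice[OF per] by simp
  qed
  \<comment> \<open>By periodicity the conjugate of \<open>h\<close> factors through the torus; the factor is continuous since its graph is the image of a compact cell.\<close>
  define \<Phi> where "\<Phi> = (\<lambda>w. cnj (h (SOME t. torus_point t = w)))"
  have \<Phi>: "\<Phi> (torus_point t) = cnj (h t)" for t
    unfolding \<Phi>_def using same_point[OF someI[of "\<lambda>s. torus_point s = torus_point t" t]] by simp
  have cont_cnj: "continuous_on S (\<lambda>t. cnj (h t))" for S
    by (intro continuous_intros continuous_on_subset[OF cont]) auto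
  have "continuous_on (torus_point ` ?B) \<Phi>"
  proof (rule continuous_from_closed_graph)
    show "compact ((\<lambda>t. cnj (h t)) ` ?B)"
      by (intro compact_continuous_image cont_cnj compact)
    show "\<Phi> \<in> torus_point ` ?B \<rightarrow> (\<lambda>t. cnj (h t)) ` ?B"
      by (auto simp: \<Phi>)
    have "(\<lambda>w. (w, \<Phi> w)) ` torus_point ` ?B = (\<lambda>t. (torus_point t, cnj (h t))) ` ?B"
      by (auto simp: \<Phi> image_image)
    moreover have "compact ((\<lambda>t. (torus_point t, cnj (h t))) ` ?B)"
      by (intro compact_continuous_image continuous_intros continuous_torus_point cont_cnj compact)
    ultimately show "closed ((\<lambda>w. (w, \<Phi> w)) ` torus_point ` ?B)"
      by (simp add: compact_imp_closed)
  qed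
  note approx = Stone_Weierstrass_polynomial_function[OF compact_continuous_image[OF continuous_torus_point compact] this]
  have ortho: "continuous_on UNIV q \<and> (\<integral>t. indicator ?B t *\<^sub>R (h t * q t) \<partial>lborel) = 0" if "trig_poly q" for q
    using that
  proof induction
    case (character c k)
    have "(\<lambda>t. indicator ?B t *\<^sub>R (h t * (c * cis (t \<bullet> real_vec k)))) = (\<lambda>t. c * (indicator ?B t *\<^sub>R (h t * cis (t \<bullet> real_vec k))))"
      by (auto simp: fun_eq_iff scaleR_conv_of_real)
    moreover have "continuous_on UNIV (\<lambda>t. c * cis (t \<bullet> real_vec k))"
      unfolding cis_conv_exp by (intro continuous_intros)
    ultimately show ?case
      by (simp only: integral_mult_right_zero coeff) simp
  next
    case (add p q)
    have "integrable lborel (\<lambda>t. indicator ?B t *\<^sub>R (h t * p t))" "integrable lborel (\<lambda>t. indicator ?B t *\<^sub>R (h t * q t))"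
      using add by (auto intro!: int continuous_intros cont)
    with add show ?case
      by (simp add: distrib_left scaleR_add_right continuous_on_add)
  qed
  define I where "I = (\<integral>t. indicator ?B t *\<^sub>R (h t * cnj (h t)) \<partial>lborel)"
  define J where "J = (\<integral>t. cmod (indicator ?B t *\<^sub>R h t) \<partial>lborel)"
  have small: "cmod I \<le> e * J" if e: "0 < e" for e
  proof -
    obtain g where g: "polynomial_function g" "\<And>w. w \<in> torus_point ` ?B \<Longrightarrow> cmod (\<Phi> w - g w) < e"
      using approx[OF e] by blast
    define q where "q = (\<lambda>t. g (torus_point t))"
    have q: "continuous_on UNIV q" "(\<integral>t. indicator ?B t *\<^sub>R (h t * q t) \<partial>lborel) = 0"
      using ortho[OF trig_poly_polynomial_function[OF g(1)]] by (auto simp: q_def)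
    have ints: "integrable lborel (\<lambda>t. indicator ?B t *\<^sub>R (h t * cnj (h t)))" "integrable lborel (\<lambda>t. indicator ?B t *\<^sub>R (h t * q t))"
      by (intro int continuous_intros cont cont_cnj q)+
    have "I = (\<integral>t. indicator ?B t *\<^sub>R (h t * cnj (h t)) - indicator ?B t *\<^sub>R (h t * q t) \<partial>lborel)"
      unfolding I_def by (subst Bochner_Integration.integral_diff[OF ints]) (simp only: q diff_zero)
    also have "cmod \<dots> \<le> (\<integral>t. e * cmod (indicator ?B t *\<^sub>R h t) \<partial>lborel)"
    proof (rule order_trans[OF integral_norm_bound integral_mono])
      show "integrable lborel (\<lambda>t. e * cmod (indicator ?B t *\<^sub>R h t))"
        by (intro integrable_mult_right integrable_norm int cont)
      show "cmod (indicator ?B t *\<^sub>R (h t * cnj (h t)) - indicator ?B t *\<^sub>R (h t * q t)) \<le> e * cmod (indicator ?B t *\<^sub>R h t)" for t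
      proof (cases "t \<in> ?B")
        case True
        then have "cmod (h t) * cmod (cnj (h t) - q t) \<le> cmod (h t) * e"
          using g(2)[of "torus_point t"] by (intro mult_left_mono) (auto simp: \<Phi> q_def)
        then show ?thesis
          using True by (simp add: norm_mult mult.commute flip: right_diff_distrib)
      qed simp
    qed (intro integrable_norm Bochner_Integration.integrable_diff ints)
    finally show ?thesis
      by (simp add: J_def)
  qed
  have "cmod I \<le> 0"
  proof (rule field_le_epsilon)
    fix e :: real assume e: "0 < e"
    have J: "0 \<le> J" unfolding J_def by (simp add: integral_nonneg_AE)
    have "cmod I \<le> e / (J + 1) * J"
      using e J by (intro small) auto
    also have "\<dots> \<le> 0 + e"
      using e J by (simp add: field_simps)
    finally show "cmod I \<le> 0 + e" .
  qed
  moreover have "I = of_real (integral (cbox 0 (\<chi> i. 2 * pi)) (\<lambda>t. (cmod (h t))\<^sup>2))"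
  proof -
    have cont': "continuous_on S (\<lambda>t. (cmod (h t))\<^sup>2)" for S
      by (intro continuous_intros continuous_on_subset[OF cont]) auto
    have "I = of_real (\<integral>t. indicator ?B t *\<^sub>R (cmod (h t))\<^sup>2 \<partial>lborel)"
      unfolding I_def integral_complex_of_real[symmetric]
      by (intro Bochner_Integration.integral_cong) (auto simp: scaleR_conv_of_real complex_norm_square[symmetric])
    also have "(\<integral>t. indicator ?B t *\<^sub>R (cmod (h t))\<^sup>2 \<partial>lborel) = integral ?B (\<lambda>t. (cmod (h t))\<^sup>2)"
      using set_borel_integral_eq_integral(2)[of ?B "\<lambda>t. (cmod (h t))\<^sup>2"] borel_integrable_compact[OF compact cont']
      by (simp add: set_lebesgue_integral_def set_integrable_def indicator_scaleR_eq_if)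
    finally show ?thesis
      by (simp add: period_box_def)
  qed
  ultimately have int0: "integral (cbox 0 (\<chi> i. 2 * pi)) (\<lambda>t. (cmod (h t))\<^sup>2) = 0"
    by simp
  have "(\<chi> i. pi) \<in> box 0 ((\<chi> i. 2 * pi) :: real^'m)"
    by (simp add: mem_box_cart)
  then have "box 0 ((\<chi> i. 2 * pi) :: real^'m) \<noteq> {}"
    by blast
  moreover have "continuous_on (cbox 0 (\<chi> i. 2 * pi)) (\<lambda>t. (cmod (h t))\<^sup>2)"
    by (intro continuous_intros continuous_on_subset[OF cont]) auto
  ultimately have zero: "h t = 0" if "t \<in> ?B" for t
    using that int0 integral_cbox_eq_0_iff[of 0 "\<chi> i. 2 * pi" "\<lambda>t. (cmod (h t))\<^sup>2"]
    by (simp add: period_box_def)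
  \<comment> \<open>An arbitrary point is moved into the cell by a lattice translation.\<close>
  define k :: "int^'m" where "k = (\<chi> i. - \<lfloor>t $ i / (2 * pi)\<rfloor>)"
  have "t + (2 * pi) *\<^sub>R real_vec k \<in> ?B"
  proof -
    have "0 \<le> t $ i - 2 * pi * of_int \<lfloor>t $ i / (2 * pi)\<rfloor> \<and> t $ i - 2 * pi * of_int \<lfloor>t $ i / (2 * pi)\<rfloor> \<le> 2 * pi" for i
    proof -
      have "of_int \<lfloor>t $ i / (2 * pi)\<rfloor> * (2 * pi) \<le> t $ i"
        by (subst pos_le_divide_eq[symmetric]) auto
      moreover have "t $ i / (2 * pi) \<le> of_int \<lfloor>t $ i / (2 * pi)\<rfloor> + 1"
        by linarith
      then have "t $ i \<le> (of_int \<lfloor>t $ i / (2 * pi)\<rfloor> + 1) * (2 * pi)"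
        by (subst (asm) pos_divide_le_eq) auto
      ultimately show ?thesis
        by (auto simp only: mult.commute[of _ "2 * pi"] distrib_left)
    qed
    then show ?thesis
      by (simp add: period_box_iff real_vec_def k_def)
  qed
  from zero[OF this] show ?thesis
    using periodic_lattice[OF per] by simp
qed

section \<open>Inversion of the mixed transform\<close>

text \<open>For fixed \<open>x\<close> both sides are continuous functions on the torus, so it suffices to compare Fourier
  coefficients. Those of \<open>f\<close> are \<open>a l x\<close> up to normalisation; as a function of \<open>x\<close> the
  coefficient is continuous and integrable with Euclidean Fourier transform a multiple of
  \<open>mixed_fourier f l\<close>, so Euclidean inversion identifies it with \<open>b l x\<close>. Those of the other side are
  the coefficients \<open>b l x\<close> of an absolutely convergent Fourier series, by orthogonality of the
  characters.\<close>

lemma inverse_fourier_mixed_fourier: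
  fixes f :: "(real^'m::finite) \<times> (real^'n::finite) \<Rightarrow> complex"
  assumes cont: "continuous_on UNIV f" and per: "torus_periodic f"
    and f: "set_integrable lborel period_cell f" and F: "rapid dual_weight (mixed_fourier f)"
  shows "inverse_fourier (mixed_fourier f) u z = f z"
proof -
  obtain t x where z: "z = (t, x)" by force
  let ?B = "period_box :: (real^'m) set"
  let ?cm = "(2 * of_real pi) ^ CARD('m) :: complex" and ?cn = "(2 * of_real pi) ^ CARD('n) :: complex"
  define a where "a = (\<lambda>l y. \<integral>s. indicator ?B s *\<^sub>R (f (s, y) * cis (- (s \<bullet> real_vec l))) \<partial>lborel)"
  define b where "b = (\<lambda>l y. 1 / ?cn * (\<integral>\<xi>. mixed_fourier f l \<xi> * cis (\<xi> \<bullet> y) \<partial>lborel))"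
  have slice: "continuous_on S (\<lambda>s. f (s, y) * cis (- (s \<bullet> real_vec l)))" for S y l
    unfolding cis_conv_exp by (intro continuous_intros continuous_on_compose2[OF cont]) auto
  have int_slice: "integrable lborel (\<lambda>s. indicator ?B s *\<^sub>R g s)" if "continuous_on UNIV g" for g :: "real^'m \<Rightarrow> complex"
    using borel_integrable_compact[of ?B, OF _ continuous_on_subset[OF that]]
    by (simp add: indicator_scaleR_eq_if period_box_def)
  have a_b: "a l y = ?cm * b l y" for l y
  proof -
    have int: "integrable (lborel \<Otimes>\<^sub>M lborel) (\<lambda>(s, y). (indicator period_cell (s, y) *\<^sub>R f (s, y)) * cis (- (s \<bullet> real_vec l) - y \<bullet> \<xi>))" for \<xi>
    proof -
      have "integrable lborel (\<lambda>z. (indicator period_cell z *\<^sub>R f z) * cis (- (z \<bullet> (real_vec l, \<xi>))))"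
        using f unfolding set_integrable_def by (rule integrable_mult_cis) simp
      then show ?thesis
        by (simp add: lborel_prod case_prod_unfold inner_prod_def)
    qed
    have fubini: "(\<integral>s. (indicator period_cell (s, y) *\<^sub>R f (s, y)) * cis (- (s \<bullet> real_vec l) - y \<bullet> \<xi>) \<partial>lborel)
        = a l y * cis (- (y \<bullet> \<xi>))" for y :: "real^'n" and \<xi>
    proof -
      have "(indicator period_cell (s, y) *\<^sub>R f (s, y)) * cis (- (s \<bullet> real_vec l) - y \<bullet> \<xi>)
          = (indicator ?B s *\<^sub>R (f (s, y) * cis (- (s \<bullet> real_vec l)))) * cis (- (y \<bullet> \<xi>))" for s
        by (simp add: indicator_def cis_mult)
      then show ?thesis
        by (simp only: integral_mult_left_zero a_def)
    qed
    have int_a: "integrable lborel (a l)"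
      using lborel_pair.integrable_snd[OF int[of 0]] unfolding fubini by simp
    have cont_a: "continuous_on UNIV (a l)"
    proof -
      have "a l y = integral (cbox 0 (\<chi> i. 2 * pi)) (\<lambda>s. f (s, y) * cis (- (s \<bullet> real_vec l)))" for y
        using set_borel_integral_eq_integral(2)[of ?B "\<lambda>s. f (s, y) * cis (- (s \<bullet> real_vec l))"]
          int_slice[OF slice]
        by (simp add: a_def set_lebesgue_integral_def set_integrable_def period_box_def)
      moreover have "continuous_on UNIV (\<lambda>y. integral (cbox 0 (\<chi> i. 2 * pi)) (\<lambda>s. f (s, y) * cis (- (s \<bullet> real_vec l))))"
        unfolding cis_conv_exp
        by (rule integral_continuous_on_param)
          (auto simp: case_prod_unfold intro!: continuous_intros continuous_on_compose2[OF cont])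
      ultimately show ?thesis by (simp cong: continuous_on_cong)
    qed
    have transform: "?cm * mixed_fourier f l \<xi> = (\<integral>y. a l y * cis (- (y \<bullet> \<xi>)) \<partial>lborel)" for \<xi>
    proof -
      have "?cm * mixed_fourier f l \<xi> = (\<integral>z. (indicator period_cell z *\<^sub>R f z) * cis (- (z \<bullet> (real_vec l, \<xi>))) \<partial>lborel)"
        unfolding mixed_fourier_eq[OF f] by simp
      also have "\<dots> = (\<integral>z. (case z of (s, y) \<Rightarrow> (indicator period_cell (s, y) *\<^sub>R f (s, y)) * cis (- (s \<bullet> real_vec l) - y \<bullet> \<xi>)) \<partial>(lborel \<Otimes>\<^sub>M lborel))"
        by (simp add: lborel_prod case_prod_unfold inner_prod_def)
      also have "\<dots> = (\<integral>y. a l y * cis (- (y \<bullet> \<xi>)) \<partial>lborel)"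
        unfolding lborel_pair.integral_snd[OF int, symmetric] fubini ..
      finally show ?thesis .
    qed
    have "a l y = 1 / ?cn * (\<integral>\<xi>. ?cm * mixed_fourier f l \<xi> * cis (\<xi> \<bullet> y) \<partial>lborel)"
      using fourier_inversion[OF int_a cont_a transform] rapid_integrable[OF F, of l] by simp
    also have "\<dots> = ?cm * b l y"
      unfolding mult.assoc integral_mult_right_zero b_def by (rule mult.left_commute)
    finally show ?thesis .
  qed
  have int_freq: "integrable (count_space UNIV \<Otimes>\<^sub>M lborel)
      (\<lambda>w. (case w of (k, \<xi>) \<Rightarrow> 1 / ?cn * mixed_fourier f k \<xi>) * cis (frequency w \<bullet> (s, x)))" for s
  proof -
    have "(\<lambda>w. frequency w \<bullet> (s, x)) \<in> borel_measurable dual_measure"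
      using measurable_frequency by measurable
    then show ?thesis
      unfolding dual_measure_def[symmetric] by (intro integrable_mult_cis rapid_integrable_dual F)
  qed
  have inner: "(\<integral>\<xi>. (case (k, \<xi>) of (k, \<xi>) \<Rightarrow> 1 / ?cn * mixed_fourier f k \<xi>) * cis (frequency (k, \<xi>) \<bullet> (s, x)) \<partial>lborel)
      = b k x * cis (s \<bullet> real_vec k)" for k s
  proof -
    have "(case (k, \<xi>) of (k, \<xi>) \<Rightarrow> 1 / ?cn * mixed_fourier f k \<xi>) * cis (frequency (k, \<xi>) \<bullet> (s, x))
        = 1 / ?cn * (mixed_fourier f k \<xi> * cis (\<xi> \<bullet> x)) * cis (s \<bullet> real_vec k)" for \<xi>
      by (simp add: frequency_def cis_mult inner_commute add.commute)
    then show ?thesis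
      by (simp only: integral_mult_left_zero integral_mult_right_zero b_def)
  qed
  have int_b: "integrable (count_space UNIV) (\<lambda>k. b k x)"
    using dual.integrable_fst'[OF int_freq[of 0]] unfolding inner by simp
  have series: "inverse_fourier (mixed_fourier f) u (s, x) = (\<integral>k. b k x * cis (s \<bullet> real_vec k) \<partial>count_space UNIV)" for s
    unfolding inverse_fourier_def osc_def dual_measure_def dual.integral_fst'[OF int_freq, symmetric] inner ..
  have coeff_series: "(\<integral>s. indicator ?B s *\<^sub>R (inverse_fourier (mixed_fourier f) u (s, x) * cis (- (s \<bullet> real_vec l))) \<partial>lborel)
      = ?cm * b l x" for l
  proof -
    let ?H = "\<lambda>k s. b k x * (indicator ?B s *\<^sub>R cis (s \<bullet> real_vec (k - l)))"
    have "integrable lborel (indicator ?B :: real^'m \<Rightarrow> real)"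
      by (auto simp: period_box_def intro!: integrable_real_indicator emeasure_lborel_cbox_finite)
    then have dom: "integrable (count_space UNIV \<Otimes>\<^sub>M lborel) (\<lambda>(k, s). cmod (b k x) * indicator ?B s)"
      by (intro dual.integrable_pair_mult integrable_norm int_b)
    have meas: "(\<lambda>(k, s). ?H k s) \<in> borel_measurable (count_space UNIV \<Otimes>\<^sub>M lborel)"
      unfolding dual_measure_def[symmetric] by (rule measurable_dual) measurable
    have int: "integrable (count_space UNIV \<Otimes>\<^sub>M lborel) (\<lambda>(k, s). ?H k s)"
      by (rule Bochner_Integration.integrable_bound[OF dom meas]) (auto simp: norm_mult)
    have "(\<integral>s. indicator ?B s *\<^sub>R (inverse_fourier (mixed_fourier f) u (s, x) * cis (- (s \<bullet> real_vec l))) \<partial>lborel)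
        = (\<integral>s. (\<integral>k. ?H k s \<partial>count_space UNIV) \<partial>lborel)"
    proof (rule Bochner_Integration.integral_cong[OF refl])
      fix s
      have "?H k s = (b k x * cis (s \<bullet> real_vec k)) * (indicator ?B s *\<^sub>R cis (- (s \<bullet> real_vec l)))" for k
        by (simp add: real_vec_minus inner_diff_right scaleR_conv_of_real cis_mult)
      then have "(\<integral>k. ?H k s \<partial>count_space UNIV)
          = inverse_fourier (mixed_fourier f) u (s, x) * (indicator ?B s *\<^sub>R cis (- (s \<bullet> real_vec l)))"
        by (simp only: integral_mult_left_zero series)
      then show "indicator ?B s *\<^sub>R (inverse_fourier (mixed_fourier f) u (s, x) * cis (- (s \<bullet> real_vec l)))
          = (\<integral>k. ?H k s \<partial>count_space UNIV)"
        by (simp only: mult_scaleR_right)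
    qed
    also have "\<dots> = (\<integral>k. (\<integral>s. ?H k s \<partial>lborel) \<partial>count_space UNIV)"
      by (rule dual.Fubini_integral[OF int])
    also have "\<dots> = (\<integral>k. indicator {l} k *\<^sub>R (?cm * b l x) \<partial>count_space UNIV)"
    proof (rule Bochner_Integration.integral_cong[OF refl])
      fix k
      show "(\<integral>s. ?H k s \<partial>lborel) = indicator {l} k *\<^sub>R (?cm * b l x)"
        unfolding integral_mult_right_zero integral_torus_character by (auto simp: indicator_def)
    qed
    also have "\<dots> = ?cm * b l x"
      by simp
    finally show ?thesis .
  qed
  define h where "h = (\<lambda>s. f (s, x) - inverse_fourier (mixed_fourier f) u (s, x))"
  have cont_inv: "continuous_on UNIV (inverse_fourier (mixed_fourier f) u)"
    using inverse.transform_continuous F by blast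
  have "h t = 0"
  proof (rule torus_uniqueness)
    show "continuous_on UNIV h"
      unfolding h_def by (intro continuous_intros continuous_on_compose2[OF cont] continuous_on_compose2[OF cont_inv]) auto
    show "h (s + (2 * pi) *\<^sub>R axis i 1) = h s" for s i
    proof -
      have "cis ((s + (2 * pi) *\<^sub>R axis i 1) \<bullet> real_vec k) = cis (s \<bullet> real_vec k)" for k
        using cis_multiple_2pi[of "of_int (k $ i)"]
        by (simp add: inner_add_left inner_axis' real_vec_def flip: cis_mult)
      then show ?thesis
        using per[unfolded torus_periodic_def] by (simp only: h_def series)
    qed
    show "(\<integral>s. indicator ?B s *\<^sub>R (h s * cis (s \<bullet> real_vec k)) \<partial>lborel) = 0" for k
    proof -
      define l where "l = - k"
      have cis: "cis (s \<bullet> real_vec k) = cis (- (s \<bullet> real_vec l))" for s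
        using real_vec_minus[of 0 l] by (simp add: l_def real_vec_def flip: zero_vec_def)
      have split: "(\<lambda>s. indicator ?B s *\<^sub>R (h s * cis (s \<bullet> real_vec k))) = (\<lambda>s. indicator ?B s *\<^sub>R (f (s, x) * cis (- (s \<bullet> real_vec l)))
          - indicator ?B s *\<^sub>R (inverse_fourier (mixed_fourier f) u (s, x) * cis (- (s \<bullet> real_vec l))))"
        by (simp add: fun_eq_iff h_def cis left_diff_distrib scaleR_diff_right)
      have "continuous_on UNIV (\<lambda>s. inverse_fourier (mixed_fourier f) u (s, x) * cis (- (s \<bullet> real_vec l)))"
        unfolding cis_conv_exp by (intro continuous_intros continuous_on_compose2[OF cont_inv]) auto
      then show ?thesis
        unfolding split
        by (subst Bochner_Integration.integral_diff[OF int_slice[OF slice] int_slice])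
          (simp_all only: coeff_series a_b[unfolded a_def] diff_self)
    qed
  qed
  then show ?thesis
    by (simp add: h_def z)
qed

section \<open>Rapid decrease in terms of multi-indices\<close>

lemma multi_deriv_0: "multi_deriv e (\<lambda>_. 0) f = f"
proof -
  have "foldr (\<lambda>i. partial_deriv (e i) ^^ 0) is f = f" for "is"
    by (induction "is") auto
  then show ?thesis by (simp add: multi_deriv_def)
qed

lemma smooth_has_vector_derivative:
  "smooth f \<Longrightarrow> b \<in> Basis \<Longrightarrow> ((\<lambda>s. f (x + s *\<^sub>R b)) has_vector_derivative partial_deriv b f x) (at 0)"
  using has_vector_derivative_along_line[of f b x 0 UNIV, OF smooth_imp_differentiable] by simp

lemma Basis_TR_cases:
  assumes "b \<in> (Basis :: ((real^'m::finite) \<times> (real^'n::finite)) set)"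
  obtains i where "b = (axis i 1, 0)" | j where "b = (0, axis j 1)"
  using assms by (auto simp: Basis_prod_def Basis_vec_def)

text \<open>The Schwartz seminorms speak about derivatives taken in a fixed order and about monomials. The
  derivatives \<open>\<partial>\<^sub>t\<^sup>\<alpha> \<partial>\<^sub>x\<^sup>\<beta> f\<close> form a class closed under differentiation because partial derivatives
  commute, and monomials are interchangeable with powers of the weight.\<close>

lemma schwartz_TR_iff_rapid_TR:
  fixes f :: "(real^'m::finite) \<times> (real^'n::finite) \<Rightarrow> complex"
  assumes f: "f \<in> smooth_TR"
  shows "f \<in> schwartz_TR \<longleftrightarrow> f \<in> rapid_TR"
proof -
  have et: "(axis i 1, 0) \<in> (Basis :: ((real^'m) \<times> (real^'n)) set)"
    and ex: "(0, axis j 1) \<in> (Basis :: ((real^'m) \<times> (real^'n)) set)" for i j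
    by (auto simp: Basis_prod_def)
  let ?D = "\<lambda>\<alpha> \<beta>. deriv_t \<alpha> (deriv_x \<beta> f)"
  have smooth_f: "smooth f" using f by (simp add: smooth_TR_def)
  have smooth_x: "smooth (deriv_x \<beta> f)" for \<beta>
    by (intro smooth_multi_deriv smooth_f ex)
  have smooth_D: "smooth (?D \<alpha> \<beta>)" for \<alpha> \<beta>
    by (intro smooth_multi_deriv smooth_x et)
  have "f \<in> rapid_TR" if schwartz: "f \<in> schwartz_TR"
  proof -
    have bound_ex: "\<exists>C. \<forall>t x. \<bar>monomial x \<gamma>\<bar> * cmod (?D \<alpha> \<beta> (t, x)) \<le> C" for \<alpha> \<beta> \<gamma>
    proof -
      have "bdd_above (range (\<lambda>(t, x). cmod (of_real (monomial x \<gamma>) * ?D \<alpha> \<beta> (t, x))))"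
        by (rule schwartz[unfolded schwartz_TR_def, THEN CollectD, THEN conjunct2, rule_format])
      then obtain C where "(case z of (t, x) \<Rightarrow> cmod (of_real (monomial x \<gamma>) * ?D \<alpha> \<beta> (t, x))) \<le> C" for z
        unfolding bdd_above_def by blast
      from this[of "(t, x)" for t x] show ?thesis
        by (auto simp: norm_mult)
    qed
    define C where "C = (\<lambda>\<alpha> \<beta> \<gamma>. SOME C. \<forall>t x. \<bar>monomial x \<gamma>\<bar> * cmod (?D \<alpha> \<beta> (t, x)) \<le> C)"
    have C: "\<bar>monomial x \<gamma>\<bar> * cmod (?D \<alpha> \<beta> (t, x)) \<le> C \<alpha> \<beta> \<gamma>" for \<alpha> \<beta> \<gamma> t x
      using someI_ex[OF bound_ex[of \<gamma> \<alpha> \<beta>]] unfolding C_def by blast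
    have "rapid space_weight (\<lambda>_. f)"
    proof (rule rapid_coinduct_derivs)
      show "(\<lambda>_. f) \<in> {\<lambda>_. ?D \<alpha> \<beta> | \<alpha> \<beta>. True}"
        by (auto intro!: exI[of _ "\<lambda>_. 0"] simp: multi_deriv_0)
    next
      fix A :: "unit \<Rightarrow> _" and u assume "A \<in> {\<lambda>_. ?D \<alpha> \<beta> | \<alpha> \<beta>. True}"
      then show "continuous_on UNIV (A u)"
        using smooth_imp_continuous[OF smooth_D] by blast
    next
      fix A :: "unit \<Rightarrow> _" and b :: "(real^'m) \<times> (real^'n)"
      assume "A \<in> {\<lambda>_. ?D \<alpha> \<beta> | \<alpha> \<beta>. True}" and b: "b \<in> Basis"
      then obtain \<alpha> \<beta> where A: "A = (\<lambda>_. ?D \<alpha> \<beta>)" by blast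
      from b obtain \<alpha>' \<beta>' where "partial_deriv b (?D \<alpha> \<beta>) = ?D \<alpha>' \<beta>'"
      proof (cases b rule: Basis_TR_cases)
        case (1 i)
        then show thesis
          using that[of "\<alpha>(i := Suc (\<alpha> i))" \<beta>]
            partial_deriv_multi_deriv[OF smooth_x, of "\<lambda>i. (axis i 1, 0)" i \<alpha> \<beta>] et by simp
      next
        case (2 j)
        then show thesis
          using that[of \<alpha> "\<beta>(j := Suc (\<beta> j))"] b
            partial_deriv_multi_deriv[OF smooth_f, of "\<lambda>j. (0, axis j 1)" j \<beta>] ex
            partial_deriv_multi_deriv_commute[OF smooth_x, of "\<lambda>i. (axis i 1, 0)" b \<alpha> \<beta>] et by simp
      qed
      then show "\<exists>A'\<in>{\<lambda>_. ?D \<alpha> \<beta> | \<alpha> \<beta>. True}. \<forall>u z. ((\<lambda>s. A u (z + s *\<^sub>R b)) has_vector_derivative A' u z) (at 0)"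
        using smooth_has_vector_derivative[OF smooth_D b, of \<alpha> \<beta>]
        by (intro bexI[of _ "\<lambda>_. ?D \<alpha>' \<beta>'"]) (auto simp: A)
    next
      fix A :: "unit \<Rightarrow> _" and N :: nat assume "A \<in> {\<lambda>_. ?D \<alpha> \<beta> | \<alpha> \<beta>. True}"
      then obtain \<alpha> \<beta> where A: "A = (\<lambda>_. ?D \<alpha> \<beta>)" by blast
      let ?\<gamma> = "\<lambda>j i. if i = j then 2 * N else 0"
      have "space_weight u (t, x) ^ N * cmod (?D \<alpha> \<beta> (t, x))
          \<le> (1 + real CARD('n)) ^ N * (C \<alpha> \<beta> (\<lambda>_. 0) + (\<Sum>j\<in>UNIV. C \<alpha> \<beta> (?\<gamma> j)))" for u t x
      proof -
        have "space_weight u (t, x) ^ N * cmod (?D \<alpha> \<beta> (t, x))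
            \<le> (1 + real CARD('n)) ^ N * (1 + (\<Sum>j\<in>UNIV. \<bar>x $ j\<bar> ^ (2 * N))) * cmod (?D \<alpha> \<beta> (t, x))"
          using weight_power_le[of x N] by (intro mult_right_mono) (simp_all add: space_weight_def)
        also have "\<dots> = (1 + real CARD('n)) ^ N * (\<bar>monomial x (\<lambda>_. 0)\<bar> * cmod (?D \<alpha> \<beta> (t, x))
            + (\<Sum>j\<in>UNIV. \<bar>monomial x (?\<gamma> j)\<bar> * cmod (?D \<alpha> \<beta> (t, x))))"
          by (simp only: monomial_0 monomial_single power_abs abs_one mult_1 distrib_right sum_distrib_right mult.assoc)
        also have "\<dots> \<le> (1 + real CARD('n)) ^ N * (C \<alpha> \<beta> (\<lambda>_. 0) + (\<Sum>j\<in>UNIV. C \<alpha> \<beta> (?\<gamma> j)))"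
          by (intro mult_left_mono add_mono sum_mono C) auto
        finally show ?thesis .
      qed
      then show "\<exists>C. \<forall>u z. space_weight u z ^ N * cmod (A u z) \<le> C"
        unfolding A by auto
    qed
    then show "f \<in> rapid_TR"
      using f by (simp add: rapid_TR_def smooth_TR_def)
  qed
  moreover have "f \<in> schwartz_TR" if "f \<in> rapid_TR"
  proof -
    have f': "rapid space_weight (\<lambda>_. f)"
      using that by (simp add: rapid_TR_def)
    have "bdd_above (range (\<lambda>(t, x). cmod (of_real (monomial x \<gamma>) * ?D \<alpha> \<beta> (t, x))))" for \<alpha> \<beta> \<gamma>
    proof -
      have "rapid space_weight (\<lambda>_. ?D \<alpha> \<beta>)"
        by (intro rapid_multi_deriv f' et ex)
      from rapid_bound[OF this, of "\<Sum>j\<in>UNIV. \<gamma> j"]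
      obtain C where C: "space_weight u z ^ (\<Sum>j\<in>UNIV. \<gamma> j) * cmod (?D \<alpha> \<beta> z) \<le> C" for u z
        by blast
      have "cmod (of_real (monomial x \<gamma>) * ?D \<alpha> \<beta> (t, x)) \<le> C" for t x
      proof -
        have "cmod (of_real (monomial x \<gamma>) * ?D \<alpha> \<beta> (t, x)) = \<bar>monomial x \<gamma>\<bar> * cmod (?D \<alpha> \<beta> (t, x))"
          by (simp add: norm_mult)
        also have "\<dots> \<le> (1 + (norm x)\<^sup>2) ^ (\<Sum>j\<in>UNIV. \<gamma> j) * cmod (?D \<alpha> \<beta> (t, x))"
          by (intro mult_right_mono abs_monomial_le) simp
        also have "\<dots> \<le> C"
          using C[of _ "(t, x)"] by (simp add: space_weight_def)
        finally show ?thesis .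
      qed
      then show ?thesis
        by (intro bdd_aboveI[of _ C]) auto
    qed
    then show "f \<in> schwartz_TR"
      unfolding schwartz_TR_def by (intro CollectI conjI allI f)
  qed
  ultimately show ?thesis
    by blast
qed

lemma one_le_dual_weight: "1 \<le> dual_weight k \<xi>"
  by (simp add: dual_weight_def algebra_simps)

lemma dual_weight_powr:
  "(1 + (norm (real_vec k))\<^sup>2) powr r * (1 + (norm \<xi>)\<^sup>2) powr r = dual_weight k \<xi> powr r"
  by (simp add: dual_weight_def powr_mult)

text \<open>As \<open>N\<close> is arbitrary, the monomial only costs a further power of the weight; conversely the
  bounds with \<open>\<gamma> = 0\<close> are bounds for the powers of the weight.\<close>

lemma rapid_dual_iff:
  fixes F :: "int^'m::finite \<Rightarrow> real^'n::finite \<Rightarrow> complex"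
  shows "rapid dual_weight F \<longleftrightarrow> (\<forall>k. smooth (F k)) \<and>
    (\<forall>(\<beta> :: 'n \<Rightarrow> nat) (\<gamma> :: 'n \<Rightarrow> nat) (N :: real). N > 0 \<longrightarrow>
      (\<exists>C > 0. \<forall>k \<xi>. cmod (of_real (monomial \<xi> \<gamma>) * deriv_xi \<beta> (F k) \<xi>)
          \<le> C * (1 + (norm (real_vec k))\<^sup>2) powr (- N / 2) * (1 + (norm \<xi>)\<^sup>2) powr (- N / 2)))"
    (is "_ \<longleftrightarrow> _ \<and> ?bounds")
proof
  assume F: "rapid dual_weight F"
  have ?bounds
  proof (intro allI impI)
    fix \<beta> \<gamma> :: "'n \<Rightarrow> nat" and N :: real assume N: "N > 0"
    \<comment> \<open>\<open>G\<close> powers of the weight absorb the monomial, the other \<open>K\<close> give the decay.\<close>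
    define K where "K = nat \<lceil>N / 2\<rceil>"
    define G where "G = (\<Sum>j\<in>UNIV. \<gamma> j)"
    have "rapid dual_weight (\<lambda>k. deriv_xi \<beta> (F k))"
      by (intro rapid_multi_deriv F) simp
    from rapid_bound[OF this, of "G + K"]
    obtain C where C: "dual_weight k \<xi> ^ (G + K) * cmod (deriv_xi \<beta> (F k) \<xi>) \<le> C" for k \<xi>
      by blast
    have "cmod (of_real (monomial \<xi> \<gamma>) * deriv_xi \<beta> (F k) \<xi>)
        \<le> max C 1 * (1 + (norm (real_vec k))\<^sup>2) powr (- N / 2) * (1 + (norm \<xi>)\<^sup>2) powr (- N / 2)" for k \<xi>
    proof -
      let ?w = "dual_weight k \<xi>"
      have w: "1 \<le> ?w" by (rule one_le_dual_weight)
      have "(1 + (norm \<xi>)\<^sup>2) ^ G \<le> ?w ^ G"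
        by (intro power_mono) (simp_all add: dual_weight_def algebra_simps)
      then have "\<bar>monomial \<xi> \<gamma>\<bar> \<le> ?w ^ G"
        using abs_monomial_le[of \<xi> \<gamma>] by (simp add: G_def)
      then have "cmod (of_real (monomial \<xi> \<gamma>) * deriv_xi \<beta> (F k) \<xi>) * ?w ^ K \<le> ?w ^ G * cmod (deriv_xi \<beta> (F k) \<xi>) * ?w ^ K"
        using w unfolding norm_mult norm_of_real by (intro mult_right_mono) auto
      also have "\<dots> \<le> max C 1"
        using C[of k \<xi>] by (simp add: power_add mult_ac)
      finally have "cmod (of_real (monomial \<xi> \<gamma>) * deriv_xi \<beta> (F k) \<xi>) \<le> max C 1 / ?w ^ K"
        using w by (subst pos_le_divide_eq) auto
      also have "\<dots> = max C 1 * ?w powr (- real K)"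
        using w by (simp add: powr_minus powr_realpow divide_inverse)
      also have "\<dots> \<le> max C 1 * ?w powr (- N / 2)"
        using w N unfolding K_def by (intro mult_left_mono powr_mono) linarith+
      finally show ?thesis
        by (simp only: mult.assoc dual_weight_powr)
    qed
    then show "\<exists>C > 0. \<forall>k \<xi>. cmod (of_real (monomial \<xi> \<gamma>) * deriv_xi \<beta> (F k) \<xi>)
          \<le> C * (1 + (norm (real_vec k))\<^sup>2) powr (- N / 2) * (1 + (norm \<xi>)\<^sup>2) powr (- N / 2)"
      by (intro exI[of _ "max C 1"]) auto
  qed
  then show "(\<forall>k. smooth (F k)) \<and> ?bounds"
    using rapid_imp_smooth[OF F] by blast
next
  assume "(\<forall>k. smooth (F k)) \<and> ?bounds"
  then have smooth: "smooth (F k)" and bounds: ?bounds for k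
    by blast+
  have e: "axis j 1 \<in> (Basis :: (real^'n) set)" for j
    by simp
  have smooth_D: "smooth (deriv_xi \<beta> (F k))" for \<beta> k
    by (intro smooth_multi_deriv smooth e)
  show "rapid dual_weight F"
  proof (rule rapid_coinduct_derivs)
    show "F \<in> {\<lambda>k. deriv_xi \<beta> (F k) | \<beta>. True}"
      by (auto intro!: exI[of _ "\<lambda>_. 0"] simp: multi_deriv_0)
  next
    fix A k assume "A \<in> {\<lambda>k. deriv_xi \<beta> (F k) | \<beta>. True}"
    then show "continuous_on UNIV (A k)"
      using smooth_imp_continuous[OF smooth_D] by blast
  next
    fix A and b :: "real^'n" assume "A \<in> {\<lambda>k. deriv_xi \<beta> (F k) | \<beta>. True}" and b: "b \<in> Basis"
    then obtain \<beta> where A: "A = (\<lambda>k. deriv_xi \<beta> (F k))" by blast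
    obtain j where j: "b = axis j 1"
      using b by (auto simp: Basis_vec_def)
    have "partial_deriv b (deriv_xi \<beta> (F k)) = deriv_xi (\<beta>(j := Suc (\<beta> j))) (F k)" for k
      using partial_deriv_multi_deriv[OF smooth, of "\<lambda>j. axis j 1"] e by (simp add: j)
    then show "\<exists>A'\<in>{\<lambda>k. deriv_xi \<beta> (F k) | \<beta>. True}. \<forall>k \<xi>. ((\<lambda>s. A k (\<xi> + s *\<^sub>R b)) has_vector_derivative A' k \<xi>) (at 0)"
      using smooth_has_vector_derivative[OF smooth_D b, of \<beta>]
      by (intro bexI[of _ "\<lambda>k. deriv_xi (\<beta>(j := Suc (\<beta> j))) (F k)"]) (auto simp: A)
  next
    fix A and N :: nat assume "A \<in> {\<lambda>k. deriv_xi \<beta> (F k) | \<beta>. True}"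
    then obtain \<beta> where A: "A = (\<lambda>k. deriv_xi \<beta> (F k))" by blast
    \<comment> \<open>The exponent has to be positive, hence \<open>Suc N\<close>.\<close>
    from bounds[rule_format, of "2 * real (Suc N)" "\<lambda>_. 0" \<beta>]
    obtain C where C: "cmod (deriv_xi \<beta> (F k) \<xi>) \<le> C * dual_weight k \<xi> powr (- real (Suc N))" for k \<xi>
      by (auto simp: monomial_0 mult.assoc dual_weight_powr simp del: of_nat_Suc)
    have "dual_weight k \<xi> ^ N * cmod (A k \<xi>) \<le> C" for k \<xi>
    proof -
      let ?w = "dual_weight k \<xi>"
      have w: "1 \<le> ?w" by (rule one_le_dual_weight)
      have "?w ^ N * cmod (A k \<xi>) \<le> ?w ^ Suc N * cmod (A k \<xi>)"
        using w by (intro mult_right_mono power_increasing) auto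
      also have "\<dots> \<le> ?w ^ Suc N * (C * ?w powr (- real (Suc N)))"
        unfolding A using w by (intro mult_left_mono C) auto
      also have "\<dots> = C"
        using w by (simp add: powr_minus powr_realpow del: of_nat_Suc power_Suc)
      finally show ?thesis .
    qed
    then show "\<exists>C. \<forall>k \<xi>. dual_weight k \<xi> ^ N * cmod (A k \<xi>) \<le> C"
      by blast
  qed
qed

theorem proposition2p3:
  fixes f :: "(real^'m::finite) \<times> (real^'n::finite) \<Rightarrow> complex"
  assumes "f \<in> smooth_TR \<inter> L1_TR"
  shows "f \<in> schwartz_TR \<longleftrightarrow>
    (\<forall>k :: int^'m. smooth (mixed_fourier f k)) \<and>
    (\<forall>(\<beta> :: 'n \<Rightarrow> nat) (\<gamma> :: 'n \<Rightarrow> nat) (N :: real). N > 0 \<longrightarrow>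
      (\<exists>C > 0. \<forall>(k :: int^'m) (\<xi> :: real^'n).
        cmod (of_real (monomial \<xi> \<gamma>) * deriv_xi \<beta> (mixed_fourier f k) \<xi>)
          \<le> C * (1 + (norm (real_vec k))\<^sup>2) powr (- N / 2) * (1 + (norm \<xi>)\<^sup>2) powr (- N / 2)))"
proof -
  have smooth: "f \<in> smooth_TR" and int: "set_integrable lborel period_cell f"
    and per: "torus_periodic f" and cont: "continuous_on UNIV f"
    using assms by (auto simp: smooth_TR_def L1_TR_def smooth_imp_continuous)
  have "f \<in> schwartz_TR \<longleftrightarrow> rapid dual_weight (mixed_fourier f)"
    unfolding schwartz_TR_iff_rapid_TR[OF smooth]
  proof
    assume "f \<in> rapid_TR"
    then show "rapid dual_weight (mixed_fourier f)"
      by (rule rapid_mixed_fourier)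
  next
    assume F: "rapid dual_weight (mixed_fourier f)"
    have "inverse_fourier (mixed_fourier f) = (\<lambda>_. f)"
      by (intro ext inverse_fourier_mixed_fourier cont per int F)
    with rapid_inverse_fourier[OF F] per show "f \<in> rapid_TR"
      by (simp add: rapid_TR_def)
  qed
  then show ?thesis
    unfolding rapid_dual_iff .
qed

end
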